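(* Consider the $n$-class queueing system of the context, with class $k$ Poisson arrivals at rate $\lambda_k$ and class $k$ job joint distribution $(R_k,\vec A_k)$. If $\rho=\sum_{k=1}^n\lambda_k\mathbb E[R_k]<1$, then the system is stable (positive recurrent).
   Context: Model: a single server; job classes $1,\dots,n$. Class $i$ jobs arrive according to independent Poisson processes of rates $\lambda_i>0$; original sizes of class $i$ jobs are i.i.d. with positive distribution $S_i$. Scheduling is preemptive priority (lower index = higher priority, FCFS within class, preempt-resume) with preemption overhead: when a class $k$ job in service is preempted by the arrival of a class $<k$ job, a nonpreemptible class $k$ pause (length $\sim C_k$) begins; whenever a job or pause completes and jobs remain, the best-priority job is identified and, if it is a previously paused class $k$ job, a nonpreemptible class $k$ resume (length $\sim D_k$) begins, else that job starts service; when a class $k$ resume completes, if a class $<k$ job arrived during it the resume fails and a class $k$ pause begins, otherwise the job continues service. Overhead lengths are i.i.d. and independent of everything else. A class $k$ job's pauses and resumes are attributed to it: its effective size $R_k$ is its original size plus the total length of its pauses and resumes, and $A_{k,i}$ is the number of class $i$ arrivals during its effective service time; $\vec A_k=(A_{k,1},\dots,A_{k,n})$. $\rho$ is called the total effective load. *)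

theory Defs
  imports "HOL-Probability.Probability"
begin

text \<open>Sample-path model of the n-class preemptive priority queue with preemption
overhead. Classes are numbered 0,...,n-1 (class 0 = highest priority = class 1 of
the paper). A job is a pair (class, index within class); within a class jobs are
indexed in arrival order.\<close>

text \<open>Primitive random inputs: interarrival times IA i m (m-th interarrival of class i),
original sizes Sz i m, the p-th pause length Ps k m p and the p-th resume length
Rs k m p of job (k,m).\<close>
datatype src = IA nat nat | Sz nat nat | Ps nat nat nat | Rs nat nat nat

type_synonym job = "nat \<times> nat"

text \<open>What the server is doing: idle, serving a job, pausing a job (remaining
pause time), resuming a job (remaining resume time, flag: a higher priority job
arrived during this resume).\<close>
datatype act = Idle | Serve job | Pausing job real | Resuming job real bool

record qstate =
  time :: real
  cnt :: "nat \<Rightarrow> nat"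
  present :: "job set"
  rem :: "job \<Rightarrow> real"
  eff :: "job \<Rightarrow> real"
  npause :: "job \<Rightarrow> nat"
  nresume :: "job \<Rightarrow> nat"
  paused :: "job set"
  completed :: "job set"
  act :: act

definition arrival_time :: "(src \<Rightarrow> real) \<Rightarrow> nat \<Rightarrow> nat \<Rightarrow> real" where
  "arrival_time x i m = (\<Sum>l\<le>m. x (IA i l))"

definition next_arr :: "nat \<Rightarrow> (src \<Rightarrow> real) \<Rightarrow> qstate \<Rightarrow> real" where
  "next_arr n x s = Min ((\<lambda>i. arrival_time x i (cnt s i)) ` {..<n})"

definition next_cls :: "nat \<Rightarrow> (src \<Rightarrow> real) \<Rightarrow> qstate \<Rightarrow> nat" where
  "next_cls n x s = (LEAST i. i < n \<and> arrival_time x i (cnt s i) = next_arr n x s)"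

definition best :: "job set \<Rightarrow> job" where
  "best P = (let k = Min (fst ` P) in (k, Min {m. (k, m) \<in> P}))"

definition act_end :: "qstate \<Rightarrow> real option" where
  "act_end s = (case act s of Idle \<Rightarrow> None
     | Serve j \<Rightarrow> Some (time s + rem s j)
     | Pausing j r \<Rightarrow> Some (time s + r)
     | Resuming j r f \<Rightarrow> Some (time s + r))"

text \<open>Let time elapse up to t (no event in between); work done is attributed to the
job concerned (service, pause or resume time all count towards its effective size).\<close>
definition advance :: "qstate \<Rightarrow> real \<Rightarrow> qstate" where
  "advance s t = (let d = t - time s in case act s of
       Idle \<Rightarrow> s\<lparr>time := t\<rparr>
     | Serve j \<Rightarrow> s\<lparr>time := t, rem := (rem s)(j := rem s j - d), eff := (eff s)(j := eff s j + d)\<rparr>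
     | Pausing j r \<Rightarrow> s\<lparr>time := t, eff := (eff s)(j := eff s j + d), act := Pausing j (r - d)\<rparr>
     | Resuming j r f \<Rightarrow> s\<lparr>time := t, eff := (eff s)(j := eff s j + d), act := Resuming j (r - d) f\<rparr>)"

definition start_pause :: "(src \<Rightarrow> real) \<Rightarrow> job \<Rightarrow> qstate \<Rightarrow> qstate" where
  "start_pause x j s = s\<lparr>act := Pausing j (x (Ps (fst j) (snd j) (npause s j))),
      npause := (npause s)(j := Suc (npause s j)), paused := insert j (paused s)\<rparr>"

definition dispatch :: "(src \<Rightarrow> real) \<Rightarrow> qstate \<Rightarrow> qstate" where
  "dispatch x s = (if present s = {} then s\<lparr>act := Idle\<rparr>
     else let j = best (present s) in
       if j \<in> paused s then
         s\<lparr>act := Resuming j (x (Rs (fst j) (snd j) (nresume s j))) False,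
           nresume := (nresume s)(j := Suc (nresume s j))\<rparr>
       else s\<lparr>act := Serve j\<rparr>)"

definition arrive :: "(src \<Rightarrow> real) \<Rightarrow> nat \<Rightarrow> qstate \<Rightarrow> qstate" where
  "arrive x i s = (let j = (i, cnt s i);
      s1 = s\<lparr>cnt := (cnt s)(i := Suc (cnt s i)), present := insert j (present s),
             rem := (rem s)(j := x (Sz i (cnt s i))), eff := (eff s)(j := 0)\<rparr>
    in case act s1 of
       Idle \<Rightarrow> dispatch x s1
     | Serve j' \<Rightarrow> (if i < fst j' then start_pause x j' s1 else s1)
     | Pausing j' r \<Rightarrow> s1
     | Resuming j' r f \<Rightarrow> s1\<lparr>act := Resuming j' r (f \<or> i < fst j')\<rparr>)"

definition complete :: "(src \<Rightarrow> real) \<Rightarrow> qstate \<Rightarrow> qstate" where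
  "complete x s = (case act s of
       Idle \<Rightarrow> s
     | Serve j \<Rightarrow> dispatch x (s\<lparr>present := present s - {j}, completed := insert j (completed s),
                                rem := (rem s)(j := 0)\<rparr>)
     | Pausing j r \<Rightarrow> dispatch x s
     | Resuming j r f \<Rightarrow> (if f then start_pause x j s
                           else s\<lparr>act := Serve j, paused := paused s - {j}\<rparr>))"

definition step :: "nat \<Rightarrow> (src \<Rightarrow> real) \<Rightarrow> qstate \<Rightarrow> qstate" where
  "step n x s = (let ta = next_arr n x s; i = next_cls n x s in
     case act_end s of
       None \<Rightarrow> arrive x i (advance s ta)
     | Some te \<Rightarrow> (if ta \<le> te then arrive x i (advance s ta) else complete x (advance s te)))"

definition init_state :: qstate where
  "init_state = \<lparr>time = 0, cnt = (\<lambda>_. 0), present = {}, rem = (\<lambda>_. 0), eff = (\<lambda>_. 0),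
     npause = (\<lambda>_. 0), nresume = (\<lambda>_. 0), paused = {}, completed = {}, act = Idle\<rparr>"

definition sys :: "nat \<Rightarrow> (src \<Rightarrow> real) \<Rightarrow> nat \<Rightarrow> qstate" where
  "sys n x e = (step n x ^^ e) init_state"

definition eff_size :: "nat \<Rightarrow> (src \<Rightarrow> real) \<Rightarrow> job \<Rightarrow> ennreal" where
  "eff_size n x j = (if \<exists>e. j \<in> completed (sys n x e)
      then ennreal (eff (sys n x (LEAST e. j \<in> completed (sys n x e))) j) else \<infinity>)"

text \<open>Regeneration cycle length: first time after time 0 (at which the system is
empty) that the system is empty again after the first arrival; infinite if never.\<close>
definition return_time :: "nat \<Rightarrow> (src \<Rightarrow> real) \<Rightarrow> ennreal" where
  "return_time n x = (if \<exists>e>0. present (sys n x e) = {}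
      then ennreal (time (sys n x (LEAST e. e > 0 \<and> present (sys n x e) = {}))) else \<infinity>)"

text \<open>Total effective load: rho = sum_k lambda_k E[R_k], with R_k the effective
size of a class k job (here: the first class k job).\<close>
definition eff_load :: "'a measure \<Rightarrow> nat \<Rightarrow> (nat \<Rightarrow> real) \<Rightarrow> (src \<Rightarrow> 'a \<Rightarrow> real) \<Rightarrow> ennreal" where
  "eff_load M n lam X = (\<Sum>k<n. ennreal (lam k) * (\<integral>\<^sup>+ \<omega>. eff_size n (\<lambda>s. X s \<omega>) (k, 0) \<partial>M))"

definition positive_recurrent :: "'a measure \<Rightarrow> nat \<Rightarrow> (src \<Rightarrow> 'a \<Rightarrow> real) \<Rightarrow> bool" where
  "positive_recurrent M n X \<longleftrightarrow> (\<integral>\<^sup>+ \<omega>. return_time n (\<lambda>s. X s \<omega>) \<partial>M) < \<infinity>"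

end

theory Submission
  imports Defs
begin

text \<open>Let \<open>b\<close> be the expected time of the system stopped at its first return to the empty state and after
  \<open>e\<close> events. Until then the server is always working on somebody's effective size, so the elapsed time is
  at most the first arrival time plus the effective sizes of all jobs that arrived. Arrivals are Poisson, so
  class \<open>k\<close> has \<open>\<lambda>\<^sub>k b\<close> of them on average (Wald), and each contributes at most \<open>E R\<^sub>k\<close>; hence
  \<open>b \<le> c + \<rho> b\<close>, that is \<open>b \<le> c / (1 - \<rho>)\<close>, uniformly in \<open>e\<close>. As the number of events is at most linear in
  the number of arrivals, letting \<open>e\<close> tend to infinity shows that the return time is integrable.

  That every job has at most the mean effective size of the first one of its class rests on memorylessness:
  whenever a job's service or resume starts, the residual interarrival times are fresh exponentials.
  For \<open>\<theta> > 0\<close> the conditional expectation of \<open>exp (- \<theta> R)\<close> given the current state is therefore a bounded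
  martingale whose initial mean is the same for all jobs of a class; \<open>\<theta> \<rightarrow> 0\<close> gives the means.\<close>

subsection \<open>Invariants of the trajectory\<close>

text \<open>An effective size may be infinite, and each job meets a different state on arrival, so
  neither integrability nor a common law of the effective sizes of a class is given beforehand.
  Transforms are bounded by one, which settles the first point. For the second, only higher priority
  arrivals during the job's own service and resumes matter; the clocks of those classes are fresh
  whenever such a period begins, and a resume and the service following it form one period.

  The initial value of the martingale does not depend on how the system is stopped. The same
  constant is therefore compared with the effective size in the unstopped system and with the work
  done on each job before the first return. Both comparisons are inequalities in the useful
  direction: a job that never completes only lowers the expected transform of the completed size,
  and the work done so far is at most the final one.

  Random indices are avoided: stopping uses absorbing states, and memorylessness is applied at fixed
  event numbers. The constant \<open>c\<close> is the mean of the first class 0 arrival time, which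
  bounds the first arrival.\<close>

declare split_paired_All [simp del] split_paired_Ex [simp del]

text \<open>Stopping is modelled by absorbing states instead of a random index, so every stopped
  quantity is evaluated after a deterministic number of events. The rule
  \<open>\<lambda>_. False\<close> gives back the original system.\<close>

definition halting_step :: "(qstate \<Rightarrow> bool) \<Rightarrow> nat \<Rightarrow> (src \<Rightarrow> real) \<Rightarrow> qstate \<Rightarrow> qstate" where
  "halting_step Q n x s = (if Q s then s else step n x s)"

definition run :: "(qstate \<Rightarrow> bool) \<Rightarrow> nat \<Rightarrow> (src \<Rightarrow> real) \<Rightarrow> nat \<Rightarrow> qstate" where
  "run Q n x e = (halting_step Q n x ^^ e) init_state"

lemma run_0 [simp]: "run Q n x 0 = init_state"
  by (simp add: run_def)

lemma run_Suc: "run Q n x (Suc e) = halting_step Q n x (run Q n x e)"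
  by (simp add: run_def)

lemma sys_eq_run: "sys n x e = run (\<lambda>_. False) n x e"
proof -
  have "halting_step (\<lambda>_. False) n x = step n x" by (auto simp: halting_step_def)
  then show ?thesis by (simp add: sys_def run_def)
qed

text \<open>The clauses \<open>counts\<close> and \<open>fresh\<close> tie the number of the next
  pause to the number of resumes: a paused job that is not being resumed has had one more pause than
  resumes, a job being resumed equally many, and a job awaiting its first service none. The
  transforms below are indexed by these numbers.\<close>

locale wf_state =
  fixes n :: nat and s :: qstate
  assumes finite: "finite (present s)"
    and arrived: "j \<in> present s \<or> j \<in> completed s \<longleftrightarrow> snd j < cnt s (fst j)"
    and disjoint: "present s \<inter> completed s = {}"
    and classes: "i \<ge> n \<Longrightarrow> cnt s i = 0"
    and paused_present: "paused s \<subseteq> present s"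
    and counts: "npause s j = (if j \<in> paused s \<and> \<not> (\<exists>r f. act s = Resuming j r f) then Suc (nresume s j) else nresume s j)"
    and fresh: "j \<notin> paused s \<Longrightarrow> j \<notin> completed s \<Longrightarrow> act s \<noteq> Serve j \<Longrightarrow> npause s j = 0"
    and serve: "act s = Serve j \<Longrightarrow> j \<in> present s \<and> j \<notin> paused s"
    and pausing: "act s = Pausing j r \<Longrightarrow> j \<in> paused s"
    and resuming: "act s = Resuming j r f \<Longrightarrow> j \<in> paused s"
    and idle: "act s = Idle \<Longrightarrow> present s = {}"

lemmas wf_stateI = wf_state.intro
lemmas wf_stateD = wf_state.finite wf_state.arrived wf_state.disjoint wf_state.classes wf_state.paused_present
  wf_state.counts wf_state.fresh wf_state.serve wf_state.pausing wf_state.resuming wf_state.idle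

lemma best_in:
  assumes "finite P" "P \<noteq> {}"
  shows "best P \<in> P"
proof -
  let ?k = "Min (fst ` P)"
  have "?k \<in> fst ` P" using assms by (intro Min_in) auto
  then obtain m where m: "(?k, m) \<in> P" by force
  have "finite {m. (?k, m) \<in> P}"
    using finite_vimageI[OF assms(1), of "Pair ?k"] by (simp add: inj_on_def vimage_def)
  then have "Min {m. (?k, m) \<in> P} \<in> {m. (?k, m) \<in> P}" using m by (intro Min_in) auto
  then show ?thesis by (simp add: best_def Let_def)
qed

lemma next_cls:
  assumes "0 < n"
  shows "next_cls n x s < n" "arrival_time x (next_cls n x s) (cnt s (next_cls n x s)) = next_arr n x s"
proof -
  have "next_arr n x s \<in> (\<lambda>i. arrival_time x i (cnt s i)) ` {..<n}"
    unfolding next_arr_def using assms by (intro Min_in) auto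
  then have "\<exists>i. i < n \<and> arrival_time x i (cnt s i) = next_arr n x s" by auto
  from LeastI_ex[OF this] show "next_cls n x s < n"
    "arrival_time x (next_cls n x s) (cnt s (next_cls n x s)) = next_arr n x s"
    by (auto simp: next_cls_def)
qed

lemma next_arr_le: "i < n \<Longrightarrow> next_arr n x s \<le> arrival_time x i (cnt s i)"
  unfolding next_arr_def by (intro Min_le) auto

lemma advance_simps [simp]:
  "cnt (advance s t) = cnt s" "present (advance s t) = present s" "npause (advance s t) = npause s"
  "nresume (advance s t) = nresume s" "paused (advance s t) = paused s" "completed (advance s t) = completed s"
  "time (advance s t) = t"
  "act (advance s t) = (case act s of Idle \<Rightarrow> Idle | Serve j \<Rightarrow> Serve j
     | Pausing j r \<Rightarrow> Pausing j (r - (t - time s)) | Resuming j r f \<Rightarrow> Resuming j (r - (t - time s)) f)"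
  "rem (advance s t) = (case act s of Serve j \<Rightarrow> (rem s)(j := rem s j - (t - time s)) | _ \<Rightarrow> rem s)"
  "eff (advance s t) = (case act s of Idle \<Rightarrow> eff s | Serve j \<Rightarrow> (eff s)(j := eff s j + (t - time s))
     | Pausing j r \<Rightarrow> (eff s)(j := eff s j + (t - time s)) | Resuming j r f \<Rightarrow> (eff s)(j := eff s j + (t - time s)))"
  by (auto simp: advance_def Let_def split: act.splits)

lemma wf_advance [simp]: "wf_state n (advance s t) = wf_state n s"
  unfolding wf_state_def by (cases "act s") (simp_all)

lemma dispatch_simps [simp]:
  "time (dispatch x s) = time s" "cnt (dispatch x s) = cnt s" "present (dispatch x s) = present s"
  "rem (dispatch x s) = rem s" "eff (dispatch x s) = eff s" "npause (dispatch x s) = npause s"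
  "paused (dispatch x s) = paused s" "completed (dispatch x s) = completed s"
  by (auto simp: dispatch_def Let_def)

lemma dispatch_act: "act (dispatch x s) = (if present s = {} then Idle else
    if best (present s) \<in> paused s
    then Resuming (best (present s)) (x (Rs (fst (best (present s))) (snd (best (present s))) (nresume s (best (present s))))) False
    else Serve (best (present s)))"
  by (auto simp: dispatch_def Let_def)

lemma dispatch_nresume: "nresume (dispatch x s) = (if present s \<noteq> {} \<and> best (present s) \<in> paused s
    then (nresume s)(best (present s) := Suc (nresume s (best (present s)))) else nresume s)"
  by (auto simp: dispatch_def Let_def)

lemma start_pause_simps [simp]:
  "time (start_pause x j s) = time s" "cnt (start_pause x j s) = cnt s" "present (start_pause x j s) = present s"
  "rem (start_pause x j s) = rem s" "eff (start_pause x j s) = eff s"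
  "nresume (start_pause x j s) = nresume s" "completed (start_pause x j s) = completed s"
  "npause (start_pause x j s) = (npause s)(j := Suc (npause s j))"
  "paused (start_pause x j s) = insert j (paused s)"
  "act (start_pause x j s) = Pausing j (x (Ps (fst j) (snd j) (npause s j)))"
  by (auto simp: start_pause_def)

definition admit :: "(src \<Rightarrow> real) \<Rightarrow> nat \<Rightarrow> qstate \<Rightarrow> qstate" where
  "admit x i s = s\<lparr>cnt := (cnt s)(i := Suc (cnt s i)), present := insert (i, cnt s i) (present s),
     rem := (rem s)((i, cnt s i) := x (Sz i (cnt s i))), eff := (eff s)((i, cnt s i) := 0)\<rparr>"

lemma admit_simps [simp]:
  "time (admit x i s) = time s" "cnt (admit x i s) = (cnt s)(i := Suc (cnt s i))"
  "present (admit x i s) = insert (i, cnt s i) (present s)" "completed (admit x i s) = completed s"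
  "rem (admit x i s) = (rem s)((i, cnt s i) := x (Sz i (cnt s i)))"
  "eff (admit x i s) = (eff s)((i, cnt s i) := 0)" "act (admit x i s) = act s"
  "npause (admit x i s) = npause s" "nresume (admit x i s) = nresume s" "paused (admit x i s) = paused s"
  by (simp_all add: admit_def)

lemma arrive_eq: "arrive x i s = (case act s of
     Idle \<Rightarrow> dispatch x (admit x i s)
   | Serve j \<Rightarrow> if i < fst j then start_pause x j (admit x i s) else admit x i s
   | Pausing j r \<Rightarrow> admit x i s
   | Resuming j r f \<Rightarrow> (admit x i s)\<lparr>act := Resuming j r (f \<or> i < fst j)\<rparr>)"
  by (simp add: arrive_def admit_def Let_def split: act.split)

text \<open>Here \<open>s\<close> is an intermediate state whose \<open>act\<close> is obsolete and
  about to be overwritten. The hypotheses are the clauses of \<open>wf_state\<close> in the form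
  they take when no job is being served or resumed.\<close>

lemma wf_dispatch:
  assumes "finite (present s)" "\<And>j. j \<in> present s \<or> j \<in> completed s \<longleftrightarrow> snd j < cnt s (fst j)"
    "present s \<inter> completed s = {}" "\<And>i. i \<ge> n \<Longrightarrow> cnt s i = 0" "paused s \<subseteq> present s"
    "\<And>j. npause s j = (if j \<in> paused s then Suc (nresume s j) else nresume s j)"
    "\<And>j. j \<notin> paused s \<Longrightarrow> j \<notin> completed s \<Longrightarrow> npause s j = 0"
  shows "wf_state n (dispatch x s)"
proof (rule wf_stateI)
  let ?b = "best (present s)"
  have b: "?b \<in> present s" if "present s \<noteq> {}" using assms(1) that best_in by blast
  show "npause (dispatch x s) j = (if j \<in> paused (dispatch x s) \<and> \<not> (\<exists>r f. act (dispatch x s) = Resuming j r f)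
      then Suc (nresume (dispatch x s) j) else nresume (dispatch x s) j)" for j
    using assms(5) assms(6)[of j] by (cases "j = ?b") (auto simp: dispatch_act dispatch_nresume)
  show "npause (dispatch x s) j = 0" if "j \<notin> paused (dispatch x s)" "j \<notin> completed (dispatch x s)" for j
    using assms(7)[of j] that by simp
  show "j \<in> present (dispatch x s) \<and> j \<notin> paused (dispatch x s)" if "act (dispatch x s) = Serve j" for j
    using b that by (simp add: dispatch_act split: if_splits)
qed (use assms(1-5) in \<open>simp_all add: dispatch_act split: if_splits\<close>)

lemma wf_start_pause:
  assumes w: "wf_state n s" and a: "act s = Serve j \<or> (\<exists>r f. act s = Resuming j r f)"
  shows "wf_state n (start_pause x j s)"
proof (rule wf_stateI)
  note W = wf_stateD[OF w]
  show "npause (start_pause x j s) j' = (if j' \<in> paused (start_pause x j s) \<and> \<not> (\<exists>r f. act (start_pause x j s) = Resuming j' r f)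
      then Suc (nresume (start_pause x j s) j') else nresume (start_pause x j s) j')" for j'
    using W(6)[of j'] W(8)[of j] a by (cases "j' = j") auto
  show "npause (start_pause x j s) j' = 0" if "j' \<notin> paused (start_pause x j s)" "j' \<notin> completed (start_pause x j s)" for j'
    using W(7)[of j'] a that by auto
  show "paused (start_pause x j s) \<subseteq> present (start_pause x j s)"
    using W(5) W(8)[of j] W(10)[of j] a by auto
qed (use wf_stateD(1-4)[OF w] in simp_all)

lemma wf_complete:
  assumes w: "wf_state n s"
  shows "wf_state n (complete x s)"
proof -
  note W = wf_stateD[OF w]
  show ?thesis
proof (cases "act s")
  case Idle
  then show ?thesis using w by (simp add: complete_def)
next
  case (Serve j)
  have "wf_state n (dispatch x (s\<lparr>present := present s - {j}, completed := insert j (completed s), rem := (rem s)(j := 0)\<rparr>))"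
  proof (rule wf_dispatch, goal_cases)
    case (2 j') then show ?case using W(2)[of j'] W(8)[OF Serve] by auto
  next
    case (3) then show ?case using W(3) by auto
  next
    case 5 then show ?case using W(5) W(8)[OF Serve] by auto
  next
    case (6 j') then show ?case using W(6)[of j'] Serve by simp
  next
    case (7 j') then show ?case using W(7)[of j'] Serve by auto
  qed (use W(1,4) in simp_all)
  then show ?thesis using Serve by (simp add: complete_def)
next
  case (Pausing j r)
  have "wf_state n (dispatch x s)"
  proof (rule wf_dispatch[OF W(1-5)])
    show "npause s j = (if j \<in> paused s then Suc (nresume s j) else nresume s j)" for j
      using W(6)[of j] Pausing by simp
    show "npause s j = 0" if "j \<notin> paused s" "j \<notin> completed s" for j
      using W(7)[of j] Pausing that by simp
  qed
  then show ?thesis using Pausing by (simp add: complete_def)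
next
  case (Resuming j r f)
  have "wf_state n (s\<lparr>act := Serve j, paused := paused s - {j}\<rparr>)"
  proof (rule wf_stateI, goal_cases)
    case (6 j') then show ?case using W(6)[of j'] Resuming by auto
  next
    case (7 j') then show ?case using W(7)[of j'] Resuming by auto
  next
    case (8 j') then show ?case using W(5) W(10)[OF Resuming] by auto
  qed (use W(1-5) in auto)
  moreover have "wf_state n (start_pause x j s)" by (rule wf_start_pause[OF w]) (simp add: Resuming)
  ultimately show ?thesis using Resuming by (simp add: complete_def)
qed
qed

lemma wf_Resuming:
  assumes "wf_state n s" "act s = Resuming j r f"
  shows "wf_state n (s\<lparr>act := Resuming j r' f'\<rparr>)"
  using assms unfolding wf_state_def by auto

lemma wf_arrive:
  assumes w: "wf_state n s" and i: "i < n"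
  shows "wf_state n (arrive x i s)"
proof -
  define j where "j = (i, cnt s i)"
  define s1 where "s1 = admit x i s"
  have "\<not> (j \<in> present s \<or> j \<in> completed s)" "paused s \<subseteq> present s"
    using w unfolding wf_state_def by (simp_all add: j_def)
  then have new: "j \<notin> present s" "j \<notin> completed s" "j \<notin> paused s" by auto
  have np: "act s \<noteq> Serve j" using new w unfolding wf_state_def by auto
  have arrj: "(snd j' < (if fst j' = i then Suc (cnt s i) else cnt s (fst j'))) \<longleftrightarrow> j' = j \<or> snd j' < cnt s (fst j')" for j'
    by (cases j') (auto simp: j_def)
  note W = wf_stateD[OF w]
  have s1: "cnt s1 = (cnt s)(i := Suc (cnt s i))" "present s1 = insert j (present s)" "completed s1 = completed s"
    "paused s1 = paused s" "npause s1 = npause s" "nresume s1 = nresume s" "act s1 = act s"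
    by (simp_all add: s1_def j_def)
  have S: "finite (present s1)" "\<And>j. j \<in> present s1 \<or> j \<in> completed s1 \<longleftrightarrow> snd j < cnt s1 (fst j)"
    "present s1 \<inter> completed s1 = {}" "\<And>i. i \<ge> n \<Longrightarrow> cnt s1 i = 0" "paused s1 \<subseteq> present s1"
    "\<And>j. act s1 = Serve j \<Longrightarrow> j \<in> present s1 \<and> j \<notin> paused s1"
    unfolding s1 using W(1-5,8) new i by (auto simp: arrj)
  have w1: "wf_state n s1" if "act s \<noteq> Idle"
  proof (rule wf_stateI[OF S(1-5) _ _ S(6)])
    show "npause s1 j = (if j \<in> paused s1 \<and> \<not> (\<exists>r f. act s1 = Resuming j r f) then Suc (nresume s1 j) else nresume s1 j)" for j
      unfolding s1 by (rule W(6))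
    show "npause s1 j = 0" if "j \<notin> paused s1" "j \<notin> completed s1" "act s1 \<noteq> Serve j" for j
      using W(7)[of j] that unfolding s1 by simp
    show "j \<in> paused s1" if "act s1 = Pausing j r" for j r
      using W(9)[of j r] that unfolding s1 by simp
    show "j \<in> paused s1" if "act s1 = Resuming j r f" for j r f
      using W(10)[of j r f] that unfolding s1 by simp
    show "present s1 = {}" if "act s1 = Idle"
      using that \<open>act s \<noteq> Idle\<close> unfolding s1 by simp
  qed
  have w2: "wf_state n (dispatch x s1)" if "act s = Idle"
  proof (rule wf_dispatch[OF S(1-5)])
    show "npause s1 j = (if j \<in> paused s1 then Suc (nresume s1 j) else nresume s1 j)" for j
      unfolding s1 using W(6)[of j] that by simp
    show "npause s1 j = 0" if "j \<notin> paused s1" "j \<notin> completed s1" for j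
      using W(7)[of j] that \<open>act s = Idle\<close> unfolding s1 by simp
  qed
  note eq = arrive_eq[of x i s, folded s1_def]
  have a1: "act s1 = act s" by (simp add: s1_def)
  show ?thesis
  proof (cases "act s")
    case Idle
    show ?thesis unfolding eq using w2[OF Idle] by (simp add: Idle)
  next
    case (Serve j')
    have "wf_state n (start_pause x j' s1)" by (intro wf_start_pause w1) (simp_all add: a1 Serve)
    then show ?thesis unfolding eq using w1 by (simp add: Serve)
  next
    case (Pausing j' r)
    show ?thesis unfolding eq using w1 by (simp add: Pausing)
  next
    case (Resuming j' r f)
    have "wf_state n (s1\<lparr>act := Resuming j' r (f \<or> i < fst j')\<rparr>)"
      by (rule wf_Resuming[OF w1]) (simp_all add: a1 Resuming)
    then show ?thesis unfolding eq by (simp add: Resuming)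
  qed
qed

lemma wf_step:
  assumes "wf_state n s" "0 < n"
  shows "wf_state n (step n x s)"
proof -
  have "wf_state n (arrive x (next_cls n x s) (advance s t))" "wf_state n (complete x (advance s t))" for t
    using assms by (auto intro: wf_arrive wf_complete next_cls(1))
  then show ?thesis by (simp add: step_def Let_def split: option.split)
qed

lemma wf_init: "wf_state n init_state"
  by (rule wf_stateI) (simp_all add: init_state_def)

lemma wf_run: "0 < n \<Longrightarrow> wf_state n (run Q n x e)"
  by (induction e) (simp_all add: wf_init run_Suc halting_step_def wf_step)

lemma step_cases:
  obtains (arrival) "step n x s = arrive x (next_cls n x s) (advance s (next_arr n x s))"
      "\<And>te. act_end s = Some te \<Longrightarrow> next_arr n x s \<le> te"
  | (completion) te where "act_end s = Some te" "te < next_arr n x s" "step n x s = complete x (advance s te)"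
proof (cases "act_end s")
  case None
  then show ?thesis using arrival by (simp add: step_def Let_def)
next
  case (Some te)
  then show ?thesis using arrival completion[of te] by (cases "next_arr n x s \<le> te") (auto simp: step_def Let_def)
qed

lemma arrive_simps [simp]:
  "time (arrive x i s) = time s" "cnt (arrive x i s) = (cnt s)(i := Suc (cnt s i))"
  "present (arrive x i s) = insert (i, cnt s i) (present s)" "completed (arrive x i s) = completed s"
  "rem (arrive x i s) = (rem s)((i, cnt s i) := x (Sz i (cnt s i)))"
  "eff (arrive x i s) = (eff s)((i, cnt s i) := 0)"
  by (auto simp: arrive_def Let_def split: act.split)

lemma complete_simps [simp]:
  "time (complete x s) = time s" "cnt (complete x s) = cnt s" "eff (complete x s) = eff s"
  "completed (complete x s) = (case act s of Serve j \<Rightarrow> insert j (completed s) | _ \<Rightarrow> completed s)"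
  "present (complete x s) = (case act s of Serve j \<Rightarrow> present s - {j} | _ \<Rightarrow> present s)"
  "rem (complete x s) = (case act s of Serve j \<Rightarrow> (rem s)(j := 0) | _ \<Rightarrow> rem s)"
  by (auto simp: complete_def Let_def split: act.split)

lemma cnt_step:
  assumes "0 < n"
  shows "cnt s i \<le> cnt (step n x s) i"
  by (cases rule: step_cases[of n x s]) auto

lemma cnt_run_mono:
  assumes "0 < n" "e \<le> e'"
  shows "cnt (run Q n x e) i \<le> cnt (run Q n x e') i"
  using assms(2)
proof (induction rule: dec_induct)
  case (step e')
  then show ?case using cnt_step[OF assms(1), of "run Q n x e'" i x]
    by (auto simp: run_Suc halting_step_def)
qed simp

lemma present_arrived: "wf_state n s \<Longrightarrow> j \<in> present s \<Longrightarrow> snd j < cnt s (fst j) \<and> fst j < n"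
  using wf_stateD(2)[of n s j] wf_stateD(4)[of n s "fst j"] by (cases "fst j < n") auto

section \<open>Signs of the real components and timing of the arrivals\<close>

definition regular :: "nat \<Rightarrow> (src \<Rightarrow> real) \<Rightarrow> bool" where
  "regular n x \<longleftrightarrow> (\<forall>i<n. \<forall>m. 0 < x (IA i m) \<and> 0 < x (Sz i m) \<and> (\<forall>p. 0 \<le> x (Ps i m p) \<and> 0 \<le> x (Rs i m p)))"

text \<open>The clauses \<open>last_arrival\<close> and \<open>next_arrival\<close> locate the
  current time between two consecutive class \<open>i\<close> arrivals. The latter makes the
  residual clocks nonnegative, the former the threshold in the memorylessness argument.\<close>

locale consistent =
  fixes n :: nat and x :: "src \<Rightarrow> real" and s :: qstate
  assumes time_nonneg: "0 \<le> time s"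
    and next_arrival: "i < n \<Longrightarrow> time s \<le> arrival_time x i (cnt s i)"
    and last_arrival: "i < n \<Longrightarrow> 0 < cnt s i \<Longrightarrow> arrival_time x i (cnt s i - 1) \<le> time s"
    and rem_nonneg: "j \<in> present s \<Longrightarrow> 0 \<le> rem s j"
    and eff_nonneg: "0 \<le> eff s j"
    and pausing_nonneg: "act s = Pausing j r \<Longrightarrow> 0 \<le> r"
    and resuming_nonneg: "act s = Resuming j r f \<Longrightarrow> 0 \<le> r"

lemmas consistentI = consistent.intro
lemmas consistentD = consistent.time_nonneg consistent.next_arrival consistent.last_arrival consistent.rem_nonneg
  consistent.eff_nonneg consistent.pausing_nonneg consistent.resuming_nonneg

lemma consistent_advance:
  assumes w: "wf_state n s" and c: "consistent n x s" and t: "time s \<le> t" "t \<le> next_arr n x s"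
    and te: "\<And>te. act_end s = Some te \<Longrightarrow> t \<le> te"
  shows "consistent n x (advance s t)"
proof (rule consistentI)
  note C = consistentD[OF c]
  show "0 \<le> rem (advance s t) j" if "j \<in> present (advance s t)" for j
    using C(4)[of j] that te by (cases "act s") (auto simp: act_end_def)
  show "0 \<le> eff (advance s t) j" for j
    using C(5)[of j] t by (cases "act s") (auto)
  show "0 \<le> r" if "act (advance s t) = Pausing j r" for j r
    using te that by (cases "act s") (auto simp: act_end_def)
  show "0 \<le> r" if "act (advance s t) = Resuming j r f" for j r f
    using te that by (cases "act s") (auto simp: act_end_def)
  show "time (advance s t) \<le> arrival_time x i (cnt (advance s t) i)" if "i < n" for i
    using next_arr_le[OF that, of x s] t by simp
  show "arrival_time x i (cnt (advance s t) i - 1) \<le> time (advance s t)" if "i < n" "0 < cnt (advance s t) i" for i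
    using C(3)[of i] that t by simp
qed (use consistentD(1)[OF c] t in simp)

lemma consistent_dispatch:
  assumes fin: "finite (present s)" and arr: "\<And>j. j \<in> present s \<Longrightarrow> fst j < n"
    and r: "regular n x" and c: "consistent n x s"
  shows "consistent n x (dispatch x s)"
proof (rule consistentI)
  note C = consistentD[OF c]
  have b: "present s \<noteq> {} \<Longrightarrow> fst (best (present s)) < n" using arr best_in[OF fin] by blast
  show "0 \<le> r" if "act (dispatch x s) = Resuming j r f" for j r f
    using that r b unfolding regular_def by (auto simp: dispatch_act split: if_splits)
qed (use consistentD(1-5)[OF c] in \<open>auto simp: dispatch_act split: if_splits\<close>)

lemma consistent_start_pause:
  assumes "fst j < n" "regular n x" and c: "consistent n x s"
  shows "consistent n x (start_pause x j s)"
  by (rule consistentI) (use consistentD(1-5)[OF c] assms(1,2) in \<open>auto simp: regular_def\<close>)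

lemma consistent_complete:
  assumes w: "wf_state n s" and r: "regular n x" and c: "consistent n x s"
  shows "consistent n x (complete x s)"
proof (cases "act s")
  case Idle
  then show ?thesis using c by (simp add: complete_def)
next
  case (Serve j)
  have "consistent n x (dispatch x (s\<lparr>present := present s - {j}, completed := insert j (completed s), rem := (rem s)(j := 0)\<rparr>))"
  proof (rule consistent_dispatch[OF _ _ r])
    show "consistent n x (s\<lparr>present := present s - {j}, completed := insert j (completed s), rem := (rem s)(j := 0)\<rparr>)"
      by (rule consistentI) (use consistentD[OF c] Serve in \<open>auto\<close>)
  qed (use wf_stateD(1)[OF w] present_arrived[OF w] in auto)
  then show ?thesis using Serve by (simp add: complete_def)
next
  case (Pausing j r')
  then show ?thesis using consistent_dispatch[OF wf_stateD(1)[OF w] _ r c] present_arrived[OF w]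
    by (simp add: complete_def)
next
  case (Resuming j r' f)
  have "j \<in> present s" using wf_stateD(10)[OF w Resuming] wf_stateD(5)[OF w] by auto
  then have "fst j < n" using present_arrived[OF w] by blast
  then have 1: "consistent n x (start_pause x j s)" by (rule consistent_start_pause[OF _ r c])
  have 2: "consistent n x (s\<lparr>act := Serve j, paused := paused s - {j}\<rparr>)"
    by (rule consistentI) (use consistentD[OF c] Resuming in \<open>auto\<close>)
  show ?thesis using 1 2 Resuming by (simp add: complete_def)
qed

lemma arrival_time_Suc: "arrival_time x i (Suc m) = arrival_time x i m + x (IA i (Suc m))"
  by (simp add: arrival_time_def)

lemma consistent_arrive:
  assumes w: "wf_state n s" and r: "regular n x" and c: "consistent n x s" and i: "i < n"
    and t: "time s = arrival_time x i (cnt s i)"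
  shows "consistent n x (arrive x i s)"
proof -
  note C = consistentD[OF c]
  define s1 where "s1 = admit x i s"
  have "0 \<le> x (Sz i m)" "0 \<le> x (IA i m)" for m using r i unfolding regular_def by (auto intro: less_imp_le)
  then have c1: "consistent n x s1"
    by (intro consistentI) (use C t i in \<open>auto simp: s1_def arrival_time_Suc\<close>)
  note eq = arrive_eq[of x i s, folded s1_def]
  show ?thesis
  proof (cases "act s")
    case Idle
    have "consistent n x (dispatch x s1)"
      using wf_stateD(1)[OF w] present_arrived[OF w] i by (intro consistent_dispatch[OF _ _ r c1]) (auto simp: s1_def)
    then show ?thesis unfolding eq by (simp add: Idle)
  next
    case (Serve j')
    have "j' \<in> present s" using wf_stateD(8)[OF w Serve] by simp
    then have "consistent n x (start_pause x j' s1)"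
      using present_arrived[OF w] by (intro consistent_start_pause[OF _ r c1]) auto
    then show ?thesis unfolding eq using c1 by (simp add: Serve)
  next
    case (Pausing j' r)
    show ?thesis unfolding eq using c1 by (simp add: Pausing)
  next
    case (Resuming j' r f)
    have "consistent n x (s1\<lparr>act := Resuming j' r (f \<or> i < fst j')\<rparr>)"
      by (rule consistentI) (use consistentD[OF c1] Resuming in \<open>auto simp: s1_def\<close>)
    then show ?thesis unfolding eq by (simp add: Resuming)
  qed
qed

lemma next_arr_ge:
  assumes n: "0 < n" and "\<And>i. i < n \<Longrightarrow> a \<le> arrival_time x i (cnt s i)"
  shows "a \<le> next_arr n x s"
  using next_cls[OF n, of x s] assms(2) by metis

lemma time_le_act_end:
  assumes "wf_state n s" "consistent n x s" "act_end s = Some te"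
  shows "time s \<le> te"
  using assms(3) consistentD(4)[OF assms(2)] consistentD(6,7)[OF assms(2)] wf_stateD(8)[OF assms(1)]
  by (cases "act s") (auto simp: act_end_def)

lemma consistent_step:
  assumes n: "0 < n" and w: "wf_state n s" and r: "regular n x" and c: "consistent n x s"
  shows "consistent n x (step n x s)" "time s \<le> time (step n x s)"
proof -
  have t: "time s \<le> next_arr n x s" using next_arr_ge[OF n] consistentD(2)[OF c] by blast
  have "consistent n x (step n x s) \<and> time s \<le> time (step n x s)"
  proof (cases rule: step_cases[of n x s])
    case arrival
    have "consistent n x (advance s (next_arr n x s))"
      by (rule consistent_advance[OF w c t]) (use arrival in auto)
    then show ?thesis using arrival n next_cls[OF n, of x s] t w by (auto intro!: consistent_arrive[OF _ r])
  next
    case (completion te)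
    have "consistent n x (advance s te)"
      by (rule consistent_advance[OF w c]) (use completion time_le_act_end[OF w c] in auto)
    then show ?thesis using completion time_le_act_end[OF w c] w by (auto intro!: consistent_complete[OF _ r])
  qed
  then show "consistent n x (step n x s)" "time s \<le> time (step n x s)" by auto
qed

lemma consistent_init: "regular n x \<Longrightarrow> consistent n x init_state"
  by (rule consistentI) (auto simp: init_state_def arrival_time_def regular_def less_imp_le)

lemma consistent_run: "0 < n \<Longrightarrow> regular n x \<Longrightarrow> consistent n x (run Q n x e)"
  by (induction e) (simp_all add: consistent_init run_Suc halting_step_def consistent_step wf_run)

lemma time_run_mono:
  assumes "0 < n" "regular n x" "e \<le> e'"
  shows "time (run Q n x e) \<le> time (run Q n x e')"
  using assms(3)
proof (induction rule: dec_induct)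
  case (step e')
  then show ?case using consistent_step(2)[OF assms(1) wf_run[OF assms(1)] assms(2) consistent_run[OF assms(1,2)], of Q e'] assms
    by (auto simp: run_Suc halting_step_def intro: order_trans)
qed simp

text \<open>A completed job is not present and its index lies below the arrival count, so no
  activity attributes time to it and no admission resets its \<open>eff\<close>.\<close>

lemma completed_step:
  assumes w: "wf_state n s" and n: "0 < n" and j: "j \<in> completed s"
  shows "j \<in> completed (step n x s)" "eff (step n x s) j = eff s j"
proof -
  have 1: "j \<notin> present s" using wf_stateD(3)[OF w] j by auto
  have 2: "j \<noteq> (i, cnt s i)" for i using wf_stateD(2)[OF w, of j] j by auto
  have 3: "eff (advance s t) j = eff s j" for t
    using 1 wf_stateD(5)[OF w] wf_stateD(8,9,10)[OF w, of j] by (cases "act s") auto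
  show "j \<in> completed (step n x s)"
    by (cases rule: step_cases[of n x s]) (use j in \<open>auto split: act.split\<close>)
  show "eff (step n x s) j = eff s j"
    by (cases rule: step_cases[of n x s]) (use 2 3 in auto)
qed

lemma completed_run_mono:
  assumes "0 < n" "e \<le> e'" "j \<in> completed (run Q n x e)"
  shows "j \<in> completed (run Q n x e') \<and> eff (run Q n x e') j = eff (run Q n x e) j"
  using assms(2)
proof (induction rule: dec_induct)
  case (step e')
  then show ?case using completed_step[OF wf_run[OF assms(1)] assms(1), of j Q x e' x]
    by (auto simp: run_Suc halting_step_def)
qed (use assms in simp)

subsection \<open>Dependence on a single interarrival time\<close>

lemma arrive_IA [simp]: "arrive (x(IA i c := y)) = arrive x"
  by (intro ext) (auto simp: arrive_def dispatch_def start_pause_def Let_def split: act.split)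

lemma complete_IA [simp]: "complete (x(IA i c := y)) = complete x"
  by (intro ext) (auto simp: complete_def dispatch_def start_pause_def Let_def split: act.split)

lemma arrival_time_IA: "arrival_time (x(IA i c := y)) i' m =
    (if i' = i \<and> c \<le> m then arrival_time x i' m - x (IA i c) + y else arrival_time x i' m)"
proof (induction m)
  case 0
  then show ?case by (auto simp: arrival_time_def)
next
  case (Suc m)
  then show ?case by (auto simp: arrival_time_Suc le_Suc_eq)
qed

text \<open>Assumption \<open>2\<close> excludes an earlier arrival under \<open>x'\<close>, and
  assumption \<open>3\<close> excludes a new tie, which could move the least class attaining the
  minimum.\<close>

lemma next_arr_cls_eqI:
  assumes n: "0 < n" and 1: "i' < n" "i' = next_cls n x s" "arrival_time x' i' (cnt s i') = next_arr n x s"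
    and 2: "\<And>i. i < n \<Longrightarrow> next_arr n x s \<le> arrival_time x' i (cnt s i)"
    and 3: "\<And>i. i < n \<Longrightarrow> arrival_time x' i (cnt s i) = next_arr n x s \<Longrightarrow> arrival_time x i (cnt s i) = next_arr n x s"
  shows "next_arr n x' s = next_arr n x s" "next_cls n x' s = next_cls n x s"
proof -
  show eq: "next_arr n x' s = next_arr n x s"
    using next_arr_ge[OF n, of "next_arr n x s" x' s] 2 next_arr_le[OF 1(1), of x' s] 1(3) by auto
  show "next_cls n x' s = next_cls n x s"
  proof (rule antisym)
    show "next_cls n x' s \<le> next_cls n x s"
      unfolding next_cls_def[of n x' s] using 1 eq by (intro Least_le) auto
    show "next_cls n x s \<le> next_cls n x' s"
      unfolding next_cls_def[of n x s] using next_cls[OF n, of x' s] 3 eq by (intro Least_le) auto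
  qed
qed

text \<open>While arrival \<open>c\<close> is pending, its clock enters a step only by losing the
  comparison with the event that occurs. The last assumption ensures that it still loses under
  \<open>x'\<close>.\<close>

lemma step_agree:
  assumes n: "0 < n" and x': "x' = x(IA i c := y')" and c: "cnt (step n x s) i \<le> c"
    and y: "cnt s i = c \<Longrightarrow> arrival_time x i c \<le> arrival_time x' i c \<or> time (step n x s) < arrival_time x' i c"
  shows "step n x' s = step n x s"
proof -
  have c': "cnt s i \<le> c" using cnt_step[OF n, of s i x] c by simp
  have same: "arrival_time x' i' (cnt s i') = arrival_time x i' (cnt s i')" if "i' \<noteq> i \<or> cnt s i < c" for i'
    using that by (auto simp: x' arrival_time_IA)
  have F: "arrive x' = arrive x" "complete x' = complete x" by (simp_all add: x')
  show ?thesis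
  proof (cases "cnt s i < c")
    case True
    then have "next_arr n x' s = next_arr n x s" "next_cls n x' s = next_cls n x s"
      using same by (simp_all add: next_arr_def next_cls_def)
    then show ?thesis by (simp only: step_def F)
  next
    case False
    then have ci: "cnt s i = c" using c' by simp
    show ?thesis
    proof (cases rule: step_cases[of n x s])
      case arrival
      let ?i = "next_cls n x s"
      \<comment> \<open>If class \<open>i\<close> arrived in this step, its count would become
        \<open>Suc c\<close>.\<close>
      have ii: "?i \<noteq> i" using c ci arrival by auto
      have ti: "time (step n x s) = next_arr n x s" using arrival by simp
      have 1: "arrival_time x' ?i (cnt s ?i) = next_arr n x s"
        using next_cls(2)[OF n, of x s] same[of ?i] ii by simp
      have 2: "next_arr n x s \<le> arrival_time x' i' (cnt s i')" if "i' < n" for i'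
        using next_arr_le[OF that, of x s] y[OF ci] ti ci same[of i'] by (cases "i' = i") auto
      have 3: "arrival_time x i' (cnt s i') = next_arr n x s"
        if "i' < n" "arrival_time x' i' (cnt s i') = next_arr n x s" for i'
        using next_arr_le[OF that(1), of x s] that(2) y[OF ci] ti ci same[of i'] by (cases "i' = i") auto
      note next_arr_cls_eqI[OF n next_cls(1)[OF n] refl 1 2 3]
      then show ?thesis by (simp only: step_def F)
    next
      case (completion te)
      have ti: "time (step n x s) = te" using completion by simp
      have "te < arrival_time x' i' (cnt s i')" if "i' < n" for i'
        using next_arr_le[OF that, of x s] y[OF ci] ti ci same[of i'] completion by (cases "i' = i") auto
      then have "te < next_arr n x' s" using next_cls[OF n, of x' s] by metis
      then show ?thesis using completion by (simp add: step_def F Let_def)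
    qed
  qed
qed

text \<open>The interarrival time before arrival \<open>c\<close> of class \<open>i\<close> influences the trajectory only once that arrival
  has occurred, so it may be enlarged, or changed to any value that keeps the arrival in the future.\<close>

lemma run_agree:
  assumes n: "0 < n" and x': "x' = x(IA i c := y')" and c: "cnt (run Q n x e) i \<le> c"
    and y: "cnt (run Q n x e) i = c \<Longrightarrow> x (IA i c) \<le> y' \<or>
       (regular n x \<and> time (run Q n x e) < arrival_time x' i c)"
  shows "run Q n x' e = run Q n x e"
  using c y
proof (induction e)
  case (Suc e)
  let ?s = "run Q n x e" and ?s' = "run Q n x (Suc e)"
  have le: "cnt ?s i \<le> cnt ?s' i" "regular n x \<Longrightarrow> time ?s \<le> time ?s'"
    using cnt_run_mono[OF n] time_run_mono[OF n] by auto
  have "run Q n x' e = ?s"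
    by (rule Suc.IH) (use Suc.prems le in \<open>auto\<close>)
  moreover have "step n x' ?s = step n x ?s" if "\<not> Q ?s"
  proof (rule step_agree[OF n x'])
    show "cnt (step n x ?s) i \<le> c" using Suc.prems that by (simp add: run_Suc halting_step_def)
    have at: "arrival_time x' i c = arrival_time x i c - x (IA i c) + y'" by (simp add: x' arrival_time_IA)
    assume ci: "cnt ?s i = c"
    then have "cnt ?s' i = c" using le(1) Suc.prems(1) by simp
    from Suc.prems(2)[OF this] show "arrival_time x i c \<le> arrival_time x' i c \<or> time (step n x ?s) < arrival_time x' i c"
      using that at by (auto simp: run_Suc halting_step_def)
  qed
  ultimately show ?case by (simp add: run_Suc halting_step_def)
qed simp

subsection \<open>Measurability of the trajectory\<close>

primrec act0 :: "act \<Rightarrow> act" where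
  "act0 Idle = Idle" | "act0 (Serve j) = Serve j" | "act0 (Pausing j r) = Pausing j 0" | "act0 (Resuming j r f) = Resuming j 0 f"

primrec arem :: "act \<Rightarrow> real" where
  "arem Idle = 0" | "arem (Serve j) = 0" | "arem (Pausing j r) = r" | "arem (Resuming j r f) = r"

definition disc :: "qstate \<Rightarrow> qstate" where
  "disc s = s\<lparr>time := 0, rem := (\<lambda>_. 0), eff := (\<lambda>_. 0), act := act0 (act s)\<rparr>"

lemma disc_eqD:
  assumes "disc s = disc s'"
  shows "cnt s = cnt s'" "present s = present s'" "npause s = npause s'" "nresume s = nresume s'"
    "paused s = paused s'" "completed s = completed s'" "act0 (act s) = act0 (act s')"
  using arg_cong[OF assms, of cnt] arg_cong[OF assms, of present] arg_cong[OF assms, of npause]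
    arg_cong[OF assms, of nresume] arg_cong[OF assms, of paused] arg_cong[OF assms, of completed]
    arg_cong[OF assms, of act] by (simp_all add: disc_def)

lemma disc_eqI:
  assumes "cnt s = cnt s'" "present s = present s'" "npause s = npause s'" "nresume s = nresume s'"
    "paused s = paused s'" "completed s = completed s'" "act0 (act s) = act0 (act s')"
  shows "disc s = disc s'"
  using assms by (simp add: disc_def)

text \<open>States carry no \<open>\<sigma>\<close>-algebra. Instead, measurability is first shown for families of states with a
  constant discrete part and then propagated through the case distinctions made by \<open>step\<close>.\<close>

definition smeas :: "'a measure \<Rightarrow> ('a \<Rightarrow> qstate) \<Rightarrow> bool" where
  "smeas A S \<longleftrightarrow> (\<exists>d. \<forall>a. disc (S a) = disc d) \<and> (\<lambda>a. time (S a)) \<in> borel_measurable A \<and>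
     (\<forall>j. (\<lambda>a. rem (S a) j) \<in> borel_measurable A) \<and> (\<forall>j. (\<lambda>a. eff (S a) j) \<in> borel_measurable A) \<and>
     (\<lambda>a. arem (act (S a))) \<in> borel_measurable A"

text \<open>The activity is split into a constant constructor, read off \<open>d\<close>, and a
  measurable remaining time \<open>r\<close>, so that a case distinction on \<open>act d\<close>
  settles the whole family at once.\<close>

definition shape :: "'a measure \<Rightarrow> ('a \<Rightarrow> qstate) \<Rightarrow> qstate \<Rightarrow> ('a \<Rightarrow> real) \<Rightarrow> bool" where
  "shape A S d r \<longleftrightarrow> (\<forall>a. disc (S a) = disc d) \<and> (\<forall>a. act (S a) = (case act d of Idle \<Rightarrow> Idle
       | Serve j \<Rightarrow> Serve j | Pausing j _ \<Rightarrow> Pausing j (r a) | Resuming j _ f \<Rightarrow> Resuming j (r a) f)) \<and>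
     r \<in> borel_measurable A \<and> (\<lambda>a. time (S a)) \<in> borel_measurable A \<and>
     (\<forall>j. (\<lambda>a. rem (S a) j) \<in> borel_measurable A) \<and> (\<forall>j. (\<lambda>a. eff (S a) j) \<in> borel_measurable A)"

lemma shape_ex:
  assumes "smeas A S"
  obtains d r where "shape A S d r"
proof -
  from assms obtain d where d: "\<And>a. disc (S a) = disc d" unfolding smeas_def by blast
  have "act (S a) = (case act d of Idle \<Rightarrow> Idle | Serve j \<Rightarrow> Serve j | Pausing j _ \<Rightarrow> Pausing j (arem (act (S a)))
     | Resuming j _ f \<Rightarrow> Resuming j (arem (act (S a))) f)" for a
    using disc_eqD(7)[OF d[of a]] by (cases "act d"; cases "act (S a)") simp_all
  then have "shape A S d (\<lambda>a. arem (act (S a)))"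
    using assms d unfolding smeas_def shape_def by blast
  then show ?thesis by (rule that)
qed

lemma shapeD:
  assumes "shape A S d r"
  shows "\<And>a. cnt (S a) = cnt d" "\<And>a. present (S a) = present d" "\<And>a. npause (S a) = npause d"
    "\<And>a. nresume (S a) = nresume d" "\<And>a. paused (S a) = paused d" "\<And>a. completed (S a) = completed d"
    "\<And>a. act (S a) = (case act d of Idle \<Rightarrow> Idle
       | Serve j \<Rightarrow> Serve j | Pausing j _ \<Rightarrow> Pausing j (r a) | Resuming j _ f \<Rightarrow> Resuming j (r a) f)"
    "r \<in> borel_measurable A" "(\<lambda>a. time (S a)) \<in> borel_measurable A"
    "\<And>j. (\<lambda>a. rem (S a) j) \<in> borel_measurable A" "\<And>j. (\<lambda>a. eff (S a) j) \<in> borel_measurable A"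
    "\<And>a. disc (S a) = disc d"
  using assms disc_eqD[of "S _" d] unfolding shape_def by simp_all

lemma smeasI:
  assumes "\<And>a. cnt (S a) = c" "\<And>a. present (S a) = p" "\<And>a. npause (S a) = np" "\<And>a. nresume (S a) = nr"
    "\<And>a. paused (S a) = pa" "\<And>a. completed (S a) = co" "\<And>a. act0 (act (S a)) = act0 ac"
    "(\<lambda>a. time (S a)) \<in> borel_measurable A" "\<And>j. (\<lambda>a. rem (S a) j) \<in> borel_measurable A"
    "\<And>j. (\<lambda>a. eff (S a) j) \<in> borel_measurable A" "(\<lambda>a. arem (act (S a))) \<in> borel_measurable A"
  shows "smeas A S"
proof -
  have "disc (S a) = disc \<lparr>time = 0, cnt = c, present = p, rem = (\<lambda>_. 0), eff = (\<lambda>_. 0),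
     npause = np, nresume = nr, paused = pa, completed = co, act = ac\<rparr>" for a
    by (rule disc_eqI) (simp_all add: assms)
  then show ?thesis unfolding smeas_def using assms(8-11) by blast
qed

lemma smeas_advance:
  assumes S: "smeas A S" and [measurable]: "T \<in> borel_measurable A"
  shows "smeas A (\<lambda>a. advance (S a) (T a))"
proof -
  obtain d r where D: "shape A S d r" by (rule shape_ex[OF S])
  note d = shapeD[OF D]
  note [measurable] = d(8-11)
  show ?thesis
    by (rule smeasI[where ac = "act d"]; cases "act d") (simp_all add: d(1-7) fun_upd_def)
qed

lemma smeas_dispatch:
  assumes S: "smeas A S" and X: "\<And>s. (\<lambda>a. X a s) \<in> borel_measurable A"
  shows "smeas A (\<lambda>a. dispatch (X a) (S a))"
proof -
  obtain d r where D: "shape A S d r" by (rule shape_ex[OF S])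
  note d = shapeD[OF D]
  note [measurable] = d(8-11)
  show ?thesis
  proof (rule smeasI[where ac = "act (dispatch (\<lambda>_. 0) d)" and nr = "nresume (dispatch (\<lambda>_. 0) d)"])
    show "act0 (act (dispatch (X a) (S a))) = act0 (act (dispatch (\<lambda>_. 0) d))" for a
      by (simp add: dispatch_act d(2,5))
    show "nresume (dispatch (X a) (S a)) = nresume (dispatch (\<lambda>_. 0) d)" for a
      by (simp add: dispatch_nresume d(2,4,5))
    have "arem (act (dispatch (X a) (S a))) = (if present d \<noteq> {} \<and> best (present d) \<in> paused d then
        X a (Rs (fst (best (present d))) (snd (best (present d))) (nresume d (best (present d)))) else 0)" for a
      by (simp add: dispatch_act d(2,4,5))
    then show "(\<lambda>a. arem (act (dispatch (X a) (S a)))) \<in> borel_measurable A"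
      using X by (cases "present d \<noteq> {} \<and> best (present d) \<in> paused d") (simp_all only: if_True if_False simp_thms borel_measurable_const)
    show "(\<lambda>a. time (dispatch (X a) (S a))) \<in> borel_measurable A" using d(9) by simp
    show "(\<lambda>a. rem (dispatch (X a) (S a)) j) \<in> borel_measurable A" for j using d(10) by simp
    show "(\<lambda>a. eff (dispatch (X a) (S a)) j) \<in> borel_measurable A" for j using d(11) by simp
  qed (simp_all only: dispatch_simps d(1-6))
qed

lemma smeas_start_pause:
  assumes S: "smeas A S" and X: "\<And>s. (\<lambda>a. X a s) \<in> borel_measurable A"
  shows "smeas A (\<lambda>a. start_pause (X a) j (S a))"
proof -
  obtain d r where D: "shape A S d r" by (rule shape_ex[OF S])
  note d = shapeD[OF D]
  note [measurable] = d(8-11)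
  show ?thesis
  proof (rule smeasI[where ac = "Pausing j 0"])
    show "(\<lambda>a. arem (act (start_pause (X a) j (S a)))) \<in> borel_measurable A"
      using X[of "Ps (fst j) (snd j) (npause d j)"] by (simp only: start_pause_simps arem.simps d(3))
    show "(\<lambda>a. time (start_pause (X a) j (S a))) \<in> borel_measurable A" using d(9) by simp
    show "(\<lambda>a. rem (start_pause (X a) j (S a)) j') \<in> borel_measurable A" for j' using d(10) by simp
    show "(\<lambda>a. eff (start_pause (X a) j (S a)) j') \<in> borel_measurable A" for j' using d(11) by simp
  qed (simp_all only: start_pause_simps d(1-6) act0.simps)
qed

lemma smeas_upd:
  assumes S: "smeas A S" and [measurable]: "R \<in> borel_measurable A" "R' \<in> borel_measurable A"
  shows "smeas A (\<lambda>a. (S a)\<lparr>cnt := C (cnt (S a)), present := P (present (S a)), rem := (rem (S a))(j := R a),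
      eff := (eff (S a))(j := R' a)\<rparr>)"
    "smeas A (\<lambda>a. (S a)\<lparr>present := P (present (S a)), completed := C' (completed (S a)), rem := (rem (S a))(j := R a)\<rparr>)"
    "(\<And>a. act (S a) = Resuming j (r a) f) \<Longrightarrow> smeas A (\<lambda>a. (S a)\<lparr>act := Resuming j (r a) f'\<rparr>)"
    "smeas A (\<lambda>a. (S a)\<lparr>act := Serve j, paused := P (paused (S a))\<rparr>)"
proof -
  obtain d r0 where D: "shape A S d r0" by (rule shape_ex[OF S])
  note d = shapeD[OF D]
  note [measurable] = d(8-11)
  have ac: "act0 (act (S a)) = act0 (act d)" for a using disc_eqD(7)[OF d(12)] .
  have m [measurable]: "(\<lambda>a. arem (act (S a))) \<in> borel_measurable A" using S unfolding smeas_def by blast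
  show "smeas A (\<lambda>a. (S a)\<lparr>cnt := C (cnt (S a)), present := P (present (S a)), rem := (rem (S a))(j := R a),
      eff := (eff (S a))(j := R' a)\<rparr>)"
    by (rule smeasI[where ac = "act d"]) (simp_all add: d(1-6) ac fun_upd_def)
  show "smeas A (\<lambda>a. (S a)\<lparr>present := P (present (S a)), completed := C' (completed (S a)), rem := (rem (S a))(j := R a)\<rparr>)"
    by (rule smeasI[where ac = "act d"]) (simp_all add: d(1-6) ac fun_upd_def)
  show "smeas A (\<lambda>a. (S a)\<lparr>act := Serve j, paused := P (paused (S a))\<rparr>)"
    by (rule smeasI[where ac = "Serve j"]) (simp_all add: d(1-6))
  show "smeas A (\<lambda>a. (S a)\<lparr>act := Resuming j (r a) f'\<rparr>)" if r: "\<And>a. act (S a) = Resuming j (r a) f"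
    by (rule smeasI[where ac = "Resuming j 0 f'"]) (use m in \<open>simp_all add: d(1-6) r\<close>)
qed

lemma smeas_arrive:
  assumes S: "smeas A S" and X: "\<And>s. (\<lambda>a. X a s) \<in> borel_measurable A"
  shows "smeas A (\<lambda>a. arrive (X a) i (S a))"
proof -
  obtain d r0 where D: "shape A S d r0" by (rule shape_ex[OF S])
  note d = shapeD(1)[OF D] and ac = shapeD(7)[OF D]
  let ?j = "(i, cnt d i)"
  have S1: "smeas A (\<lambda>a. admit (X a) i (S a))" unfolding admit_def d
    by (rule smeas_upd(1)[OF S X borel_measurable_const, where C = "\<lambda>_. (cnt d)(i := Suc (cnt d i))" and P = "insert ?j"])
  note eq = arrive_eq[where i = i]
  show ?thesis
  proof (cases "act d")
    case Idle
    then have "act (S a) = Idle" for a using ac[of a] by simp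
    then show ?thesis unfolding eq by (simp add: smeas_dispatch[OF S1 X])
  next
    case (Serve j')
    then have "act (S a) = Serve j'" for a using ac[of a] by simp
    then show ?thesis unfolding eq by (cases "i < fst j'") (simp_all add: smeas_start_pause[OF S1 X] S1)
  next
    case (Pausing j' r)
    then have "act (S a) = Pausing j' (r0 a)" for a using ac[of a] by simp
    then show ?thesis unfolding eq by (simp add: S1)
  next
    case (Resuming j' r f)
    then have r: "act (S a) = Resuming j' (r0 a) f" for a using ac[of a] by simp
    then have "arrive (X a) i (S a) = (admit (X a) i (S a))\<lparr>act := Resuming j' (r0 a) (f \<or> i < fst j')\<rparr>" for a
      unfolding eq r by simp
    moreover have "smeas A (\<lambda>a. (admit (X a) i (S a))\<lparr>act := Resuming j' (r0 a) (f \<or> i < fst j')\<rparr>)"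
      by (rule smeas_upd(3)[OF S1 borel_measurable_const borel_measurable_const]) (simp add: r)
    ultimately show ?thesis by simp
  qed
qed

lemma smeas_complete:
  assumes S: "smeas A S" and X: "\<And>s. (\<lambda>a. X a s) \<in> borel_measurable A"
  shows "smeas A (\<lambda>a. complete (X a) (S a))"
proof -
  obtain d r0 where D: "shape A S d r0" by (rule shape_ex[OF S])
  note d = shapeD(1)[OF D] and ac = shapeD(7)[OF D]
  show ?thesis
  proof (cases "act d")
    case Idle
    then have "act (S a) = Idle" for a using ac[of a] by simp
    then show ?thesis by (simp add: complete_def S)
  next
    case (Serve j')
    then have "act (S a) = Serve j'" for a using ac[of a] by simp
    then show ?thesis by (simp add: complete_def)
      (intro smeas_dispatch[OF _ X] smeas_upd(2)[OF S, where P = "\<lambda>P. P - {j'}" and C' = "insert j'", OF _ borel_measurable_const] borel_measurable_const)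
  next
    case (Pausing j' r)
    then have "act (S a) = Pausing j' (r0 a)" for a using ac[of a] by simp
    then show ?thesis by (simp add: complete_def smeas_dispatch[OF S X])
  next
    case (Resuming j' r f)
    then have "complete (X a) (S a) = (if f then start_pause (X a) j' (S a) else (S a)\<lparr>act := Serve j', paused := paused (S a) - {j'}\<rparr>)" for a
      using ac[of a] by (simp add: complete_def)
    then show ?thesis using smeas_start_pause[OF S, of X, OF X, where j = j'] smeas_upd(4)[OF S borel_measurable_const borel_measurable_const, where j = j' and P = "\<lambda>P. P - {j'}"]
      by (cases f) simp_all
  qed
qed

lemma arrival_time_measurable:
  "(\<And>s. (\<lambda>a. X a s) \<in> borel_measurable A) \<Longrightarrow> (\<lambda>a. arrival_time (X a) i m) \<in> borel_measurable A"
  unfolding arrival_time_def by (intro borel_measurable_sum)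

text \<open>After a step the discrete part is no longer constant, since both the arriving class and
  the order of arrival and completion depend on \<open>a\<close>. Hence the conclusion speaks of an
  observable \<open>g\<close> of the new state, assembled from the finitely or countably many cases
  in which the discrete part is constant.\<close>

lemma smeas_step:
  assumes g: "\<And>S. smeas A S \<Longrightarrow> (\<lambda>a. g a (S a)) \<in> measurable A N"
    and S: "smeas A S" and X: "\<And>s. (\<lambda>a. X a s) \<in> borel_measurable A"
  shows "(\<lambda>a. g a (step n (X a) (S a))) \<in> measurable A N"
proof -
  obtain d r0 where D: "shape A S d r0" by (rule shape_ex[OF S])
  note d = shapeD(1)[OF D] and ac = shapeD(7)[OF D]
  note [measurable] = shapeD(8-11)[OF D]
  note [measurable] = arrival_time_measurable[of X, OF X]
  let ?ta = "\<lambda>a. next_arr n (X a) (S a)"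
  have ta[measurable]: "?ta \<in> borel_measurable A"
    unfolding next_arr_def d by (intro borel_measurable_Min) auto
  have ci: "(\<lambda>a. next_cls n (X a) (S a)) \<in> measurable A (count_space UNIV)"
    unfolding next_cls_def d by measurable
  \<comment> \<open>For each fixed value of the arriving class the new states again have a constant
    discrete part.\<close>
  have arr: "(\<lambda>a. g a (arrive (X a) (next_cls n (X a) (S a)) (advance (S a) (?ta a)))) \<in> measurable A N"
    by (rule measurable_compose_countable[OF _ ci]) (intro g smeas_arrive smeas_advance S ta X)
  show ?thesis
  proof (cases "act d = Idle")
    case True
    then have "act (S a) = Idle" for a using ac[of a] by simp
    then show ?thesis using arr by (simp add: step_def act_end_def Let_def)
  next
    case False
    define te where "te a = time (S a) + (case act d of Serve j \<Rightarrow> rem (S a) j | _ \<Rightarrow> r0 a)" for a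
    have te: "act_end (S a) = Some (te a)" for a
      using ac[of a] False by (cases "act d") (simp_all add: act_end_def te_def)
    have te_m: "te \<in> borel_measurable A" unfolding te_def by (cases "act d") simp_all
    have com: "(\<lambda>a. g a (complete (X a) (advance (S a) (te a)))) \<in> measurable A N"
      by (intro g smeas_complete smeas_advance S X te_m)
    have "(\<lambda>a. if ?ta a \<le> te a then g a (arrive (X a) (next_cls n (X a) (S a)) (advance (S a) (?ta a)))
       else g a (complete (X a) (advance (S a) (te a)))) \<in> measurable A N"
      by (rule measurable_If[OF arr com borel_measurable_le[OF ta te_m]])
    moreover have "g a (step n (X a) (S a)) = (if ?ta a \<le> te a then g a (arrive (X a) (next_cls n (X a) (S a)) (advance (S a) (?ta a)))
       else g a (complete (X a) (advance (S a) (te a))))" for a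
      by (simp add: step_def te Let_def)
    ultimately show ?thesis by simp
  qed
qed

definition discrete :: "(qstate \<Rightarrow> 'b) \<Rightarrow> bool" where
  "discrete Q \<longleftrightarrow> (\<forall>s. Q s = Q (disc s))"

lemma discreteD: "discrete Q \<Longrightarrow> disc s = disc s' \<Longrightarrow> Q s = Q s'"
  unfolding discrete_def by metis

text \<open>The induction peels off the last step and absorbs it into the observable
  \<open>g\<close>; this is why \<open>g\<close> is universally quantified over families of states
  and generalized.\<close>

lemma measurable_run:
  assumes g: "\<And>S. smeas A S \<Longrightarrow> (\<lambda>a. g a (S a)) \<in> measurable A N"
    and X: "\<And>s. (\<lambda>a. X a s) \<in> borel_measurable A" and Q: "discrete Q"
  shows "(\<lambda>a. g a (run Q n (X a) e)) \<in> measurable A N"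
  using g
proof (induction e arbitrary: g)
  case 0
  have "smeas A (\<lambda>a. init_state)" by (rule smeasI) (simp_all)
  then show ?case using 0 by simp
next
  case (Suc e)
  show ?case unfolding run_Suc
  proof (rule Suc.IH)
    fix S assume S: "smeas A S"
    then obtain d where d: "\<And>a. disc (S a) = disc d" unfolding smeas_def by blast
    have Q: "Q (S a) = Q d" for a by (rule discreteD[OF assms(3) d])
    show "(\<lambda>a. g a (halting_step Q n (X a) (S a))) \<in> measurable A N"
      using smeas_step[OF Suc.prems S X, where n = n] Suc.prems[OF S] by (cases "Q d") (simp_all add: halting_step_def Q)
  qed
qed

lemma measurable_run_discrete:
  assumes X: "\<And>s. (\<lambda>a. X a s) \<in> borel_measurable A" and Q: "discrete Q" and f: "discrete f" "range f \<subseteq> space N"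
  shows "(\<lambda>a. f (run Q n (X a) e)) \<in> measurable A N"
proof (rule measurable_run[OF _ X Q])
  fix S assume S: "smeas A S"
  then obtain d where d: "\<And>a. disc (S a) = disc d" unfolding smeas_def by blast
  have "f (S a) = f d" for a by (rule discreteD[OF f(1) d])
  moreover have "f d \<in> space N" using f(2) by auto
  ultimately show "(\<lambda>a. f (S a)) \<in> measurable A N" by simp
qed

lemma measurable_run_time:
  assumes X: "\<And>s. (\<lambda>a. X a s) \<in> borel_measurable A" and Q: "discrete Q"
  shows "(\<lambda>a. time (run Q n (X a) e)) \<in> borel_measurable A"
    "(\<lambda>a. eff (run Q n (X a) e) j) \<in> borel_measurable A"
  by (rule measurable_run[OF _ X Q], simp add: smeas_def)+

subsection \<open>The law of the inputs\<close>

abbreviation expm :: "real \<Rightarrow> real measure" where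
  "expm l \<equiv> density lborel (\<lambda>t. ennreal (exponential_density l t))"

text \<open>Memorylessness in integral form: beyond \<open>b\<close> the exponential density is
  \<open>exp (- l * b)\<close> times the density at \<open>y - b\<close>.\<close>

lemma expm_shift:
  assumes [measurable]: "f \<in> borel_measurable borel" and b: "0 \<le> b" and l: "0 < l"
  shows "(\<integral>\<^sup>+y. indicator {b<..} y * f (y - b) \<partial>expm l) = ennreal (exp (- l * b)) * (\<integral>\<^sup>+u. f u \<partial>expm l)"
proof -
  let ?d = "\<lambda>y. ennreal (exponential_density l y)"
  have "(\<integral>\<^sup>+y. indicator {b<..} y * f (y - b) \<partial>expm l) = (\<integral>\<^sup>+y. ?d y * (indicator {b<..} y * f (y - b)) \<partial>lborel)"
    by (subst nn_integral_density) auto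
  also have "\<dots> = (\<integral>\<^sup>+u. ?d (b + u) * (indicator {b<..} (b + u) * f (b + u - b)) \<partial>lborel)"
    by (subst nn_integral_real_affine[where c = 1 and t = b]) auto
  also have "\<dots> = (\<integral>\<^sup>+u. ennreal (exp (- l * b)) * (?d u * f u) \<partial>lborel)"
  proof (rule nn_integral_cong_AE)
    \<comment> \<open>At \<open>u = 0\<close> the density is positive while the indicator of
      \<open>{b<..}\<close> vanishes, so the integrands agree only off this null set.\<close>
    have "AE u in lborel. u \<noteq> (0::real)" by (rule AE_lborel_singleton)
    then show "AE u in lborel. ?d (b + u) * (indicator {b<..} (b + u) * f (b + u - b)) = ennreal (exp (- l * b)) * (?d u * f u)"
    proof eventually_elim
      case (elim u)
      show ?case
      proof (cases "0 < u")
        case True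
        then have nb: "\<not> b + u < 0" "\<not> u < 0" using b by auto
        have e: "exp (- (b + u) * l) = exp (- l * b) * exp (- u * l)"
          by (simp add: exp_add[symmetric] algebra_simps)
        have "exponential_density l (b + u) = exp (- l * b) * exponential_density l u"
          by (simp only: exponential_density_def nb if_False e mult.left_commute)
        then have "?d (b + u) = ennreal (exp (- l * b)) * ?d u"
          using exponential_density_nonneg[OF l] by (simp add: ennreal_mult)
        then show ?thesis using True by (simp add: mult.assoc)
      next
        case False
        then show ?thesis using elim by (simp add: exponential_density_def)
      qed
    qed
  qed
  also have "\<dots> = ennreal (exp (- l * b)) * (\<integral>\<^sup>+u. f u \<partial>expm l)"
    by (subst nn_integral_cmult, measurable, subst nn_integral_density) auto
  finally show ?thesis .
qed

lemma expm_mean: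
  assumes l: "0 < l"
  shows "(\<integral>\<^sup>+u. ennreal u \<partial>expm l) = ennreal (1 / l)"
proof -
  have "(\<integral>\<^sup>+u. ennreal u \<partial>expm l) = (\<integral>\<^sup>+u. ennreal (exponential_density l u) * ennreal u \<partial>lborel)"
    by (rule nn_integral_density) auto
  also have "\<dots> = (\<integral>\<^sup>+u. ennreal (exponential_density l u * u ^ 1) \<partial>lborel)"
    using exponential_density_nonneg[OF l] by (intro nn_integral_cong) (simp add: ennreal_mult')
  also have "\<dots> = ennreal (1 / l)"
    using nn_integral_erlang_ith_moment[OF l, of 0 1] by simp
  finally show ?thesis .
qed

text \<open>The excluded point \<open>b\<close> will be the value for which a pending arrival
  coincides with the current event; positivity keeps a modified path regular.\<close>

lemma AE_expm: 
  assumes "0 < l"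
  shows "AE y in expm l. 0 < y \<and> y \<noteq> b"
proof (subst AE_density)
  have "AE y in lborel. y \<noteq> 0 \<and> y \<noteq> b"
    using AE_lborel_singleton[of 0] AE_lborel_singleton[of b] by eventually_elim auto
  then show "AE y in lborel. 0 < ennreal (exponential_density l y) \<longrightarrow> 0 < y \<and> y \<noteq> b"
    by eventually_elim (auto simp: exponential_density_def split: if_splits)
qed simp

section \<open>The product space of the inputs\<close>

locale inputs =
  fixes n :: nat and lam :: "nat \<Rightarrow> real" and \<mu> :: "src \<Rightarrow> real measure"
  assumes n: "0 < n" and lam: "\<And>i. i < n \<Longrightarrow> 0 < lam i"
    and prob_\<mu>: "\<And>s. prob_space (\<mu> s)" and sets_\<mu>: "\<And>s. sets (\<mu> s) = sets borel"
    and IA: "\<And>i m. i < n \<Longrightarrow> \<mu> (IA i m) = expm (lam i)"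
    and Sz: "\<And>i m. i < n \<Longrightarrow> \<mu> (Sz i m) = \<mu> (Sz i 0)"
    and Ps: "\<And>i m p. i < n \<Longrightarrow> \<mu> (Ps i m p) = \<mu> (Ps i 0 0)"
    and Rs: "\<And>i m p. i < n \<Longrightarrow> \<mu> (Rs i m p) = \<mu> (Rs i 0 0)"
    and pos: "\<And>i m. i < n \<Longrightarrow> AE y in \<mu> (Sz i m). 0 < y"
      "\<And>i m p. i < n \<Longrightarrow> AE y in \<mu> (Ps i m p). 0 \<le> y" "\<And>i m p. i < n \<Longrightarrow> AE y in \<mu> (Rs i m p). 0 \<le> y"
begin

sublocale product_prob_space \<mu> "UNIV :: src set"
  by (simp add: product_prob_space_def product_prob_space_axioms_def product_sigma_finite_def prob_\<mu> prob_space_imp_sigma_finite)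

abbreviation "P \<equiv> PiM UNIV \<mu>"

abbreviation expect :: "((src \<Rightarrow> real) \<Rightarrow> ennreal) \<Rightarrow> ennreal" (binder "\<E>" 10) where
  "expect f \<equiv> integral\<^sup>N P f"

lemma space_\<mu> [simp]: "space (\<mu> s) = UNIV"
  using sets_eq_imp_space_eq[OF sets_\<mu>[of s]] by simp

lemma space_P [simp]: "space P = UNIV"
  by (simp add: space_PiM)

lemma coord [measurable]: "(\<lambda>x. x s) \<in> borel_measurable P"
  using measurable_component_singleton[of s UNIV \<mu>] sets_\<mu>[of s] by (simp cong: measurable_cong_sets)

lemma measurable_PI:
  assumes "\<And>s. (\<lambda>a. f a s) \<in> borel_measurable A"
  shows "f \<in> measurable A P"
  by (rule measurable_PiM_single') (use assms sets_\<mu> in \<open>auto cong: measurable_cong_sets\<close>)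

text \<open>Replacing the coordinates in \<open>A\<close> by those of an independent copy preserves
  the law: on a cylinder set the product over \<open>J\<close> splits into the factors outside and
  inside \<open>A\<close>. Integration over a single coordinate and independence of disjoint sets of
  coordinates both follow from this.\<close>

lemma resample_law: "distr (P \<Otimes>\<^sub>M P) P (\<lambda>z s. if s \<in> A then snd z s else fst z s) = P" (is "distr _ _ ?f = _")
proof (rule PiM_eq)
  interpret PP: pair_prob_space P P ..
  have f: "?f \<in> measurable (P \<Otimes>\<^sub>M P) P"
    by (rule measurable_PI) (auto intro: measurable_compose[OF _ coord])
  show "sets (distr (P \<Otimes>\<^sub>M P) P ?f) = sets P" by simp
  fix J F assume J: "finite J" "J \<subseteq> UNIV" and F: "\<And>j. j \<in> J \<Longrightarrow> F j \<in> sets (\<mu> j)"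
  let ?E = "\<lambda>K. prod_emb UNIV \<mu> K (\<Pi>\<^sub>E j\<in>K. F j)"
  have E: "?E K = {x. \<forall>j\<in>K. x j \<in> F j}" for K
    by (auto simp: prod_emb_iff PiE_iff)
  have s: "?E K \<in> sets P" if "K \<subseteq> J" for K
    using J F that by (intro sets_PiM_I) (auto intro: finite_subset)
  have m: "emeasure P (?E K) = (\<Prod>j\<in>K. emeasure (\<mu> j) (F j))" if "K \<subseteq> J" for K
    using J F that by (intro emeasure_PiM_emb) (auto intro: finite_subset)
  have "?f -` ?E J \<inter> space (P \<Otimes>\<^sub>M P) = ?E (J - A) \<times> ?E (J \<inter> A)"
    by (auto simp: E space_pair_measure)
  then have "emeasure (distr (P \<Otimes>\<^sub>M P) P ?f) (?E J) = emeasure (P \<Otimes>\<^sub>M P) (?E (J - A) \<times> ?E (J \<inter> A))"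
    using f s[of J] by (subst emeasure_distr) auto
  also have "\<dots> = emeasure P (?E (J - A)) * emeasure P (?E (J \<inter> A))"
    by (intro sigma_finite_measure.emeasure_pair_measure_Times[OF prob_space_imp_sigma_finite[OF P.prob_space_axioms]] s) auto
  also have "\<dots> = (\<Prod>j\<in>J - A. emeasure (\<mu> j) (F j)) * (\<Prod>j\<in>J \<inter> A. emeasure (\<mu> j) (F j))"
    by (simp add: m)
  also have "\<dots> = (\<Prod>j\<in>J. emeasure (\<mu> j) (F j))"
    using J by (subst prod.union_disjoint[symmetric]) (auto intro!: prod.cong)
  finally show "emeasure (distr (P \<Otimes>\<^sub>M P) P ?f) (?E J) = (\<Prod>j\<in>J. emeasure (\<mu> j) (F j))" .
qed

lemma resample_set:
  assumes f [measurable]: "f \<in> borel_measurable P"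
  shows "(\<E> x. f x) = (\<E> x. \<E> x'. f (\<lambda>s. if s \<in> A then x' s else x s))"
proof -
  interpret PP: pair_prob_space P P ..
  have g: "(\<lambda>z s. if s \<in> A then snd z s else fst z s) \<in> measurable (P \<Otimes>\<^sub>M P) P"
    by (rule measurable_PI) (auto intro: measurable_compose[OF _ coord])
  have "(\<E> x. f x) = (\<integral>\<^sup>+x. f x \<partial>distr (P \<Otimes>\<^sub>M P) P (\<lambda>z s. if s \<in> A then snd z s else fst z s))"
    by (simp only: resample_law)
  also have "\<dots> = (\<integral>\<^sup>+z. f (\<lambda>s. if s \<in> A then snd z s else fst z s) \<partial>(P \<Otimes>\<^sub>M P))"
    by (rule nn_integral_distr[OF g]) (simp add: f)
  also have "\<dots> = (\<E> x. \<E> x'. f (\<lambda>s. if s \<in> A then snd (x, x') s else fst (x, x') s))"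
    by (rule nn_integral_fst[symmetric]) (rule measurable_compose[OF g f])
  finally show ?thesis by (simp cong: if_cong)
qed

lemma resample:
  assumes f [measurable]: "f \<in> borel_measurable P"
  shows "(\<E> x. f x) = (\<E> x. \<integral>\<^sup>+y. f (x(s := y)) \<partial>\<mu> s)"
proof -
  have "(\<E> x'. f (\<lambda>t. if t \<in> {s} then x' t else x t)) = (\<integral>\<^sup>+y. f (x(s := y)) \<partial>\<mu> s)" for x
  proof -
    have "(\<lambda>y. x(s := y)) \<in> measurable (\<mu> s) P"
      by (rule measurable_PI) (auto simp: fun_upd_def sets_\<mu> cong: measurable_cong_sets)
    then have m: "(\<lambda>y. f (x(s := y))) \<in> borel_measurable (\<mu> s)" by measurable
    have "(\<integral>\<^sup>+y. f (x(s := y)) \<partial>\<mu> s) = (\<integral>\<^sup>+y. f (x(s := y)) \<partial>distr P (\<mu> s) (\<lambda>x. x s))"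
      by (simp add: PiM_component)
    also have "\<dots> = (\<E> x'. f (x(s := x' s)))"
      by (rule nn_integral_distr[OF measurable_component_singleton]) (simp_all add: m)
    also have "\<dots> = (\<E> x'. f (\<lambda>t. if t \<in> {s} then x' t else x t))"
      by (intro nn_integral_cong arg_cong[where f = f]) auto
    finally show ?thesis ..
  qed
  then show ?thesis using resample_set[OF f, of "{s}"] by simp
qed

text \<open>\<open>f\<close> reads no coordinate in \<open>A\<close> and \<open>g\<close> reads only
  those, so resampling \<open>A\<close> separates the variables.\<close>

lemma independent:
  assumes [measurable]: "f \<in> borel_measurable P" "g \<in> borel_measurable P"
    and f: "\<And>x x'. f (\<lambda>s. if s \<in> A then x' s else x s) = f x"
    and g: "\<And>x x'. g (\<lambda>s. if s \<in> A then x' s else x s) = g x'"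
  shows "(\<E> x. f x * g x) = (\<E> x. f x) * (\<E> x. g x)"
proof -
  have "(\<E> x. f x * g x) = (\<E> x. \<E> x'. f x * g x')"
    by (subst resample_set[where A = A]) (simp_all add: f g)
  then show ?thesis by (simp add: nn_integral_cmult nn_integral_multc)
qed

lemma AE_regular: "AE x in P. regular n x"
proof -
  have "AE x in P. 0 < x (IA i m)" if "i < n" for i m
  proof (rule AE_component)
    show "AE y in \<mu> (IA i m). 0 < y"
      unfolding IA[OF that] using AE_expm[OF lam[OF that], of 0] by (rule eventually_mono) simp
  qed simp
  moreover have "AE x in P. 0 < x (Sz i m)" if "i < n" for i m
    by (rule AE_component) (use pos that in auto)
  moreover have "AE x in P. 0 \<le> x (Ps i m p)" "AE x in P. 0 \<le> x (Rs i m p)" if "i < n" for i m p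
    by (rule AE_component; use pos that in auto)+
  ultimately have "AE x in P. \<forall>i m p. i < n \<longrightarrow> 0 < x (IA i m) \<and> 0 < x (Sz i m) \<and> 0 \<le> x (Ps i m p) \<and> 0 \<le> x (Rs i m p)"
    by (simp add: AE_all_countable)
  then show ?thesis by eventually_elim (auto simp: regular_def)
qed

text \<open>All other inputs being fixed, the trajectory up to event \<open>e\<close> is the same for all values \<open>y\<close> of the
  interarrival time above a threshold, and below it the arrival has already occurred. Shifting the
  exponential law by the threshold turns \<open>y\<close> into the residual time.\<close>

lemma memoryless_at:
  assumes i: "i < n" and x: "regular n x"
    and hm: "\<And>x. h x \<in> borel_measurable borel"
    and inv: "\<And>x y u. regular n x \<Longrightarrow> 0 < y \<Longrightarrow> cnt (run Q n x e) i = c \<Longrightarrow> (\<And>e'. e' \<le> e \<Longrightarrow> run Q n (x(IA i c := y)) e' = run Q n x e') \<Longrightarrow>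
       h (x(IA i c := y)) u = (h x u :: ennreal)"
  shows "(\<integral>\<^sup>+y. (if cnt (run Q n (x(IA i c := y)) e) i = c
        then h (x(IA i c := y)) (arrival_time (x(IA i c := y)) i c - time (run Q n (x(IA i c := y)) e)) else 0) \<partial>expm (lam i))
    = (\<integral>\<^sup>+y. (if cnt (run Q n (x(IA i c := y)) e) i = c
        then (\<integral>\<^sup>+u. h (x(IA i c := y)) u \<partial>expm (lam i)) else 0) \<partial>expm (lam i))" (is "(\<integral>\<^sup>+y. ?G y \<partial>_) = (\<integral>\<^sup>+y. ?H y \<partial>_)")
proof (cases "\<exists>y0>0. cnt (run Q n (x(IA i c := y0)) e) i = c")
  case False
  have "AE y in expm (lam i). ?G y = ?H y"
    using AE_expm[OF lam[OF i]] by eventually_elim (use False in auto)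
  then show ?thesis by (rule nn_integral_cong_AE)
next
  case True
  then obtain y0 where y0: "0 < y0" "cnt (run Q n (x(IA i c := y0)) e) i = c" by blast
  define x0 where "x0 = x(IA i c := y0)"
  define T where "T = time (run Q n x0 e)"
  \<comment> \<open>The value of the interarrival time for which arrival \<open>c\<close> would
    occur exactly at time \<open>T\<close>. It is nonnegative because the preceding arrival, or time
    0 if \<open>c = 0\<close>, is not later than \<open>T\<close>.\<close>
  define b where "b = T - (arrival_time x0 i c - y0)"
  have upd: "x(IA i c := y) = x0(IA i c := y)" for y by (simp add: x0_def)
  have r: "regular n (x0(IA i c := y))" if "0 < y" for y
    using x that unfolding regular_def x0_def by auto
  have r0: "regular n x0" using r[OF y0(1)] by (simp add: x0_def)
  have c0: "cnt (run Q n x0 e) i = c" using y0 by (simp add: x0_def)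
  have at: "arrival_time (x0(IA i c := y)) i c = arrival_time x0 i c - y0 + y" for y
    by (simp add: arrival_time_IA) (simp add: x0_def)
  have b: "0 \<le> b"
  proof (cases c)
    case 0
    then have "arrival_time x0 i c = y0" by (simp add: arrival_time_def x0_def)
    then show ?thesis using consistentD(1)[OF consistent_run[OF n r0]] by (simp add: b_def T_def)
  next
    case (Suc c')
    then have "arrival_time x0 i c = arrival_time x0 i c' + y0" by (simp add: arrival_time_Suc x0_def)
    then show ?thesis using consistentD(3)[OF consistent_run[OF n r0] i, of Q e] Suc c0 by (simp add: b_def T_def)
  qed
  have iff: "cnt (run Q n (x0(IA i c := y)) e) i = c \<longleftrightarrow> b < y" if y: "0 < y" "y \<noteq> b" for y
  proof
    assume "cnt (run Q n (x0(IA i c := y)) e) i = c"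
    \<comment> \<open>Of \<open>y\<close> and \<open>y0\<close> the smaller value can be enlarged to
      the other without changing the trajectory, so all values with count \<open>c\<close> share the
      same \<open>T\<close>.\<close>
    moreover have "time (run Q n (x0(IA i c := y)) e) = T" if "cnt (run Q n (x0(IA i c := y)) e) i = c"
    proof (cases "y0 \<le> y")
      case True
      then have "run Q n (x0(IA i c := y)) e = run Q n x0 e"
        by (intro run_agree[OF n refl]) (use True y0 in \<open>simp_all add: x0_def\<close>)
      then show ?thesis by (simp add: T_def)
    next
      case False
      have "run Q n x0 e = run Q n (x0(IA i c := y)) e"
        by (intro run_agree[OF n, where i = i and c = c and y' = y0]) (use False that in \<open>auto simp: x0_def\<close>)
      then show ?thesis by (simp add: T_def)
    qed
    ultimately have "T \<le> arrival_time (x0(IA i c := y)) i c"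
      using consistentD(2)[OF consistent_run[OF n r[OF y(1)]] i, of Q e] by simp
    then show "b < y" using y by (simp add: at b_def)
  next
    assume "b < y"
    then have "T < arrival_time (x0(IA i c := y)) i c" by (simp add: at b_def)
    then have "run Q n (x0(IA i c := y)) e = run Q n x0 e"
      by (intro run_agree[OF n refl]) (use c0 r0 in \<open>auto simp: T_def\<close>)
    then show "cnt (run Q n (x0(IA i c := y)) e) i = c" by (simp add: c0)
  qed
  \<comment> \<open>Agreement at all earlier events is required as well, since \<open>h\<close> may
    depend on the whole trajectory up to \<open>e\<close>.\<close>
  have same: "run Q n (x0(IA i c := y)) e' = run Q n x0 e'" if y: "0 < y" "y \<noteq> b" "b < y" and e': "e' \<le> e" for y e'
  proof (rule run_agree[OF n refl])
    show "cnt (run Q n x0 e') i \<le> c" using cnt_run_mono[OF n e', of Q x0 i] c0 by simp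
    have "time (run Q n x0 e') \<le> T" unfolding T_def by (rule time_run_mono[OF n r0 e'])
    moreover have "T < arrival_time (x0(IA i c := y)) i c" using y by (simp add: at b_def)
    ultimately show "x0 (IA i c) \<le> y \<or> regular n x0 \<and> time (run Q n x0 e') < arrival_time (x0(IA i c := y)) i c"
      using r0 by simp
  qed
  have h: "h (x0(IA i c := y)) = h x0" if y: "0 < y" "y \<noteq> b" "b < y" for y
    by (rule ext) (rule inv[OF r0 y(1) c0 same[OF y]])
  have [measurable]: "h x0 \<in> borel_measurable borel" by (rule hm)
  have "(\<integral>\<^sup>+y. ?G y \<partial>expm (lam i)) = (\<integral>\<^sup>+y. indicator {b<..} y * h x0 (y - b) \<partial>expm (lam i))"
    using AE_expm[OF lam[OF i], of b]
  proof (intro nn_integral_cong_AE, eventually_elim)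
    case (elim y)
    show ?case
    proof (cases "b < y")
      case True
      then show ?thesis using elim iff[of y] h[of y] same[of y e] unfolding upd
        by (simp add: at T_def[symmetric]) (simp add: b_def algebra_simps)
    next
      case False
      then show ?thesis using elim iff[of y] unfolding upd by simp
    qed
  qed
  also have "\<dots> = ennreal (exp (- lam i * b)) * (\<integral>\<^sup>+u. h x0 u \<partial>expm (lam i))"
    by (rule expm_shift[OF _ b lam[OF i]]) measurable
  also have "\<dots> = (\<integral>\<^sup>+y. indicator {b<..} y * (\<integral>\<^sup>+u. h x0 u \<partial>expm (lam i)) \<partial>expm (lam i))"
    using expm_shift[OF _ b lam[OF i], of "\<lambda>_. \<integral>\<^sup>+u. h x0 u \<partial>expm (lam i)"]
      prob_space.emeasure_space_1[OF prob_space_exponential_density[OF lam[OF i]]] by simp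
  also have "\<dots> = (\<integral>\<^sup>+y. ?H y \<partial>expm (lam i))"
    using AE_expm[OF lam[OF i], of b]
  proof (intro nn_integral_cong_AE, eventually_elim)
    case (elim y)
    then show ?case using iff[of y] h[of y] unfolding upd by (cases "b < y") auto
  qed
  finally show ?thesis .
qed

text \<open>The coordinate to be resampled has a random index, so the expectation is split over the
  value \<open>c\<close> of the count. By \<open>inv\<close>, \<open>h\<close> reads that coordinate
  only through the trajectory up to event \<open>e\<close>; this is what leaves the residual time
  fresh.\<close>

lemma memoryless:
  assumes i: "i < n" and Q: "discrete Q"
    and h [measurable]: "case_prod h \<in> borel_measurable (P \<Otimes>\<^sub>M borel)"
    and inv: "\<And>x y u. regular n x \<Longrightarrow> 0 < y \<Longrightarrow>
       (\<And>e'. e' \<le> e \<Longrightarrow> run Q n (x(IA i (cnt (run Q n x e) i) := y)) e' = run Q n x e') \<Longrightarrow>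
       h (x(IA i (cnt (run Q n x e) i) := y)) u = (h x u :: ennreal)"
  shows "(\<E> x. h x (arrival_time x i (cnt (run Q n x e) i) - time (run Q n x e))) =
    (\<E> x. \<integral>\<^sup>+u. h x u \<partial>expm (lam i))" (is "(\<E> x. ?L x) = (\<E> x. ?R x)")
proof -
  interpret E: prob_space "expm (lam i)" by (rule prob_space_exponential_density[OF lam[OF i]])
  have N [measurable]: "(\<lambda>x. cnt (run Q n x e) i) \<in> measurable P (count_space UNIV)"
    by (rule measurable_run_discrete[OF coord Q]) (auto simp: discrete_def disc_def)
  have [measurable]: "(\<lambda>x. time (run Q n x e)) \<in> borel_measurable P"
    by (rule measurable_run_time[OF coord Q])
  have [measurable]: "(\<lambda>x. arrival_time x i c) \<in> borel_measurable P" for c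
    by (rule arrival_time_measurable) (rule coord)
  have hE [measurable]: "(\<lambda>x. \<integral>\<^sup>+u. h x u \<partial>expm (lam i)) \<in> borel_measurable P" by measurable
  let ?G = "\<lambda>c x. if cnt (run Q n x e) i = c then h x (arrival_time x i c - time (run Q n x e)) else 0"
  let ?H = "\<lambda>c x. if cnt (run Q n x e) i = c then \<integral>\<^sup>+u. h x u \<partial>expm (lam i) else 0"
  have s: "(\<Sum>c. if N = c then f c else 0) = f N" for f :: "nat \<Rightarrow> ennreal" and N
    using suminf_finite[of "{N}" "\<lambda>c. if N = c then f c else 0"] by auto
  have mG [measurable]: "?G c \<in> borel_measurable P" for c by measurable
  have mH [measurable]: "?H c \<in> borel_measurable P" for c by measurable
  have eq: "(\<E> x. ?G c x) = (\<E> x. ?H c x)" for c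
  proof -
    have "(\<E> x. ?G c x) = (\<E> x. \<integral>\<^sup>+y. ?G c (x(IA i c := y)) \<partial>expm (lam i))"
      by (subst resample[OF mG, of _ "IA i c"]) (simp add: IA[OF i])
    also have "\<dots> = (\<E> x. \<integral>\<^sup>+y. ?H c (x(IA i c := y)) \<partial>expm (lam i))"
      using AE_regular
    proof (intro nn_integral_cong_AE, eventually_elim)
      case (elim x)
      show ?case
      proof (rule memoryless_at[OF i elim(2)])
        show "h x \<in> borel_measurable borel" for x
          using measurable_compose[OF measurable_Pair1'[of x P borel] h] by simp
        show "h (x(IA i c := y)) u = h x u" if "regular n x" "0 < y" "cnt (run Q n x e) i = c"
          "\<And>e'. e' \<le> e \<Longrightarrow> run Q n (x(IA i c := y)) e' = run Q n x e'" for x y u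
          using inv[of x y u] that by simp
      qed
    qed
    also have "\<dots> = (\<E> x. ?H c x)"
      by (subst resample[OF mH, of _ "IA i c"]) (simp add: IA[OF i])
    finally show ?thesis .
  qed
  have "(\<E> x. ?L x) = (\<E> x. (\<Sum>c. ?G c x))" by (simp add: s)
  also have "\<dots> = (\<Sum>c. \<E> x. ?G c x)" by (rule nn_integral_suminf) measurable
  also have "\<dots> = (\<Sum>c. \<E> x. ?H c x)" by (simp only: eq)
  also have "\<dots> = (\<E> x. (\<Sum>c. ?H c x))" by (rule nn_integral_suminf[symmetric]) measurable
  also have "\<dots> = (\<E> x. ?R x)" by (simp add: s)
  finally show ?thesis .
qed

section \<open>Joint memorylessness of the residual clocks\<close>

abbreviation "E k \<equiv> PiM {..<k::nat} (\<lambda>i. expm (lam i))"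

text \<open>The clocks of the classes that can interrupt class \<open>k\<close>. The restriction of
  the domain makes the value a point of the product space underlying \<open>E k\<close>.\<close>

definition clk :: "nat \<Rightarrow> (src \<Rightarrow> real) \<Rightarrow> qstate \<Rightarrow> nat \<Rightarrow> real" where
  "clk k x s = (\<lambda>i\<in>{..<k}. arrival_time x i (cnt s i) - time s)"

lemma measurable_clk:
  assumes X: "\<And>s. (\<lambda>a. X a s) \<in> borel_measurable A" and Q: "discrete Q"
  shows "(\<lambda>a. clk k (X a) (run Q n (X a) e)) \<in> measurable A (PiM {..<k} (\<lambda>_. borel))"
  unfolding clk_def
proof (rule measurable_restrict)
  fix i
  show "(\<lambda>a. arrival_time (X a) i (cnt (run Q n (X a) e) i) - time (run Q n (X a) e)) \<in> borel_measurable A"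
  proof (rule measurable_run[OF _ X Q])
    fix S assume S: "smeas A S"
    obtain d r where D: "shape A S d r" by (rule shape_ex[OF S])
    show "(\<lambda>a. arrival_time (X a) i (cnt (S a) i) - time (S a)) \<in> borel_measurable A"
      using arrival_time_measurable[of X A i "cnt d i", OF X] shapeD(9)[OF D] unfolding shapeD(1)[OF D]
      by (rule borel_measurable_diff)
  qed
qed

text \<open>Induction on the number of clocks. The last clock is replaced by a fresh one while the
  others are part of \<open>h\<close>, which is legitimate because changing an interarrival time of
  its class leaves them alone. The induction hypothesis then applies to the integral over this
  clock, which also yields the independence of the clocks.\<close>

lemma memoryless_clk:
  assumes k: "k \<le> n" and Q: "discrete Q"
    and F [measurable]: "case_prod F \<in> borel_measurable (P \<Otimes>\<^sub>M PiM {..<k} (\<lambda>_. borel))"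
    and inv: "\<forall>i c x y u. i < k \<longrightarrow> regular n x \<longrightarrow> 0 < y \<longrightarrow>
       (\<forall>e'\<le>e. run Q n (x(IA i c := y)) e' = run Q n x e') \<longrightarrow>
       F (x(IA i c := y)) u = (F x u :: ennreal)"
  shows "(\<E> x. F x (clk k x (run Q n x e))) = (\<E> x. \<integral>\<^sup>+u. F x u \<partial>E k)"
  using k F inv
proof (induction k arbitrary: F)
  case 0
  have "clk 0 x s = (\<lambda>_. undefined)" for x s by (simp add: clk_def fun_eq_iff)
  then show ?case by (simp add: PiM_empty nn_integral_count_space_finite)
next
  case (Suc k)
  note F[measurable] = Suc.prems(2)
  have kn: "k < n" using Suc.prems(1) by simp
  interpret Ek: prob_space "expm (lam k)"
    by (rule prob_space_exponential_density[OF lam[OF kn]])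
  have C [measurable]: "(\<lambda>x. clk k x (run Q n x e)) \<in> measurable P (PiM {..<k} (\<lambda>_. borel))"
    by (rule measurable_clk[OF coord Q])
  have U: "insert k {..<k} = {..<Suc k}" by auto
  have upd: "(\<lambda>z. (fst z)(k := snd z)) \<in> measurable (PiM {..<k} (\<lambda>_. borel) \<Otimes>\<^sub>M (borel :: real measure)) (PiM {..<Suc k} (\<lambda>_. borel))"
    using measurable_add_dim[of k "{..<k}" "\<lambda>_. borel :: real measure"] unfolding U by (simp add: case_prod_beta')
  have Fu: "(\<lambda>w. F (fst w) ((fst (snd w))(k := snd (snd w)))) \<in> borel_measurable (P \<Otimes>\<^sub>M (PiM {..<k} (\<lambda>_. borel) \<Otimes>\<^sub>M borel))"
  proof -
    have "(\<lambda>w. (fst w, (fst (snd w))(k := snd (snd w)))) \<in> measurable (P \<Otimes>\<^sub>M (PiM {..<k} (\<lambda>_. borel) \<Otimes>\<^sub>M (borel :: real measure))) (P \<Otimes>\<^sub>M PiM {..<Suc k} (\<lambda>_. borel))"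
      by (rule measurable_Pair[OF measurable_fst measurable_compose[OF measurable_snd upd]])
    from measurable_compose[OF this F] show ?thesis by simp
  qed
  have clk: "clk (Suc k) x s = (clk k x s)(k := arrival_time x k (cnt s k) - time s)" for x s
    by (auto simp: clk_def fun_eq_iff)
  define G where "G x u = (\<integral>\<^sup>+t. F x (u(k := t)) \<partial>expm (lam k))" for x u
  have G: "case_prod G \<in> borel_measurable (P \<Otimes>\<^sub>M PiM {..<k} (\<lambda>_. borel))"
  proof -
    let ?B = "P \<Otimes>\<^sub>M PiM {..<k} (\<lambda>_. borel :: real measure)"
    have m1: "(\<lambda>w. fst (fst w)) \<in> measurable (?B \<Otimes>\<^sub>M (borel :: real measure)) P"
      by (rule measurable_compose[OF measurable_fst measurable_fst])
    have m2: "(\<lambda>w. snd (fst w)) \<in> measurable (?B \<Otimes>\<^sub>M (borel :: real measure)) (PiM {..<k} (\<lambda>_. borel))"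
      by (rule measurable_compose[OF measurable_fst measurable_snd])
    note m = measurable_Pair[OF m1 measurable_Pair[OF m2 measurable_snd]]
    have e: "sets (?B \<Otimes>\<^sub>M borel) = sets (?B \<Otimes>\<^sub>M expm (lam k))"
      by (intro sets_pair_measure_cong) simp_all
    from measurable_compose[OF m Fu]
    have "(\<lambda>w. F (fst (fst w)) ((snd (fst w))(k := snd w))) \<in> borel_measurable (?B \<Otimes>\<^sub>M borel)"
      by (simp only: fst_conv snd_conv)
    then have "(\<lambda>(z, t). F (fst z) ((snd z)(k := t))) \<in> borel_measurable (?B \<Otimes>\<^sub>M expm (lam k))"
      unfolding measurable_cong_sets[OF e refl] case_prod_beta' .
    from sigma_finite_measure.borel_measurable_nn_integral[OF prob_space_imp_sigma_finite[OF Ek.prob_space_axioms] this]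
    show "case_prod G \<in> borel_measurable (P \<Otimes>\<^sub>M PiM {..<k} (\<lambda>_. borel))"
      by (simp only: case_prod_beta' G_def)
  qed
  have inv: "F (x(IA i c := y)) u = F x u"
    if "i < Suc k" "regular n x" "0 < y" "\<And>e'. e' \<le> e \<Longrightarrow> run Q n (x(IA i c := y)) e' = run Q n x e'" for i c x y u
    using Suc.prems(3) that by blast
  have Ginv: "\<forall>i c x y u. i < k \<longrightarrow> regular n x \<longrightarrow> 0 < y \<longrightarrow>
       (\<forall>e'\<le>e. run Q n (x(IA i c := y)) e' = run Q n x e') \<longrightarrow> G (x(IA i c := y)) u = G x u"
  proof (intro allI impI)
    fix i c x y u
    assume a: "i < k" "regular n x" "0 < y" "\<forall>e'\<le>e. run Q n (x(IA i c := y)) e' = run Q n x e'"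
    have "F (x(IA i c := y)) v = F x v" for v by (rule inv) (use a in auto)
    then show "G (x(IA i c := y)) u = G x u" by (simp add: G_def)
  qed
  define h where "h x t = F x ((clk k x (run Q n x e))(k := t))" for x t
  have "(\<E> x. F x (clk (Suc k) x (run Q n x e))) =
      (\<E> x. h x (arrival_time x k (cnt (run Q n x e) k) - time (run Q n x e)))"
    by (simp add: clk h_def)
  also have "\<dots> = (\<E> x. \<integral>\<^sup>+t. h x t \<partial>expm (lam k))"
  proof (rule memoryless[OF kn Q])
    have "(\<lambda>z. (fst z, (clk k (fst z) (run Q n (fst z) e), snd z))) \<in> measurable (P \<Otimes>\<^sub>M (borel :: real measure)) (P \<Otimes>\<^sub>M (PiM {..<k} (\<lambda>_. borel) \<Otimes>\<^sub>M borel))"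
      by (rule measurable_Pair[OF measurable_fst measurable_Pair[OF measurable_compose[OF measurable_fst C] measurable_snd]])
    from measurable_compose[OF this Fu] show "case_prod h \<in> borel_measurable (P \<Otimes>\<^sub>M borel)"
      by (simp add: h_def case_prod_beta')
    fix x y u
    let ?c = "cnt (run Q n x e) k"
    assume r: "regular n x" "0 < (y::real)" "\<And>e'. e' \<le> e \<Longrightarrow> run Q n (x(IA k ?c := y)) e' = run Q n x e'"
    have "clk k (x(IA k ?c := y)) (run Q n x e) = clk k x (run Q n x e)"
      by (auto simp: clk_def arrival_time_IA fun_eq_iff)
    moreover have "F (x(IA k ?c := y)) v = F x v" for v
      by (rule inv[OF lessI r(1,2)]) (rule r(3))
    ultimately show "h (x(IA k ?c := y)) u = h x u"
      unfolding h_def using r(3)[of e] by simp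
  qed
  also have "\<dots> = (\<E> x. G x (clk k x (run Q n x e)))"
    by (simp only: h_def G_def)
  also have "\<dots> = (\<E> x. \<integral>\<^sup>+u. G x u \<partial>E k)"
    by (rule Suc.IH[OF less_imp_le[OF kn] G Ginv])
  also have "\<dots> = (\<E> x. \<integral>\<^sup>+u. F x u \<partial>E (Suc k))"
  proof (rule nn_integral_cong)
    fix x
    \<comment> \<open>Rates are known to be positive only below \<open>n\<close>; the value 1
      elsewhere makes every factor a probability measure.\<close>
    define l where "l i = (if i < n then lam i else 1)" for i
    have "sigma_finite_measure (expm (l i))" for i
      by (rule prob_space_imp_sigma_finite[OF prob_space_exponential_density]) (simp add: l_def lam)
    then interpret L: product_sigma_finite "\<lambda>i. expm (l i)"
      by (simp add: product_sigma_finite_def)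
    have El: "E m = PiM {..<m} (\<lambda>i. expm (l i))" if "m \<le> n" for m
      by (rule PiM_cong) (use that in \<open>simp_all add: l_def\<close>)
    have sE: "sets (PiM J (\<lambda>i. expm (l i))) = sets (PiM J (\<lambda>_. borel))" for J :: "nat set"
      by (rule sets_PiM_cong) simp_all
    have "F x \<in> borel_measurable (PiM {..<Suc k} (\<lambda>_. borel))"
      using measurable_compose[OF measurable_Pair1'[of x P "PiM {..<Suc k} (\<lambda>_. borel)"] F] by simp
    then have "F x \<in> borel_measurable (PiM (insert k {..<k}) (\<lambda>i. expm (l i)))"
      unfolding measurable_cong_sets[OF sE refl] U .
    from L.product_nn_integral_insert[OF _ _ this]
    show "(\<integral>\<^sup>+u. G x u \<partial>E k) = (\<integral>\<^sup>+u. F x u \<partial>E (Suc k))"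
      using kn by (simp add: El U G_def) (simp add: l_def)
  qed
  finally show ?case .
qed

end

subsection \<open>The Laplace transform of the remaining effective size\<close>

definition lap :: "real \<Rightarrow> real \<Rightarrow> ennreal" where
  "lap \<theta> z = ennreal (exp (- \<theta> * z))"

lemma lap_add: "lap \<theta> (a + b) = lap \<theta> a * lap \<theta> b"
  by (simp add: lap_def ennreal_mult[symmetric] exp_add[symmetric] algebra_simps)

lemma lap_cancel: "lap \<theta> d * lap \<theta> (a - d) = lap \<theta> a"
  using lap_add[of \<theta> d "a - d"] by simp

lemma lap_0 [simp]: "lap \<theta> 0 = 1"
  by (simp add: lap_def)

lemma lap_le_1: "0 < \<theta> \<Longrightarrow> 0 \<le> z \<Longrightarrow> lap \<theta> z \<le> 1"
  by (simp add: lap_def)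

lemma lap_measurable [measurable]: "lap \<theta> \<in> borel_measurable borel"
  unfolding lap_def by measurable

text \<open>Ties count as interruptions, because \<open>step\<close> processes an arrival before a
  completion occurring at the same time.\<close>

definition hit :: "nat \<Rightarrow> (nat \<Rightarrow> real) \<Rightarrow> real \<Rightarrow> bool" where
  "hit k u r \<longleftrightarrow> (\<exists>i<k. u i \<le> r)"

lemma hit_shift [simp]: "hit k (\<lambda>i. u i - d) (r - d) = hit k u r"
  by (simp add: hit_def)

lemma hit_cong: "(\<And>i. i < k \<Longrightarrow> u i = u' i) \<Longrightarrow> hit k u r = hit k u' r"
  by (auto simp: hit_def)

text \<open>Here \<open>u i\<close> is the time until the next class \<open>i\<close> arrival and \<open>W r\<close> is the transform at the start of a
  pause of a job with remaining original size \<open>r\<close>.\<close>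

definition serveL :: "real \<Rightarrow> nat \<Rightarrow> (real \<Rightarrow> ennreal) \<Rightarrow> real \<Rightarrow> (nat \<Rightarrow> real) \<Rightarrow> ennreal" where
  "serveL \<theta> k W r u = (if hit k u r then lap \<theta> (Min (u ` {..<k})) * W (r - Min (u ` {..<k})) else lap \<theta> r)"

text \<open>After a successful resume the service goes on with the same clocks reduced by
  \<open>a\<close>, not with fresh ones. After a failed one the clocks no longer matter, as a pause
  follows.\<close>

definition resumeL :: "real \<Rightarrow> nat \<Rightarrow> (real \<Rightarrow> ennreal) \<Rightarrow> real \<Rightarrow> real \<Rightarrow> (nat \<Rightarrow> real) \<Rightarrow> ennreal" where
  "resumeL \<theta> k W a r u = lap \<theta> a * (if hit k u a then W r else serveL \<theta> k W r (\<lambda>i. u i - a))"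

lemma serveL_cong: "(\<And>i. i < k \<Longrightarrow> u i = u' i) \<Longrightarrow> serveL \<theta> k W r u = serveL \<theta> k W r u'"
  unfolding serveL_def by (intro hit_cong if_cong arg_cong2[where f = "(*)"] arg_cong[where f = W] arg_cong[where f = "lap \<theta>"]
    arg_cong2[where f = "(-)"] arg_cong[where f = Min] image_cong) (auto)

lemma resumeL_cong:
  assumes "\<And>i. i < k \<Longrightarrow> u i = u' i"
  shows "resumeL \<theta> k W a r u = resumeL \<theta> k W a r u'"
proof -
  have "serveL \<theta> k W r (\<lambda>i. u i - a) = serveL \<theta> k W r (\<lambda>i. u' i - a)" by (rule serveL_cong) (simp add: assms)
  then show ?thesis using hit_cong[of k u u' a, OF assms] unfolding resumeL_def by simp
qed

text \<open>When time \<open>d\<close> passes, the time to the interruption falls by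
  \<open>d\<close> while the size left at the interruption stays the same, so only the factor
  \<open>lap \<theta> d\<close> changes hands.\<close>

lemma serveL_shift: "lap \<theta> d * serveL \<theta> k W (r - d) (\<lambda>i. u i - d) = serveL \<theta> k W r u"
proof (cases "hit k u r")
  case True
  then have "{..<k} \<noteq> {}" by (auto simp: hit_def)
  then have M: "Min ((\<lambda>i. u i - d) ` {..<k}) = Min (u ` {..<k}) - d"
    using mono_Min_commute[of "\<lambda>x. x - d" "u ` {..<k}"] by (simp add: image_image mono_def)
  have "lap \<theta> d * lap \<theta> (Min (u ` {..<k}) - d) = lap \<theta> (Min (u ` {..<k}))"
    by (rule lap_cancel)
  then show ?thesis using True unfolding serveL_def M by (simp add: mult.assoc[symmetric])
next
  case False
  have "lap \<theta> d * lap \<theta> (r - d) = lap \<theta> r" by (rule lap_cancel)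
  then show ?thesis using False unfolding serveL_def by simp
qed

lemma resumeL_shift: "lap \<theta> d * resumeL \<theta> k W (a - d) r (\<lambda>i. u i - d) = resumeL \<theta> k W a r u"
proof -
  have "lap \<theta> d * lap \<theta> (a - d) = lap \<theta> a" by (rule lap_cancel)
  then show ?thesis unfolding resumeL_def by (simp add: mult.assoc[symmetric])
qed

lemma serveL_mono: "(\<And>r. W r \<le> W' r) \<Longrightarrow> serveL \<theta> k W r u \<le> serveL \<theta> k W' r u"
  by (auto simp: serveL_def intro: mult_left_mono)

lemma resumeL_mono: "(\<And>r. W r \<le> W' r) \<Longrightarrow> resumeL \<theta> k W a r u \<le> resumeL \<theta> k W' a r u"
  by (auto simp: resumeL_def intro!: mult_left_mono serveL_mono)

lemma serveL_SUP: "serveL \<theta> k (\<lambda>r. SUP N. W N r) r u = (SUP N::nat. serveL \<theta> k (W N) r u)"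
  by (cases "hit k u r") (simp_all add: serveL_def SUP_mult_left_ennreal)

lemma resumeL_SUP: "resumeL \<theta> k (\<lambda>r. SUP N. W N r) a r u = (SUP N::nat. resumeL \<theta> k (W N) a r u)"
  unfolding resumeL_def serveL_SUP by (cases "hit k u a") (simp_all add: SUP_mult_left_ennreal)

lemma serveL_le_1:
  assumes "\<And>i. i < k \<Longrightarrow> 0 \<le> u i" "\<And>r. 0 \<le> r \<Longrightarrow> W r \<le> 1" "0 \<le> r" "0 < \<theta>"
  shows "serveL \<theta> k W r u \<le> 1"
proof (cases "hit k u r")
  case True
  then obtain i where i: "i < k" "u i \<le> r" by (auto simp: hit_def)
  have "Min (u ` {..<k}) \<in> u ` {..<k}" using i by (intro Min_in) auto
  then have "0 \<le> Min (u ` {..<k})" using assms(1) by auto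
  moreover have "Min (u ` {..<k}) \<le> r" using i by (intro order_trans[OF Min_le[of _ "u i"]]) auto
  ultimately show ?thesis using True assms(2)[of "r - Min (u ` {..<k})"] assms(4)
    by (auto simp: serveL_def intro!: mult_le_one lap_le_1)
next
  case False
  then show ?thesis using assms(3,4) by (simp add: serveL_def lap_le_1)
qed

lemma resumeL_le_1:
  assumes "\<And>r. 0 \<le> r \<Longrightarrow> W r \<le> 1" "0 \<le> a" "0 \<le> r" "0 < \<theta>"
  shows "resumeL \<theta> k W a r u \<le> 1"
proof -
  \<comment> \<open>If no clock runs out during the resume, all of them exceed \<open>a\<close>, so
    the service starts with positive clocks.\<close>
  have "serveL \<theta> k W r (\<lambda>i. u i - a) \<le> 1" if "\<not> (hit k u a)"
    by (rule serveL_le_1) (use assms that in \<open>auto simp: hit_def not_le intro: less_imp_le\<close>)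
  then show ?thesis using assms by (auto simp: resumeL_def intro!: mult_le_one lap_le_1)
qed

lemma measurable_serveL:
  assumes W: "(\<lambda>z. W (fst z) (snd z)) \<in> borel_measurable (A \<Otimes>\<^sub>M borel)"
    and r [measurable]: "r \<in> borel_measurable A" and u: "\<And>i. i < k \<Longrightarrow> (\<lambda>a. u a i) \<in> borel_measurable A"
  shows "(\<lambda>a. serveL \<theta> k (W a) (r a) (u a)) \<in> borel_measurable A"
proof -
  have p: "Measurable.pred A (\<lambda>a. hit k (u a) (r a))"
  proof -
    have "Measurable.pred A (\<lambda>a. \<exists>i\<in>{..<k}. u a i \<le> r a)"
      by (rule pred_intros_countable_bounded) (use u r in \<open>auto intro: borel_measurable_le\<close>)
    then show ?thesis by (simp only: hit_def Bex_def lessThan_iff)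
  qed
  have M [measurable]: "(\<lambda>a. Min (u a ` {..<k})) \<in> borel_measurable A"
    by (rule borel_measurable_Min) (use u in auto)
  have [measurable]: "(\<lambda>a. W a (r a - Min (u a ` {..<k}))) \<in> borel_measurable A"
    using measurable_compose[OF _ W, of "\<lambda>a. (a, r a - Min (u a ` {..<k}))" A] by simp
  show ?thesis unfolding serveL_def
    by (rule measurable_If[OF _ _ p[unfolded pred_def]]) measurable
qed

lemma measurable_resumeL:
  assumes W: "(\<lambda>z. W (fst z) (snd z)) \<in> borel_measurable (A \<Otimes>\<^sub>M borel)"
    and b [measurable]: "b \<in> borel_measurable A"
    and r [measurable]: "r \<in> borel_measurable A" and u: "\<And>i. i < k \<Longrightarrow> (\<lambda>a. u a i) \<in> borel_measurable A"
  shows "(\<lambda>a. resumeL \<theta> k (W a) (b a) (r a) (u a)) \<in> borel_measurable A"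
proof -
  have p: "Measurable.pred A (\<lambda>a. hit k (u a) (b a))"
  proof -
    have "Measurable.pred A (\<lambda>a. \<exists>i\<in>{..<k}. u a i \<le> b a)"
      by (rule pred_intros_countable_bounded) (use u b in \<open>auto intro: borel_measurable_le\<close>)
    then show ?thesis by (simp only: hit_def Bex_def lessThan_iff)
  qed
  have 1: "(\<lambda>a. W a (r a)) \<in> borel_measurable A"
    using measurable_compose[OF _ W, of "\<lambda>a. (a, r a)" A] by simp
  have 2: "(\<lambda>a. serveL \<theta> k (W a) (r a) (\<lambda>i. u a i - b a)) \<in> borel_measurable A"
    by (rule measurable_serveL[OF W r]) (use u b in measurable)
  have "(\<lambda>a. if hit k (u a) (b a) then W a (r a) else serveL \<theta> k (W a) (r a) (\<lambda>i. u a i - b a)) \<in> borel_measurable A"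
    by (rule measurable_If[OF 1 2 p[unfolded pred_def]])
  then show ?thesis unfolding resumeL_def by measurable
qed

text \<open>The periods during which the clocks influence the job's own effective size. Service and
  resume are merged because the passage from a resume to the service keeps the clocks; fresh clocks
  are needed only on entering such a period.\<close>

definition busy :: "job \<Rightarrow> qstate \<Rightarrow> bool" where
  "busy j s \<longleftrightarrow> act s = Serve j \<or> (\<exists>a f. act s = Resuming j a f)"

lemma busy_advance [simp]: "busy j (advance s t) = busy j s"
  by (cases "act s") (auto simp: busy_def)

lemma busy_present: "wf_state n s \<Longrightarrow> busy j s \<Longrightarrow> j \<in> present s"
  unfolding busy_def using wf_stateD(5)[of n s] wf_stateD(8)[of n s j] wf_stateD(10)[of n s j] by blast

context inputs begin

text \<open>Transform from the start of pause number \<open>q\<close> on, where paths with more than \<open>N\<close> further pauses are counted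
  as zero; the limit in \<open>N\<close> solves the renewal equation \<open>pauseL_eq\<close>.\<close>

primrec pauseN :: "real \<Rightarrow> nat \<Rightarrow> nat \<Rightarrow> nat \<Rightarrow> (src \<Rightarrow> real) \<Rightarrow> nat \<Rightarrow> real \<Rightarrow> ennreal" where
  "pauseN \<theta> k m 0 x q r = 0"
| "pauseN \<theta> k m (Suc N) x q r =
    lap \<theta> (x (Ps k m q)) * (\<integral>\<^sup>+u. resumeL \<theta> k (pauseN \<theta> k m N x (Suc q)) (x (Rs k m q)) r u \<partial>E k)"

definition pauseL :: "real \<Rightarrow> nat \<Rightarrow> nat \<Rightarrow> (src \<Rightarrow> real) \<Rightarrow> nat \<Rightarrow> real \<Rightarrow> ennreal" where
  "pauseL \<theta> k m x q r = (SUP N. pauseN \<theta> k m N x q r)"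

text \<open>A waiting job finds fresh clocks when it gets the server, so its transform depends only
  on its own inputs, its number of resumes and its remaining size. Counted from zero, pause
  \<open>q\<close> is followed by resume \<open>q\<close>, and a failure of that resume by pause
  \<open>Suc q\<close>.\<close>

definition pausedL :: "real \<Rightarrow> nat \<Rightarrow> nat \<Rightarrow> (src \<Rightarrow> real) \<Rightarrow> nat \<Rightarrow> real \<Rightarrow> ennreal" where
  "pausedL \<theta> k m x q r = (\<integral>\<^sup>+u. resumeL \<theta> k (pauseL \<theta> k m x (Suc q)) (x (Rs k m q)) r u \<partial>E k)"

definition freshL :: "real \<Rightarrow> nat \<Rightarrow> nat \<Rightarrow> (src \<Rightarrow> real) \<Rightarrow> real \<Rightarrow> ennreal" where
  "freshL \<theta> k m x r = (\<integral>\<^sup>+u. serveL \<theta> k (pauseL \<theta> k m x 0) r u \<partial>E k)"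

lemma pauseN_Suc_mono: "pauseN \<theta> k m N x q r \<le> pauseN \<theta> k m (Suc N) x q r"
proof (induction N arbitrary: q r)
  case (Suc N)
  show ?case by (subst (1 2) pauseN.simps(2)) (intro mult_left_mono nn_integral_mono resumeL_mono Suc.IH, simp)
qed simp

lemma incseq_pauseN: "incseq (\<lambda>N. pauseN \<theta> k m N x q r)"
  by (rule incseq_SucI) (rule pauseN_Suc_mono)

lemma sets_E: "sets (E k) = sets (PiM {..<k} (\<lambda>_. borel))"
  by (rule sets_PiM_cong) auto

lemma prob_E: "k \<le> n \<Longrightarrow> prob_space (E k)"
  by (rule prob_space_PiM) (rule prob_space_exponential_density[OF lam], simp)

lemma measurable_compose_P:
  assumes f: "(\<lambda>z. f (fst z) (snd z)) \<in> borel_measurable (P \<Otimes>\<^sub>M borel)"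
    and X: "\<And>s. (\<lambda>a. X a s) \<in> borel_measurable A" and r: "r \<in> borel_measurable A"
  shows "(\<lambda>a. f (X a) (r a)) \<in> borel_measurable A"
proof -
  have "(\<lambda>a. (X a, r a)) \<in> measurable A (P \<Otimes>\<^sub>M borel)" 
    by (rule measurable_Pair[OF measurable_PI r]) (rule X)
  from measurable_compose[OF this f] show ?thesis by simp
qed

lemma measurable_compose_P':
  assumes f: "(\<lambda>z. f (fst z) (snd z)) \<in> borel_measurable (P \<Otimes>\<^sub>M borel)"
    and X: "\<And>s. (\<lambda>a. X a s) \<in> borel_measurable A"
  shows "(\<lambda>z. f (X (fst z)) (snd z)) \<in> borel_measurable (A \<Otimes>\<^sub>M borel)"
  by (rule measurable_compose_P[OF f measurable_compose[OF measurable_fst X] measurable_snd])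

lemma measurable_E_component: "i < k \<Longrightarrow> (\<lambda>u. u i) \<in> borel_measurable (E k)"
  using measurable_component_singleton[of i "{..<k}" "\<lambda>_. borel :: real measure"] sets_E[of k]
  by (simp cong: measurable_cong_sets)

lemma measurable_integral_E:
  assumes k: "k \<le> n" and f: "(\<lambda>z. f (fst z) (snd z)) \<in> borel_measurable (B \<Otimes>\<^sub>M E k)"
  shows "(\<lambda>w. \<integral>\<^sup>+u. f w u \<partial>E k) \<in> borel_measurable B"
proof -
  interpret EK: prob_space "E k" by (rule prob_E[OF k])
  have "(\<lambda>(w, u). f w u) \<in> borel_measurable (B \<Otimes>\<^sub>M E k)" using f by (simp add: case_prod_beta')
  from EK.borel_measurable_nn_integral[OF this] show ?thesis .
qed

lemma coord_fst: "(\<lambda>z. fst z s) \<in> borel_measurable (P \<Otimes>\<^sub>M B)"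
  by (rule measurable_compose[OF measurable_fst coord])

lemma coord_fst2: "(\<lambda>z. fst (fst z) s) \<in> borel_measurable ((P \<Otimes>\<^sub>M B) \<Otimes>\<^sub>M C)"
  by (rule measurable_compose[OF measurable_fst coord_fst])

lemma measurable_pauseN:
  assumes k: "k \<le> n"
  shows "(\<lambda>z. pauseN \<theta> k m N (fst z) q (snd z)) \<in> borel_measurable (P \<Otimes>\<^sub>M borel)"
proof (induction N arbitrary: q)
  case (Suc N)
  show ?case unfolding pauseN.simps
    by (rule borel_measurable_times_ennreal, rule measurable_compose[OF coord_fst lap_measurable],
        rule measurable_integral_E[OF k], rule measurable_resumeL,
        rule measurable_compose_P'[OF Suc.IH, where X = "\<lambda>z. fst (fst z)", OF coord_fst2],
        rule coord_fst2, rule measurable_compose[OF measurable_fst measurable_snd],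
        rule measurable_compose[OF measurable_snd measurable_E_component])
qed simp

lemma measurable_pauseL:
  "k \<le> n \<Longrightarrow> (\<lambda>z. pauseL \<theta> k m (fst z) q (snd z)) \<in> borel_measurable (P \<Otimes>\<^sub>M borel)"
  unfolding pauseL_def by (intro borel_measurable_SUP measurable_pauseN) auto

lemma measurable_resumeL_E [measurable]:
  assumes k: "k \<le> n"
  shows "(\<lambda>u. resumeL \<theta> k (pauseL \<theta> k m x q) a r u) \<in> borel_measurable (E k)"
    "(\<lambda>u. resumeL \<theta> k (pauseN \<theta> k m N x q) a r u) \<in> borel_measurable (E k)"
    "(\<lambda>u. serveL \<theta> k (pauseL \<theta> k m x q) r u) \<in> borel_measurable (E k)"
  by (intro measurable_resumeL measurable_serveL measurable_compose_P'[OF measurable_pauseL[OF k], where X = "\<lambda>_. x"]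
    measurable_compose_P'[OF measurable_pauseN[OF k], where X = "\<lambda>_. x"] measurable_E_component; simp)+

text \<open>Monotone convergence in the bound on the number of pauses, since \<open>resumeL\<close>
  commutes with suprema of the transform at the next pause.\<close>

lemma pauseL_eq:
  assumes k: "k \<le> n"
  shows "pauseL \<theta> k m x q r = lap \<theta> (x (Ps k m q)) * pausedL \<theta> k m x q r"
proof -
  have "pauseL \<theta> k m x q r = (SUP N. pauseN \<theta> k m (Suc N) x q r)"
    unfolding pauseL_def
  proof (rule antisym)
    show "(SUP N. pauseN \<theta> k m N x q r) \<le> (SUP N. pauseN \<theta> k m (Suc N) x q r)"
      by (rule SUP_mono) (use pauseN_Suc_mono in blast)
    show "(SUP N. pauseN \<theta> k m (Suc N) x q r) \<le> (SUP N. pauseN \<theta> k m N x q r)"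
      by (rule SUP_mono) blast
  qed
  also have "\<dots> = lap \<theta> (x (Ps k m q)) * (SUP N. \<integral>\<^sup>+u. resumeL \<theta> k (pauseN \<theta> k m N x (Suc q)) (x (Rs k m q)) r u \<partial>E k)"
    by (simp add: SUP_mult_left_ennreal)
  also have "(SUP N. \<integral>\<^sup>+u. resumeL \<theta> k (pauseN \<theta> k m N x (Suc q)) (x (Rs k m q)) r u \<partial>E k) =
      (\<integral>\<^sup>+u. (SUP N. resumeL \<theta> k (pauseN \<theta> k m N x (Suc q)) (x (Rs k m q)) r u) \<partial>E k)"
    by (rule nn_integral_monotone_convergence_SUP[symmetric])
      (auto simp: incseq_def le_fun_def k intro!: resumeL_mono incseqD[OF incseq_pauseN])
  also have "\<dots> = pausedL \<theta> k m x q r"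
    unfolding pausedL_def pauseL_def by (rule nn_integral_cong) (rule resumeL_SUP[symmetric])
  finally show ?thesis .
qed

lemma pausedL_le_1:
  assumes k: "k < n" and x: "regular n x" and t: "0 < \<theta>" and r: "0 \<le> r"
  shows "pausedL \<theta> k m x q r \<le> 1" "pauseL \<theta> k m x q r \<le> 1" "freshL \<theta> k m x r \<le> 1"
proof -
  interpret EK: prob_space "E k" by (rule prob_E) (use k in simp)
  have p: "0 \<le> x (Ps k m q)" "0 \<le> x (Rs k m q)" for q using x k unfolding regular_def by auto
  have pauseN: "pauseN \<theta> k m N x q r \<le> 1" if "0 \<le> r" for N q r
    using that
  proof (induction N arbitrary: q r)
    case (Suc N)
    have "(\<integral>\<^sup>+u. resumeL \<theta> k (pauseN \<theta> k m N x (Suc q)) (x (Rs k m q)) r u \<partial>E k) \<le> (\<integral>\<^sup>+u. 1 \<partial>E k)"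
      by (intro nn_integral_mono resumeL_le_1 Suc.IH p Suc.prems t)
    then show ?case using p[of q] t by (auto simp: EK.emeasure_space_1 intro!: mult_le_one lap_le_1)
  qed simp
  then have U: "pauseL \<theta> k m x q r \<le> 1" if "0 \<le> r" for q r
    unfolding pauseL_def using that by (intro SUP_least) auto
  then show "pauseL \<theta> k m x q r \<le> 1" using r .
  have "pausedL \<theta> k m x q r \<le> (\<integral>\<^sup>+u. 1 \<partial>E k)"
    unfolding pausedL_def by (intro nn_integral_mono resumeL_le_1 U p r t)
  then show "pausedL \<theta> k m x q r \<le> 1" by (simp add: EK.emeasure_space_1)
  have "AE u in E k. \<forall>i<k. 0 \<le> u i"
  proof -
    have "AE u in E k. 0 < u i" if "i < k" for i
      by (rule AE_PiM_component) (use that k AE_expm[OF lam, of i 0] prob_space_exponential_density[OF lam] in simp_all)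
    then have "AE u in E k. \<forall>i\<in>{..<k}. 0 < u i" by (subst AE_finite_all) auto
    then show ?thesis by eventually_elim (auto intro: less_imp_le)
  qed
  then have "freshL \<theta> k m x r \<le> (\<integral>\<^sup>+u. 1 \<partial>E k)"
    unfolding freshL_def
    by (intro nn_integral_mono_AE, eventually_elim) (intro serveL_le_1 U r t, auto)
  then show "freshL \<theta> k m x r \<le> 1" by (simp add: EK.emeasure_space_1)
qed

section \<open>The conditional transform and its preservation under events\<close>

definition waitL :: "real \<Rightarrow> nat \<Rightarrow> nat \<Rightarrow> (src \<Rightarrow> real) \<Rightarrow> qstate \<Rightarrow> ennreal" where
  "waitL \<theta> k m x s = (if (k, m) \<in> paused s then pausedL \<theta> k m x (nresume s (k, m)) (rem s (k, m))
     else freshL \<theta> k m x (rem s (k, m)))"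

text \<open>Once the flag \<open>f\<close> is set, the clock that ran out has been renewed; the
  failure of the resume must therefore be read from the flag and no longer from
  \<open>u\<close>.\<close>

definition activeL :: "real \<Rightarrow> nat \<Rightarrow> nat \<Rightarrow> (src \<Rightarrow> real) \<Rightarrow> qstate \<Rightarrow> (nat \<Rightarrow> real) \<Rightarrow> ennreal" where
  "activeL \<theta> k m x s u = (case act s of
       Idle \<Rightarrow> waitL \<theta> k m x s
     | Serve j \<Rightarrow> if j = (k, m) then serveL \<theta> k (pauseL \<theta> k m x (npause s (k, m))) (rem s (k, m)) u else waitL \<theta> k m x s
     | Pausing j b \<Rightarrow> if j = (k, m) then lap \<theta> b * pausedL \<theta> k m x (nresume s (k, m)) (rem s (k, m)) else waitL \<theta> k m x s
     | Resuming j a f \<Rightarrow> if j = (k, m) then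
           if f then lap \<theta> a * pauseL \<theta> k m x (npause s (k, m)) (rem s (k, m))
           else resumeL \<theta> k (pauseL \<theta> k m x (npause s (k, m))) a (rem s (k, m)) u
         else waitL \<theta> k m x s)"

text \<open>Conditional transform of the final effective size of job \<open>(k, m)\<close>, given the state and the residual
  interarrival times \<open>u\<close>. Each step preserves its value, except that at the start of a service or resume
  of the job it is preserved only after averaging over fresh \<open>u\<close>.\<close>

definition sizeL :: "real \<Rightarrow> nat \<Rightarrow> nat \<Rightarrow> (src \<Rightarrow> real) \<Rightarrow> qstate \<Rightarrow> (nat \<Rightarrow> real) \<Rightarrow> ennreal" where
  "sizeL \<theta> k m x s u = (if (k, m) \<in> completed s then lap \<theta> (eff s (k, m))
     else if (k, m) \<notin> present s then freshL \<theta> k m x (x (Sz k m))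
     else lap \<theta> (eff s (k, m)) * activeL \<theta> k m x s u)"

lemma sizeL_cong:
  assumes "\<And>i. i < k \<Longrightarrow> u i = u' i"
  shows "sizeL \<theta> k m x s u = sizeL \<theta> k m x s u'"
  using serveL_cong[OF assms] resumeL_cong[OF assms] unfolding sizeL_def activeL_def by (simp split: act.split)

text \<open>Elapsed time moves from the remaining service, pause or resume into \<open>eff\<close>,
  and \<open>lap\<close> is multiplicative. A job that is not being worked on is unaffected.\<close>

lemma sizeL_advance: "sizeL \<theta> k m x (advance s t) (\<lambda>i. u i - (t - time s)) = sizeL \<theta> k m x s u"
  if w: "wf_state n s"
proof -
  let ?d = "t - time s" and ?j = "(k, m)"
  have pd: "?j \<in> completed s \<Longrightarrow> act s \<noteq> Serve ?j" "?j \<in> completed s \<Longrightarrow> act s \<noteq> Pausing ?j r"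
    "?j \<in> completed s \<Longrightarrow> act s \<noteq> Resuming ?j r f" for r f
    using wf_stateD(3,5)[OF w] wf_stateD(8)[OF w, of ?j] wf_stateD(9)[OF w, of ?j] wf_stateD(10)[OF w, of ?j] by auto
  have wait: "waitL \<theta> k m x (advance s t) = waitL \<theta> k m x s" if "act s \<noteq> Serve ?j"
    using that by (cases "act s") (auto simp: waitL_def)
  have e: "lap \<theta> (eff s ?j + ?d) = lap \<theta> (eff s ?j) * lap \<theta> ?d" by (rule lap_add)
  have b: "lap \<theta> ?d * lap \<theta> (b - ?d) = lap \<theta> b" for b by (rule lap_cancel)
  show ?thesis
  proof (cases "act s")
    case Idle
    then show ?thesis using wait by (simp add: sizeL_def activeL_def)
  next
    case (Serve j)
    show ?thesis
    proof (cases "j = ?j")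
      case True
      then have "?j \<notin> completed s" using Serve pd(1) by auto
      then show ?thesis using Serve True unfolding sizeL_def by (simp add: activeL_def e mult.assoc serveL_shift)
    next
      case False
      then show ?thesis using Serve wait by (simp add: sizeL_def activeL_def)
    qed
  next
    case (Pausing j r)
    show ?thesis
    proof (cases "j = ?j")
      case True
      have "lap \<theta> (eff s ?j + ?d) * (lap \<theta> (r - ?d) * z) = lap \<theta> (eff s ?j) * (lap \<theta> r * z)" for z
        unfolding e b[of r, symmetric] by (simp only: mult.assoc)
      moreover have "?j \<notin> completed s" using True Pausing pd(2)[of r] by auto
      ultimately show ?thesis using True Pausing unfolding sizeL_def by (simp add: activeL_def)
    next
      case False
      then show ?thesis using Pausing wait by (simp add: sizeL_def activeL_def)
    qed
  next
    case (Resuming j r f)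
    show ?thesis
    proof (cases "j = ?j")
      case True
      have "lap \<theta> (eff s ?j + ?d) * (lap \<theta> (r - ?d) * z) = lap \<theta> (eff s ?j) * (lap \<theta> r * z)" for z
        unfolding e b[of r, symmetric] by (simp only: mult.assoc)
      moreover have "lap \<theta> (eff s ?j + ?d) * resumeL \<theta> k W (r - ?d) z (\<lambda>i. u i - ?d) = lap \<theta> (eff s ?j) * resumeL \<theta> k W r z u" for W z
        unfolding e by (simp only: mult.assoc resumeL_shift)
      moreover have "?j \<notin> completed s" using True Resuming pd(3)[of r f] by auto
      ultimately show ?thesis using True Resuming unfolding sizeL_def by (simp add: activeL_def)
    next
      case False
      then show ?thesis using Resuming wait by (simp add: sizeL_def activeL_def)
    qed
  qed
qed


lemma sizeL_act:
  assumes "(k, m) \<in> present s" "(k, m) \<notin> completed s"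
  shows "sizeL \<theta> k m x s u = lap \<theta> (eff s (k, m)) * activeL \<theta> k m x s u"
  using assms by (simp add: sizeL_def)

text \<open>If the job gets the server, averaging over fresh clocks turns its active transform into
  the waiting one by the very definition of \<open>pausedL\<close> and \<open>freshL\<close>;
  otherwise it keeps waiting. The hypothesis \<open>np\<close> makes the number of its next pause
  agree with these definitions.\<close>

lemma sizeL_dispatch:
  fixes s0 :: qstate
  assumes k: "k < n" and j: "(k, m) \<in> present s0" "(k, m) \<notin> completed s0"
    and np: "npause s0 (k, m) = (if (k, m) \<in> paused s0 then Suc (nresume s0 (k, m)) else 0)"
  shows "(if busy (k, m) (dispatch x s0) then \<integral>\<^sup>+u. sizeL \<theta> k m x (dispatch x s0) u \<partial>E k
      else sizeL \<theta> k m x (dispatch x s0) v) = lap \<theta> (eff s0 (k, m)) * waitL \<theta> k m x s0"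
proof -
  let ?j = "(k, m)" and ?s = "dispatch x s0"
  have ne: "present s0 \<noteq> {}" using j by auto
  have S: "sizeL \<theta> k m x ?s u = lap \<theta> (eff s0 ?j) * activeL \<theta> k m x ?s u" for u
    using j by (simp add: sizeL_act)
  have kn: "k \<le> n" using k by simp
  show ?thesis
  proof (cases "best (present s0) = ?j")
    case True
    show ?thesis
    proof (cases "?j \<in> paused s0")
      case p: True
      have a: "act ?s = Resuming ?j (x (Rs k m (nresume s0 ?j))) False"
        using ne True p by (simp add: dispatch_act)
      have b: "busy ?j ?s" unfolding busy_def a by blast
      have "activeL \<theta> k m x ?s u = resumeL \<theta> k (pauseL \<theta> k m x (Suc (nresume s0 ?j))) (x (Rs k m (nresume s0 ?j))) (rem s0 ?j) u" for u
        using np p by (simp add: activeL_def a)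
      then show ?thesis using p b unfolding S
        by (simp add: nn_integral_cmult measurable_resumeL_E[OF kn] waitL_def pausedL_def)
    next
      case p: False
      have a: "act ?s = Serve ?j" using ne True p by (simp add: dispatch_act)
      have b: "busy ?j ?s" by (simp add: busy_def a)
      have "activeL \<theta> k m x ?s u = serveL \<theta> k (pauseL \<theta> k m x 0) (rem s0 ?j) u" for u
        using np p by (simp add: activeL_def a)
      then show ?thesis using p b unfolding S
        by (simp add: nn_integral_cmult measurable_resumeL_E[OF kn] waitL_def freshL_def)
    qed
  next
    case False
    have b: "\<not> busy ?j ?s" using ne False by (simp add: busy_def dispatch_act)
    have "activeL \<theta> k m x ?s v = waitL \<theta> k m x ?s" using ne False by (simp add: activeL_def dispatch_act)
    moreover have "waitL \<theta> k m x ?s = waitL \<theta> k m x s0"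
      using False by (auto simp: waitL_def dispatch_nresume)
    ultimately show ?thesis using b by (simp add: S)
  qed
qed

lemma wf_npause:
  assumes w: "wf_state n s" and "j \<notin> completed s" "\<not> busy j s"
  shows "npause s j = (if j \<in> paused s then Suc (nresume s j) else 0)"
  using wf_stateD(6)[OF w, of j] wf_stateD(7)[OF w, of j] assms(2,3) by (auto simp: busy_def)

lemma Min_zero:
  assumes "i < (k::nat)" "u i = (0::real)" "\<And>i. i < k \<Longrightarrow> 0 \<le> u i"
  shows "Min (u ` {..<k}) = 0"
  using assms by (intro Min_eqI) (auto simp: image_iff intro: bexI[of _ i])

text \<open>The clock of the arriving class stands at zero. If \<open>i < k\<close>, an interruption
  or failure with elapsed time zero is what the transform already predicted; if \<open>i\<close> is
  not below \<open>k\<close>, no clock that matters to the job is renewed.\<close>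

lemma sizeL_arrive_present:
  fixes s :: qstate
  assumes k: "k < n" and w: "wf_state n s" and c: "consistent n x s"
    and i: "i < n" and t: "time s = arrival_time x i (cnt s i)" and j: "(k, m) \<in> present s"
  shows "sizeL \<theta> k m x s (clk k x s) = (if busy (k, m) (arrive x i s) \<and> \<not> busy (k, m) s
     then \<integral>\<^sup>+u. sizeL \<theta> k m x (arrive x i s) u \<partial>E k else sizeL \<theta> k m x (arrive x i s) (clk k x (arrive x i s)))"
proof -
  let ?j = "(k, m)"
  define j0 where "j0 = (i, cnt s i)"
  define s1 where "s1 = admit x i s"
  note eq = arrive_eq[of x i s, folded s1_def]
  have kn: "k \<le> n" using k by simp
  have "\<not> (j0 \<in> present s \<or> j0 \<in> completed s)" "paused s \<subseteq> present s"
    using wf_stateD(2,5)[OF w] by (simp_all add: j0_def)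
  then have j0: "j0 \<noteq> ?j" "j0 \<notin> paused s" using j by auto
  have nc: "?j \<notin> completed s" using wf_stateD(3)[OF w] j by auto
  have ni: "act s \<noteq> Idle" using wf_stateD(11)[OF w] j by auto
  have s1: "present s1 = insert j0 (present s)" "completed s1 = completed s" "paused s1 = paused s"
    "npause s1 = npause s" "nresume s1 = nresume s" "act s1 = act s" "rem s1 ?j = rem s ?j" "eff s1 ?j = eff s ?j"
    "cnt s1 = (cnt s)(i := Suc (cnt s i))" "time s1 = time s"
    unfolding s1_def using j0 by (simp_all add: j0_def[symmetric])
  have S: "sizeL \<theta> k m x s u = lap \<theta> (eff s ?j) * activeL \<theta> k m x s u" for u
    using j nc by (rule sizeL_act)
  have u0: "0 \<le> clk k x s i'" if "i' < k" for i'
    using consistentD(2)[OF c, of i'] that k by (simp add: clk_def)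
  have ui: "clk k x s i = 0" if "i < k" using that t by (simp add: clk_def)
  have same: "clk k x s i' = clk k x s' i'" if "\<not> i < k" "i' < k" "cnt s' = cnt s1" "time s' = time s" for i' s'
    using that by (auto simp: clk_def s1)
  have hitI: "hit k (clk k x s) r" if "i < k" "0 \<le> r" for r using ui that by (auto simp: hit_def)
  have Mz: "Min (clk k x s ` {..<k}) = 0" if "i < k" by (rule Min_zero[of i k "clk k x s", OF that ui[OF that] u0])
  show ?thesis
  proof (cases "act s")
    case Idle
    then show ?thesis using ni by simp
  next
    case (Serve j')
    have pj': "j' \<in> present s" using wf_stateD(8)[OF w Serve] by simp
    show ?thesis
    proof (cases "j' = ?j")
      case True
      have b: "busy ?j s" using Serve True by (simp add: busy_def)
      have r0: "0 \<le> rem s ?j" using consistentD(4)[OF c j] .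
      show ?thesis
      proof (cases "i < k")
        case ik: True
        have a: "arrive x i s = start_pause x ?j s1" using Serve True ik by (simp add: eq)
        \<comment> \<open>During service pauses and resumes are balanced, so the pause now starting
          has the same number as the resume that will follow it.\<close>
        have "npause s ?j = nresume s ?j" using wf_stateD(6)[OF w, of ?j] Serve True wf_stateD(8)[OF w Serve] by auto
        then have "activeL \<theta> k m x s (clk k x s) = activeL \<theta> k m x (start_pause x ?j s1) (clk k x (start_pause x ?j s1))"
          using Serve True hitI[OF ik r0] Mz[OF ik] pauseL_eq[OF kn, of \<theta> m x "npause s ?j" "rem s ?j"]
          by (simp add: activeL_def serveL_def s1)
        then show ?thesis using b j nc unfolding S a by (simp add: sizeL_act s1)
      next
        case ik: False
        have a: "arrive x i s = s1" using Serve True ik by (simp add: eq)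
        have "activeL \<theta> k m x s (clk k x s) = activeL \<theta> k m x s1 (clk k x s1)"
          using Serve True serveL_cong[of k "clk k x s" "clk k x s1", OF same[OF ik]] by (simp add: activeL_def s1)
        then show ?thesis using b j nc unfolding S a by (simp add: sizeL_act s1)
      qed
    next
      case False
      have nb: "\<not> busy ?j (arrive x i s)" using False Serve by (simp add: busy_def s1 eq)
      have "activeL \<theta> k m x s u = waitL \<theta> k m x s" "activeL \<theta> k m x (arrive x i s) u = waitL \<theta> k m x s" for u
        using False Serve by (simp_all add: activeL_def waitL_def s1 eq)
      moreover have "?j \<in> present (arrive x i s)" "?j \<notin> completed (arrive x i s)" "eff (arrive x i s) ?j = eff s ?j"
        using j nc Serve by (simp_all add: eq s1)
      ultimately show ?thesis using nb unfolding S by (simp add: sizeL_act del: arrive_simps)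
    qed
  next
    case (Pausing j' r)
    have a: "arrive x i s = s1" using Pausing by (simp add: eq)
    have nb: "\<not> busy ?j (arrive x i s)" using a Pausing by (auto simp: busy_def s1)
    have "activeL \<theta> k m x s (clk k x s) = activeL \<theta> k m x s1 (clk k x s1)"
      using Pausing by (simp add: activeL_def waitL_def s1)
    then show ?thesis using nb a j nc unfolding S by (simp add: sizeL_act s1)
  next
    case (Resuming j' r f)
    let ?s2 = "s1\<lparr>act := Resuming j' r (f \<or> i < fst j')\<rparr>"
    have a: "arrive x i s = ?s2" using Resuming by (simp add: eq)
    have b: "busy ?j (arrive x i s) = busy ?j s" using Resuming by (auto simp: busy_def a)
    have r0: "0 \<le> r" using consistentD(7)[OF c Resuming] .
    have "activeL \<theta> k m x s (clk k x s) = activeL \<theta> k m x ?s2 (clk k x ?s2)"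
    proof (cases "j' = ?j")
      case True
      show ?thesis
      proof (cases "i < k")
        case ik: True
        then show ?thesis using True Resuming hitI[OF ik r0] by (simp add: activeL_def resumeL_def s1)
      next
        case ik: False
        have "resumeL \<theta> k W r z (clk k x s) = resumeL \<theta> k W r z (clk k x ?s2)" for W z
          by (rule resumeL_cong) (rule same[OF ik], simp_all add: s1)
        then show ?thesis using True Resuming ik by (simp add: activeL_def s1)
      qed
    next
      case False
      then show ?thesis using Resuming by (simp add: activeL_def waitL_def s1)
    qed
    then show ?thesis using b j nc unfolding S a by (simp add: sizeL_act s1)
  qed
qed

text \<open>Before its arrival the job is represented by the transform of a fresh job with its own
  size. An idle server starts it at once, and there the average over fresh clocks enters; otherwise
  it waits unpaused, with the same transform.\<close>

lemma sizeL_arrive_new: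
  assumes k: "k < n" and w: "wf_state n s" and j: "(k, m) = (i, cnt s i)"
  shows "sizeL \<theta> k m x s (clk k x s) = (if busy (k, m) (arrive x i s) \<and> \<not> busy (k, m) s
     then \<integral>\<^sup>+u. sizeL \<theta> k m x (arrive x i s) u \<partial>E k else sizeL \<theta> k m x (arrive x i s) v)"
proof -
  let ?j = "(k, m)"
  define s1 where "s1 = admit x i s"
  note eq = arrive_eq[of x i s, folded s1_def]
  have "\<not> (?j \<in> present s \<or> ?j \<in> completed s)" "paused s \<subseteq> present s"
    using wf_stateD(2,5)[OF w] by (simp_all add: j)
  then have nj: "?j \<notin> present s" "?j \<notin> completed s" "?j \<notin> paused s" by auto
  have nb: "\<not> busy ?j s" using busy_present[OF w] nj by auto
  have na: "act s \<noteq> Pausing ?j r" for r using wf_stateD(9)[OF w, of ?j r] nj by auto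
  have np: "npause s ?j = 0" using wf_npause[OF w nj(2) nb] nj by simp
  have s1: "present s1 = insert ?j (present s)" "completed s1 = completed s" "paused s1 = paused s"
    "npause s1 = npause s" "nresume s1 = nresume s" "act s1 = act s" "rem s1 ?j = x (Sz k m)" "eff s1 ?j = 0"
    using j by (simp_all add: s1_def)
  have L: "sizeL \<theta> k m x s u = freshL \<theta> k m x (x (Sz k m))" for u using nj by (simp add: sizeL_def)
  show ?thesis
  proof (cases "act s")
    case Idle
    have a: "arrive x i s = dispatch x s1" using Idle by (simp add: eq)
    have "(if busy ?j (dispatch x s1) then \<integral>\<^sup>+u. sizeL \<theta> k m x (dispatch x s1) u \<partial>E k
      else sizeL \<theta> k m x (dispatch x s1) v) = lap \<theta> (eff s1 ?j) * waitL \<theta> k m x s1"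
      by (rule sizeL_dispatch[OF k]) (use nj np in \<open>simp_all add: s1\<close>)
    also have "\<dots> = freshL \<theta> k m x (x (Sz k m))" using nj by (simp add: waitL_def s1)
    finally have "freshL \<theta> k m x (x (Sz k m)) = (if busy ?j (dispatch x s1) then \<integral>\<^sup>+u. sizeL \<theta> k m x (dispatch x s1) u \<partial>E k
      else sizeL \<theta> k m x (dispatch x s1) v)" ..
    then show ?thesis unfolding a L by (simp only: nb simp_thms)
  next
    case (Serve j')
    have nj': "j' \<noteq> ?j" using nb Serve by (auto simp: busy_def)
    have "\<not> busy ?j (arrive x i s)" "activeL \<theta> k m x (arrive x i s) v = freshL \<theta> k m x (x (Sz k m))"
      "?j \<in> present (arrive x i s)" "?j \<notin> completed (arrive x i s)" "eff (arrive x i s) ?j = 0"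
      using nj' nj Serve by (simp_all add: eq busy_def s1 activeL_def waitL_def)
    then show ?thesis by (simp add: L sizeL_act del: arrive_simps)
  next
    case (Pausing j' r)
    have nj': "j' \<noteq> ?j" using na Pausing by auto
    have a: "arrive x i s = s1" using Pausing by (simp add: eq)
    have "\<not> busy ?j s1" "activeL \<theta> k m x s1 v = freshL \<theta> k m x (x (Sz k m))"
      using nj' nj Pausing by (auto simp: busy_def s1 activeL_def waitL_def)
    then show ?thesis using nj by (simp add: L sizeL_act a s1)
  next
    case (Resuming j' r f)
    have nj': "j' \<noteq> ?j" using nb Resuming by (auto simp: busy_def)
    have a: "arrive x i s = s1\<lparr>act := Resuming j' r (f \<or> i < fst j')\<rparr>" using Resuming by (simp add: eq)
    have "\<not> busy ?j (arrive x i s)" "activeL \<theta> k m x (arrive x i s) v = freshL \<theta> k m x (x (Sz k m))"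
      using nj' nj by (simp_all add: busy_def s1 activeL_def waitL_def a)
    then show ?thesis using nj by (simp add: L sizeL_act a s1)
  qed
qed

text \<open>The strict inequality in \<open>t\<close> means that no clock has run out. Hence a
  service with remaining size zero ends without interruption, and a resume that was not flagged
  succeeds.\<close>

lemma sizeL_complete_present:
  fixes s :: qstate
  assumes k: "k < n" and w: "wf_state n s" and t: "\<And>i. i < n \<Longrightarrow> time s < arrival_time x i (cnt s i)"
    and te: "act_end s = Some (time s)" and j: "(k, m) \<in> present s"
  shows "sizeL \<theta> k m x s (clk k x s) = (if busy (k, m) (complete x s) \<and> \<not> busy (k, m) s
     then \<integral>\<^sup>+u. sizeL \<theta> k m x (complete x s) u \<partial>E k else sizeL \<theta> k m x (complete x s) (clk k x (complete x s)))"
proof -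
  let ?j = "(k, m)"
  have kn: "k \<le> n" using k by simp
  have nc: "?j \<notin> completed s" using wf_stateD(3)[OF w] j by auto
  have S: "sizeL \<theta> k m x s u = lap \<theta> (eff s ?j) * activeL \<theta> k m x s u" for u
    using j nc by (rule sizeL_act)
  have "\<not> clk k x s i \<le> 0" if "i < k" for i using t[of i] k that by (simp add: clk_def)
  then have nh: "\<not> hit k (clk k x s) 0" by (auto simp: hit_def)
  have ck: "clk k x (complete x s) = clk k x s" by (simp add: clk_def)
  show ?thesis
  proof (cases "act s")
    case Idle
    then show ?thesis using te by (simp add: act_end_def)
  next
    case (Serve j')
    let ?s0 = "s\<lparr>present := present s - {j'}, completed := insert j' (completed s), rem := (rem s)(j' := 0)\<rparr>"
    have a: "complete x s = dispatch x ?s0" using Serve by (simp add: complete_def)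
    have r0: "rem s j' = 0" using te Serve by (simp add: act_end_def)
    show ?thesis
    proof (cases "j' = ?j")
      case True
      have "busy ?j s" using Serve True by (simp add: busy_def)
      moreover have "sizeL \<theta> k m x (complete x s) u = lap \<theta> (eff s ?j)" for u
        using True Serve by (simp add: sizeL_def)
      moreover have "activeL \<theta> k m x s (clk k x s) = 1"
        using True Serve r0 nh by (simp add: activeL_def serveL_def)
      ultimately show ?thesis by (simp add: S)
    next
      case False
      have nb: "\<not> busy ?j s" using Serve False by (simp add: busy_def)
      have "waitL \<theta> k m x ?s0 = waitL \<theta> k m x s" using False by (simp add: waitL_def)
      moreover have "activeL \<theta> k m x s (clk k x s) = waitL \<theta> k m x s" using False Serve by (simp add: activeL_def)
      ultimately have "sizeL \<theta> k m x s (clk k x s) = lap \<theta> (eff ?s0 ?j) * waitL \<theta> k m x ?s0" by (simp add: S)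
      also have "\<dots> = (if busy ?j (dispatch x ?s0) then \<integral>\<^sup>+u. sizeL \<theta> k m x (dispatch x ?s0) u \<partial>E k
        else sizeL \<theta> k m x (dispatch x ?s0) (clk k x (dispatch x ?s0)))"
        by (rule sizeL_dispatch[OF k, symmetric]) (use False j nc wf_npause[OF w nc nb] in simp_all)
      finally show ?thesis unfolding a by (simp only: nb simp_thms)
    qed
  next
    case (Pausing j' r)
    have a: "complete x s = dispatch x s" using Pausing by (simp add: complete_def)
    have r0: "r = 0" using te Pausing by (simp add: act_end_def)
    have nb: "\<not> busy ?j s" using Pausing by (simp add: busy_def)
    have "j' \<in> paused s" by (rule wf_stateD(9)[OF w Pausing])
    then have "activeL \<theta> k m x s (clk k x s) = waitL \<theta> k m x s"
      using Pausing r0 by (auto simp: activeL_def waitL_def)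
    then have "sizeL \<theta> k m x s (clk k x s) = lap \<theta> (eff s ?j) * waitL \<theta> k m x s" by (simp add: S)
    also have "\<dots> = (if busy ?j (dispatch x s) then \<integral>\<^sup>+u. sizeL \<theta> k m x (dispatch x s) u \<partial>E k
        else sizeL \<theta> k m x (dispatch x s) (clk k x (dispatch x s)))"
      by (rule sizeL_dispatch[OF k j nc wf_npause[OF w nc nb], symmetric])
    finally show ?thesis unfolding a by (simp only: nb simp_thms)
  next
    case (Resuming j' r f)
    have r0: "r = 0" using te Resuming by (simp add: act_end_def)
    have pj': "j' \<in> paused s" by (rule wf_stateD(10)[OF w Resuming])
    have np: "npause s j' = nresume s j'" using wf_stateD(6)[OF w, of j'] Resuming by simp
    show ?thesis
    proof (cases f)
      case f: True
      have a: "complete x s = start_pause x j' s" using Resuming f by (simp add: complete_def)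
      have "activeL \<theta> k m x s (clk k x s) = activeL \<theta> k m x (start_pause x j' s) (clk k x (start_pause x j' s))"
        using Resuming r0 f np pauseL_eq[OF kn, of \<theta> m x "npause s ?j" "rem s ?j"]
        by (cases "j' = ?j") (simp_all add: activeL_def waitL_def)
      moreover have "\<not> busy ?j (complete x s)" by (simp add: a busy_def)
      ultimately show ?thesis using j nc by (simp add: S a sizeL_act)
    next
      case f: False
      let ?s0 = "s\<lparr>act := Serve j', paused := paused s - {j'}\<rparr>"
      have a: "complete x s = ?s0" using Resuming f by (simp add: complete_def)
      have "activeL \<theta> k m x s (clk k x s) = activeL \<theta> k m x ?s0 (clk k x ?s0)"
      proof -
        have "clk k x ?s0 = clk k x s" by (simp add: clk_def)
        then show ?thesis using Resuming r0 f nh by (cases "j' = ?j") (simp_all add: activeL_def waitL_def resumeL_def)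
      qed
      moreover have "busy ?j ?s0 = busy ?j s" using Resuming by (auto simp: busy_def)
      ultimately show ?thesis using j nc by (simp add: S a sizeL_act)
    qed
  qed
qed

text \<open>The pathwise form of the martingale property: the passage of time and the event
  following it preserve the value, and randomness is called for only where the job becomes
  busy.\<close>

lemma sizeL_step:
  assumes k: "k < n" and w: "wf_state n s" and c: "consistent n x s" and r: "regular n x"
  shows "sizeL \<theta> k m x s (clk k x s) = (if busy (k, m) (step n x s) \<and> \<not> busy (k, m) s
     then \<integral>\<^sup>+u. sizeL \<theta> k m x (step n x s) u \<partial>E k else sizeL \<theta> k m x (step n x s) (clk k x (step n x s)))"
proof -
  let ?j = "(k, m)" and ?s' = "step n x s"
  have w': "wf_state n ?s'" by (rule wf_step[OF w n])
  have adv: "sizeL \<theta> k m x (advance s t) (clk k x (advance s t)) = sizeL \<theta> k m x s (clk k x s)" for t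
  proof -
    have "sizeL \<theta> k m x (advance s t) (clk k x (advance s t)) = sizeL \<theta> k m x (advance s t) (\<lambda>i. clk k x s i - (t - time s))"
      by (rule sizeL_cong) (simp add: clk_def)
    then show ?thesis by (simp add: sizeL_advance[OF w])
  qed
  have t: "time s \<le> next_arr n x s" using next_arr_ge[OF n] consistentD(2)[OF c] by blast
  show ?thesis
  proof (cases "?j \<in> completed s")
    case True
    have "?j \<notin> present ?s'" using completed_step(1)[OF w n True, of x] wf_stateD(3)[OF w'] by auto
    then have "\<not> busy ?j ?s'" using busy_present[OF w'] by auto
    then show ?thesis using completed_step[OF w n True, of x] True by (simp add: sizeL_def)
  next
    case nc: False
    show ?thesis
    proof (cases rule: step_cases[of n x s])
      case arrival
      let ?i = "next_cls n x s" and ?s1 = "advance s (next_arr n x s)"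
      have w1: "wf_state n ?s1" using w by simp
      have c1: "consistent n x ?s1" by (rule consistent_advance[OF w c t]) (use arrival in auto)
      have i: "?i < n" "time ?s1 = arrival_time x ?i (cnt ?s1 ?i)" using next_cls[OF n, of x s] by simp_all
      show ?thesis
      proof (cases "?j \<in> present s")
        case True
        then show ?thesis using sizeL_arrive_present[OF k w1 c1 i, of m \<theta>] arrival adv by simp
      next
        case np: False
        show ?thesis
        proof (cases "?j = (?i, cnt s ?i)")
          case True
          then have "?j = (?i, cnt ?s1 ?i)" by simp
          from sizeL_arrive_new[OF k w1 this, where x = x and \<theta> = \<theta> and v = "clk k x ?s'"]
          show ?thesis using arrival adv by simp
        next
          case False
          have "?j \<notin> present ?s'" "?j \<notin> completed ?s'" using arrival np nc False by auto
          moreover have "\<not> busy ?j ?s'" using busy_present[OF w'] \<open>?j \<notin> present ?s'\<close> by auto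
          ultimately show ?thesis using np nc by (simp add: sizeL_def)
        qed
      qed
    next
      case (completion te)
      let ?s1 = "advance s te"
      have w1: "wf_state n ?s1" using w by simp
      have e: "act_end ?s1 = Some (time ?s1)"
        using completion(1) by (cases "act s") (auto simp: act_end_def)
      have lt: "time ?s1 < arrival_time x i (cnt ?s1 i)" if "i < n" for i
        using next_arr_le[OF that, of x s] completion(2) by simp
      show ?thesis
      proof (cases "?j \<in> present s")
        case True
        then show ?thesis using sizeL_complete_present[OF k w1 lt e, of m \<theta>] completion adv by simp
      next
        case np: False
        have "act s \<noteq> Serve ?j" using np wf_stateD(8)[OF w, of ?j] by auto
        then have "?j \<notin> present ?s'" "?j \<notin> completed ?s'" using completion np nc
          by (auto split: act.splits)
        moreover have "\<not> busy ?j ?s'" using busy_present[OF w'] \<open>?j \<notin> present ?s'\<close> by auto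
        ultimately show ?thesis using np nc by (simp add: sizeL_def)
      qed
    qed
  qed
qed

text \<open>Remaining work is nonnegative, so its transform is at most one. The second bound
  expresses, on the level of transforms, that the effective size so far cannot exceed the final
  one.\<close>

lemma sizeL_le_lap:
  assumes k: "k < n" and w: "wf_state n s" and c: "consistent n x s" and r: "regular n x"
    and t: "0 < \<theta>"
  shows "sizeL \<theta> k m x s (clk k x s) \<le> 1"
    "(k, m) \<in> present s \<or> (k, m) \<in> completed s \<Longrightarrow> sizeL \<theta> k m x s (clk k x s) \<le> lap \<theta> (eff s (k, m))"
proof -
  let ?j = "(k, m)"
  have u0: "0 \<le> clk k x s i" if "i < k" for i
    using consistentD(2)[OF c, of i] that k by (simp add: clk_def)
  have e: "0 \<le> eff s ?j" using consistentD(5)[OF c] .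
  have A: "activeL \<theta> k m x s (clk k x s) \<le> 1" if p: "?j \<in> present s"
  proof -
    have r0: "0 \<le> rem s ?j" using consistentD(4)[OF c p] .
    have W: "waitL \<theta> k m x s \<le> 1" unfolding waitL_def using pausedL_le_1[OF k r t r0] by simp
    have U: "\<And>r' q. 0 \<le> r' \<Longrightarrow> pauseL \<theta> k m x q r' \<le> 1" by (rule pausedL_le_1(2)[OF k r t])
    show ?thesis
    proof (cases "act s")
      case Idle then show ?thesis using W by (simp add: activeL_def)
    next
      case (Serve j)
      then show ?thesis using W serveL_le_1[of k "clk k x s" "pauseL \<theta> k m x (npause s ?j)" "rem s ?j" \<theta>] u0 U r0 t
        by (simp add: activeL_def)
    next
      case (Pausing j b)
      then show ?thesis using W consistentD(6)[OF c Pausing] pausedL_le_1(1)[OF k r t r0] t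
        by (simp add: activeL_def mult_le_one lap_le_1)
    next
      case (Resuming j a f)
      then show ?thesis using W consistentD(7)[OF c Resuming] U[OF r0] t r0
          resumeL_le_1[of "pauseL \<theta> k m x (npause s ?j)" a "rem s ?j" \<theta> k "clk k x s"] U
        by (simp add: activeL_def mult_le_one lap_le_1)
    qed
  qed
  have B: "lap \<theta> (eff s ?j) * a \<le> lap \<theta> (eff s ?j)" if "a \<le> 1" for a
    using mult_left_mono[OF that, of "lap \<theta> (eff s ?j)"] by simp
  show L: "sizeL \<theta> k m x s (clk k x s) \<le> lap \<theta> (eff s ?j)" if "?j \<in> present s \<or> ?j \<in> completed s"
    using that A B by (auto simp: sizeL_def)
  have "freshL \<theta> k m x (x (Sz k m)) \<le> 1"
    by (rule pausedL_le_1(3)[OF k r t]) (use r k in \<open>auto simp: regular_def intro: less_imp_le\<close>)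
  then show "sizeL \<theta> k m x s (clk k x s) \<le> 1"
    using L lap_le_1[OF t e] by (cases "?j \<in> present s \<or> ?j \<in> completed s") (auto simp: sizeL_def intro: order_trans)
qed

end

lemma discrete_busy: "discrete (busy j)"
proof -
  have "busy j s = busy j (disc s)" for s by (cases "act s") (auto simp: busy_def disc_def)
  then show ?thesis by (auto simp: discrete_def)
qed

lemma discrete_cnt: "discrete (\<lambda>s. f (cnt s i))"
  by (simp add: discrete_def disc_def)

lemma discrete_completed: "discrete (\<lambda>s. j \<in> completed s)"
  by (simp add: discrete_def disc_def)

section \<open>Dependence on the inputs of a single job\<close>

definition job_inputs :: "nat \<Rightarrow> nat \<Rightarrow> src set" where
  "job_inputs k m = {Sz k m} \<union> range (Ps k m) \<union> range (Rs k m)"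

lemma job_inputs_iff [simp]: "IA i l \<notin> job_inputs k m" "Sz i l \<in> job_inputs k m \<longleftrightarrow> (i, l) = (k, m)"
  "Ps i l p \<in> job_inputs k m \<longleftrightarrow> (i, l) = (k, m)" "Rs i l p \<in> job_inputs k m \<longleftrightarrow> (i, l) = (k, m)"
  by (auto simp: job_inputs_def)

lemma dispatch_other_job:
  assumes x: "\<And>s. s \<notin> job_inputs k m \<Longrightarrow> x' s = x s" and fin: "finite (present s)" and j: "(k, m) \<notin> present s"
  shows "dispatch x' s = dispatch x s"
proof (cases "present s = {}")
  case False
  then have "best (present s) \<noteq> (k, m)" using best_in[OF fin] j by metis
  then have "x' (Rs (fst (best (present s))) (snd (best (present s))) p) = x (Rs (fst (best (present s))) (snd (best (present s))) p)" for p
    by (intro x) (auto simp: prod_eq_iff)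
  then show ?thesis by (simp add: dispatch_def Let_def)
qed (simp add: dispatch_def)

lemma start_pause_other_job:
  assumes x: "\<And>s. s \<notin> job_inputs k m \<Longrightarrow> x' s = x s" and j: "j \<noteq> (k, m)"
  shows "start_pause x' j s = start_pause x j s"
proof -
  have "x' (Ps (fst j) (snd j) p) = x (Ps (fst j) (snd j) p)" for p
    using j by (intro x) (auto simp: prod_eq_iff)
  then show ?thesis by (simp add: start_pause_def)
qed

text \<open>Before its admission a job is neither selected by \<open>dispatch\<close> nor served,
  paused or resumed, so a step does not read its size, pause or resume inputs.\<close>

lemma step_other_job:
  assumes n: "0 < n" and x: "\<And>s. s \<notin> job_inputs k m \<Longrightarrow> x' s = x s"
    and w: "wf_state n s" and m: "\<not> m < cnt (step n x s) k"
  shows "step n x' s = step n x s"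
proof -
  let ?j = "(k, m)"
  have at: "arrival_time x' i l = arrival_time x i l" for i l
    unfolding arrival_time_def by (simp add: x)
  have nx: "next_arr n x' s = next_arr n x s" "next_cls n x' s = next_cls n x s"
    by (simp_all add: next_arr_def next_cls_def at)
  have "\<not> m < cnt s k" using cnt_step[OF n, of s k x] m by simp
  then have np: "?j \<notin> present s" using present_arrived[OF w, of ?j] by auto
  then have na: "act s \<noteq> Serve ?j" "act s \<noteq> Resuming ?j r f" for r f
    using wf_stateD(8)[OF w, of ?j] wf_stateD(10)[OF w, of ?j r f] wf_stateD(5)[OF w] by auto
  have fin: "finite (present s)" by (rule wf_stateD(1)[OF w])
  have arr: "arrive x' i (advance s t) = arrive x i (advance s t)" if i: "(i, cnt s i) \<noteq> ?j" for i t
  proof -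
    have z: "x' (Sz i (cnt s i)) = x (Sz i (cnt s i))" using i by (intro x) auto
    let ?s1 = "\<lambda>x. (advance s t)\<lparr>cnt := (cnt (advance s t))(i := Suc (cnt s i)), present := insert (i, cnt s i) (present s),
             rem := (rem (advance s t))((i, cnt s i) := x (Sz i (cnt s i))), eff := (eff (advance s t))((i, cnt s i) := 0)\<rparr>"
    have d: "dispatch x' (?s1 x) = dispatch x (?s1 x)"
      by (rule dispatch_other_job[OF x]) (use fin np i in auto)
    have p: "start_pause x' j' (?s1 x) = start_pause x j' (?s1 x)" if "act s = Serve j'" for j'
      by (rule start_pause_other_job[OF x]) (use na that in auto)
    show ?thesis using d p by (cases "act s") (simp_all add: arrive_def Let_def z)
  qed
  have com: "complete x' (advance s t) = complete x (advance s t)" for t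
  proof (cases "act s")
    case Idle
    then show ?thesis by (simp add: complete_def)
  next
    case (Serve j)
    then show ?thesis using fin np by (simp add: complete_def) (rule dispatch_other_job[OF x], auto)
  next
    case (Pausing j r)
    then show ?thesis using fin np by (simp add: complete_def) (rule dispatch_other_job[OF x], auto)
  next
    case (Resuming j r f)
    then have "j \<noteq> ?j" using na by auto
    then show ?thesis using Resuming start_pause_other_job[OF x] by (simp add: complete_def)
  qed
  show ?thesis
  proof (cases rule: step_cases[of n x s])
    case arrival
    have "(next_cls n x s, cnt s (next_cls n x s)) \<noteq> ?j" using arrival(1) m by auto
    note a = arr[OF this]
    show ?thesis
    proof (cases "act_end s")
      case None then show ?thesis by (simp add: step_def Let_def nx a)
    next
      case (Some te) then show ?thesis using arrival(2)[OF Some] by (simp add: step_def Let_def nx a)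
    qed
  next
    case (completion te)
    then show ?thesis by (simp add: step_def Let_def nx com)
  qed
qed

lemma run_other_job:
  assumes n: "0 < n" and x: "\<And>s. s \<notin> job_inputs k m \<Longrightarrow> x' s = x s" and m: "\<not> m < cnt (run Q n x e) k"
  shows "run Q n x' e = run Q n x e"
  using m
proof (induction e)
  case (Suc e)
  have "\<not> m < cnt (run Q n x e) k" using cnt_run_mono[OF n, of e "Suc e" Q x k] Suc.prems by simp
  then have eq: "run Q n x' e = run Q n x e" by (rule Suc.IH)
  show ?case
  proof (cases "Q (run Q n x e)")
    case True then show ?thesis by (simp add: run_Suc halting_step_def eq)
  next
    case False
    then have "step n x' (run Q n x e) = step n x (run Q n x e)"
      using Suc.prems by (intro step_other_job[OF n x wf_run[OF n]]) (simp_all add: run_Suc halting_step_def)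
    then show ?thesis by (simp add: run_Suc halting_step_def eq)
  qed
qed simp

context inputs begin

lemma measurable_pausedL:
  assumes k: "k \<le> n"
  shows "(\<lambda>z. pausedL \<theta> k m (fst z) q (snd z)) \<in> borel_measurable (P \<Otimes>\<^sub>M borel)"
  unfolding pausedL_def
  by (rule measurable_integral_E[OF k], rule measurable_resumeL,
      rule measurable_compose_P'[OF measurable_pauseL[OF k], where X = "\<lambda>z. fst (fst z)", OF coord_fst2],
      rule coord_fst2, rule measurable_compose[OF measurable_fst measurable_snd],
      rule measurable_compose[OF measurable_snd measurable_E_component])

lemma measurable_freshL:
  assumes k: "k \<le> n"
  shows "(\<lambda>z. freshL \<theta> k m (fst z) (snd z)) \<in> borel_measurable (P \<Otimes>\<^sub>M borel)"
  unfolding freshL_def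
  by (rule measurable_integral_E[OF k], rule measurable_serveL,
      rule measurable_compose_P'[OF measurable_pauseL[OF k], where X = "\<lambda>z. fst (fst z)", OF coord_fst2],
      rule measurable_compose[OF measurable_fst measurable_snd],
      rule measurable_compose[OF measurable_snd measurable_E_component])

lemma measurable_sizeL:
  assumes k: "k \<le> n" and Q: "discrete Q" and X: "\<And>s. (\<lambda>a. X a s) \<in> borel_measurable A"
    and u: "\<And>i. i < k \<Longrightarrow> (\<lambda>a. u a i) \<in> borel_measurable A"
  shows "(\<lambda>a. sizeL \<theta> k m (X a) (run Q n (X a) e) (u a)) \<in> borel_measurable A"
proof (rule measurable_run[OF _ X Q])
  fix S assume S: "smeas A S"
  let ?j = "(k, m)"
  obtain d r where D: "shape A S d r" by (rule shape_ex[OF S])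
  note d = shapeD[OF D]
  have fresh: "R \<in> borel_measurable A \<Longrightarrow> (\<lambda>a. freshL \<theta> k m (X a) (R a)) \<in> borel_measurable A" for R
    by (rule measurable_compose_P[OF measurable_freshL[OF k] X])
  have paused: "R \<in> borel_measurable A \<Longrightarrow> (\<lambda>a. pausedL \<theta> k m (X a) q (R a)) \<in> borel_measurable A" for R q
    by (rule measurable_compose_P[OF measurable_pausedL[OF k] X])
  have pause: "R \<in> borel_measurable A \<Longrightarrow> (\<lambda>a. pauseL \<theta> k m (X a) q (R a)) \<in> borel_measurable A" for R q
    by (rule measurable_compose_P[OF measurable_pauseL[OF k] X])
  have lap: "R \<in> borel_measurable A \<Longrightarrow> (\<lambda>a. lap \<theta> (R a)) \<in> borel_measurable A" for R
    by (rule measurable_compose[OF _ lap_measurable])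
  have wait: "(\<lambda>a. waitL \<theta> k m (X a) (S a)) \<in> borel_measurable A"
    unfolding waitL_def d(4,5) by (cases "?j \<in> paused d") (simp_all add: fresh[OF d(10)] paused[OF d(10)])
  have serve: "(\<lambda>a. serveL \<theta> k (pauseL \<theta> k m (X a) q) (rem (S a) ?j) (u a)) \<in> borel_measurable A" for q
    by (rule measurable_serveL[OF measurable_compose_P'[OF measurable_pauseL[OF k] X] d(10) u])
  have resume: "(\<lambda>a. resumeL \<theta> k (pauseL \<theta> k m (X a) q) (r a) (rem (S a) ?j) (u a)) \<in> borel_measurable A" for q
    by (rule measurable_resumeL[OF measurable_compose_P'[OF measurable_pauseL[OF k] X] d(8) d(10) u])
  have act: "(\<lambda>a. activeL \<theta> k m (X a) (S a) (u a)) \<in> borel_measurable A"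
  proof (cases "act d")
    case Idle
    then show ?thesis using wait by (simp add: activeL_def d(7))
  next
    case (Serve j)
    then show ?thesis using wait serve by (cases "j = ?j") (simp_all add: activeL_def d(3,7))
  next
    case (Pausing j b)
    then show ?thesis using wait borel_measurable_times_ennreal[OF lap[OF d(8)] paused[OF d(10)]]
      by (cases "j = ?j") (simp_all add: activeL_def d(4,7))
  next
    case (Resuming j b f)
    then show ?thesis using wait resume borel_measurable_times_ennreal[OF lap[OF d(8)] pause[OF d(10)]]
      by (cases "j = ?j"; cases f) (simp_all add: activeL_def d(3,7))
  qed
  show "(\<lambda>a. sizeL \<theta> k m (X a) (S a) (u a)) \<in> borel_measurable A"
    unfolding sizeL_def d(2,6)
    using borel_measurable_times_ennreal[OF lap[OF d(11)] act] lap[OF d(11)] fresh[OF X]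
    by (cases "?j \<in> completed d"; cases "?j \<in> present d") simp_all
qed

lemma pauseN_cong: "(\<And>s. s \<in> job_inputs k m \<Longrightarrow> x' s = x s) \<Longrightarrow> pauseN \<theta> k m N x' q r = pauseN \<theta> k m N x q r"
proof (induction N arbitrary: q r)
  case (Suc N)
  then have "pauseN \<theta> k m N x' (Suc q) = pauseN \<theta> k m N x (Suc q)" by (intro ext) simp
  then show ?case using Suc.prems by simp
qed simp

lemma pauseL_cong: "(\<And>s. s \<in> job_inputs k m \<Longrightarrow> x' s = x s) \<Longrightarrow> pauseL \<theta> k m x' q = pauseL \<theta> k m x q"
  unfolding pauseL_def by (intro ext SUP_cong refl pauseN_cong)

lemma freshL_cong: "(\<And>s. s \<in> job_inputs k m \<Longrightarrow> x' s = x s) \<Longrightarrow> freshL \<theta> k m x' r = freshL \<theta> k m x r"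
  unfolding freshL_def using pauseL_cong[of k m x' x \<theta>] by simp

text \<open>The future arrivals are either integrated out or supplied by \<open>u\<close>, so
  interarrival times enter only through the state and the clocks. This provides the invariance
  required by \<open>memoryless_clk\<close>.\<close>

lemma sizeL_IA: "sizeL \<theta> k m (x(IA i c := y)) s u = sizeL \<theta> k m x s u"
proof -
  have eq: "(x(IA i c := y)) t = x t" if "t \<in> job_inputs k m" for t
    using that by (auto simp: job_inputs_def)
  have U: "pauseL \<theta> k m (x(IA i c := y)) q = pauseL \<theta> k m x q" for q by (rule pauseL_cong[OF eq])
  have V: "freshL \<theta> k m (x(IA i c := y)) r = freshL \<theta> k m x r" for r by (rule freshL_cong[OF eq])
  have W: "pausedL \<theta> k m (x(IA i c := y)) q r = pausedL \<theta> k m x q r" for q r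
    unfolding pausedL_def U by simp
  show ?thesis unfolding sizeL_def activeL_def waitL_def U V W by simp
qed

lemma measurable_sizeL_clk:
  assumes k: "k \<le> n" and Q: "discrete Q"
  shows "(\<lambda>x. sizeL \<theta> k m x (run Q n x e) (clk k x (run Q n x e'))) \<in> borel_measurable P"
proof (rule measurable_sizeL[OF k Q coord])
  fix i assume "i < k"
  then show "(\<lambda>x. clk k x (run Q n x e') i) \<in> borel_measurable P"
    using measurable_compose[OF measurable_clk[of "\<lambda>x. x", OF coord Q] measurable_component_singleton[of i "{..<k}"]] by simp
qed

text \<open>The expectation is split along the event \<open>B\<close> that the job becomes busy in
  this step. \<open>B\<close> is determined by the trajectory up to \<open>Suc e\<close>, so on it
  the actual clocks may be exchanged for fresh ones; then \<open>sizeL_step\<close> applies path by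
  path.\<close>

lemma expect_sizeL_Suc:
  assumes k: "k < n" and Q: "discrete Q"
  shows "(\<E> x. sizeL \<theta> k m x (run Q n x (Suc e)) (clk k x (run Q n x (Suc e)))) =
    (\<E> x. sizeL \<theta> k m x (run Q n x e) (clk k x (run Q n x e)))" (is "(\<E> x. ?S x) = (\<E> x. ?T x)")
proof -
  have kn: "k \<le> n" using k by simp
  let ?j = "(k, m)"
  define B where "B x \<longleftrightarrow> busy ?j (run Q n x (Suc e)) \<and> \<not> busy ?j (run Q n x e)" for x
  define F where "F x u = (if B x then sizeL \<theta> k m x (run Q n x (Suc e)) u else 0)" for x u
  have busy: "(\<lambda>a. busy ?j (run Q n (X a) e)) \<in> measurable A (count_space UNIV)"
    if "\<And>s. (\<lambda>a. X a s) \<in> borel_measurable A" for X e and A :: "'b measure"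
    by (rule measurable_run_discrete[OF that Q discrete_busy]) simp
  have Bm: "Measurable.pred A (\<lambda>a. B (X a))" if "\<And>s. (\<lambda>a. X a s) \<in> borel_measurable A" for X and A :: "'b measure"
    unfolding B_def using busy[of X A, OF that] by (intro pred_intros_logic) auto
  have BP: "{x \<in> space P. B x} \<in> sets P" using Bm[of "\<lambda>x. x" P, OF coord] by (simp add: pred_def)
  have S: "?S \<in> borel_measurable P" by (rule measurable_sizeL_clk[OF kn Q])
  define G where "G x = (if B x then 0 else ?S x)" for x
  have G: "G \<in> borel_measurable P" unfolding G_def by (intro measurable_If S BP) simp
  have F: "case_prod F \<in> borel_measurable (P \<Otimes>\<^sub>M PiM {..<k} (\<lambda>_. borel))"
  proof -
    have "(\<lambda>z. sizeL \<theta> k m (fst z) (run Q n (fst z) (Suc e)) (snd z)) \<in> borel_measurable (P \<Otimes>\<^sub>M PiM {..<k} (\<lambda>_. borel))"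
      by (rule measurable_sizeL[OF kn Q coord_fst]) (rule measurable_compose[OF measurable_snd measurable_component_singleton], simp)
    then have "(\<lambda>z. if B (fst z) then sizeL \<theta> k m (fst z) (run Q n (fst z) (Suc e)) (snd z) else 0) \<in> borel_measurable (P \<Otimes>\<^sub>M PiM {..<k} (\<lambda>_. borel))"
      by (rule measurable_If) (use Bm[of fst, OF coord_fst] in \<open>simp_all add: pred_def\<close>)
    then show ?thesis by (simp only: F_def case_prod_beta')
  qed
  have Fx: "(\<lambda>x. F x (clk k x (run Q n x (Suc e)))) \<in> borel_measurable P"
    unfolding F_def by (intro measurable_If S BP) simp
  have FE: "(\<lambda>x. \<integral>\<^sup>+u. F x u \<partial>E k) \<in> borel_measurable P"
  proof (rule measurable_integral_E[OF kn])
    have e: "sets (P \<Otimes>\<^sub>M PiM {..<k} (\<lambda>_. borel)) = sets (P \<Otimes>\<^sub>M E k)"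
      by (intro sets_pair_measure_cong sets_E[symmetric] refl)
    show "(\<lambda>z. F (fst z) (snd z)) \<in> borel_measurable (P \<Otimes>\<^sub>M E k)"
      using F unfolding measurable_cong_sets[OF e refl] case_prod_beta' .
  qed
  have "(\<E> x. ?S x) = (\<E> x. F x (clk k x (run Q n x (Suc e))) + G x)"
    by (intro nn_integral_cong) (simp add: F_def G_def)
  also have "\<dots> = (\<E> x. F x (clk k x (run Q n x (Suc e)))) + (\<E> x. G x)"
    by (rule nn_integral_add[OF Fx G])
  also have "(\<E> x. F x (clk k x (run Q n x (Suc e)))) = (\<E> x. \<integral>\<^sup>+u. F x u \<partial>E k)"
  proof (rule memoryless_clk[OF kn Q F], intro allI impI)
    fix i c x y u
    assume "\<forall>e'\<le>Suc e. run Q n (x(IA i c := y)) e' = run Q n x e'"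
    then have "run Q n (x(IA i c := y)) (Suc e) = run Q n x (Suc e)" "run Q n (x(IA i c := y)) e = run Q n x e"
      by simp_all
    then show "F (x(IA i c := y)) u = F x u" by (simp only: F_def B_def sizeL_IA)
  qed
  also have "\<dots> + (\<E> x. G x) = (\<E> x. (\<integral>\<^sup>+u. F x u \<partial>E k) + G x)"
    by (rule nn_integral_add[OF FE G, symmetric])
  also have "\<dots> = (\<E> x. ?T x)"
    using AE_regular
  proof (intro nn_integral_cong_AE, eventually_elim)
    case (elim x)
    show ?case
    proof (cases "Q (run Q n x e)")
      case True
      then have "run Q n x (Suc e) = run Q n x e" by (simp add: run_Suc halting_step_def)
      then show ?thesis by (simp add: F_def G_def B_def)
    next
      case False
      then have "run Q n x (Suc e) = step n x (run Q n x e)" by (simp add: run_Suc halting_step_def)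
      then have T: "?T x = (if B x then \<integral>\<^sup>+u. sizeL \<theta> k m x (run Q n x (Suc e)) u \<partial>E k else ?S x)"
        using sizeL_step[OF k wf_run[OF n] consistent_run[OF n elim(2)] elim(2), of \<theta> m Q e] by (simp only: B_def)
      show ?thesis unfolding T by (cases "B x") (simp_all add: F_def G_def)
    qed
  qed
  finally show ?thesis .
qed

definition meanL :: "real \<Rightarrow> nat \<Rightarrow> nat \<Rightarrow> ennreal" where
  "meanL \<theta> k m = (\<E> x. freshL \<theta> k m x (x (Sz k m)))"

text \<open>The value at event 0 does not involve \<open>Q\<close>. This links the unstopped system,
  whose effective sizes define the load, with the system stopped at its return.\<close>

lemma expect_sizeL:
  assumes k: "k < n" and Q: "discrete Q"
  shows "(\<E> x. sizeL \<theta> k m x (run Q n x e) (clk k x (run Q n x e))) = meanL \<theta> k m"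
proof (induction e)
  case 0
  then show ?case by (simp add: sizeL_def init_state_def meanL_def)
next
  case (Suc e)
  then show ?case using expect_sizeL_Suc[OF k Q] by simp
qed

end

section \<open>Exchangeability within a class, and the limit of small \<theta>\<close>

definition job_swap :: "nat \<Rightarrow> nat \<Rightarrow> src \<Rightarrow> src" where
  "job_swap k m s = (case s of IA i l \<Rightarrow> IA i l
     | Sz i l \<Rightarrow> Sz i (if i = k then Transposition.transpose m 0 l else l)
     | Ps i l p \<Rightarrow> Ps i (if i = k then Transposition.transpose m 0 l else l) p
     | Rs i l p \<Rightarrow> Rs i (if i = k then Transposition.transpose m 0 l else l) p)"

lemma job_swap_involutory: "job_swap k m (job_swap k m s) = s"
  by (cases s) (simp_all add: job_swap_def)

lemma lap_minus: "1 - lap \<theta> z = ennreal (1 - exp (- \<theta> * z))"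
  unfolding lap_def ennreal_1[symmetric] by (rule ennreal_minus) simp

lemma lap_loss:
  assumes "0 < \<theta>" "0 \<le> z"
  shows "(1 - lap \<theta> z) * ennreal (1 / \<theta>) \<le> ennreal z"
proof -
  have "1 - exp (- \<theta> * z) \<le> \<theta> * z" using exp_ge_add_one_self[of "- \<theta> * z"] by simp
  then have "(1 - exp (- \<theta> * z)) * (1 / \<theta>) \<le> z" using assms by (simp add: field_simps)
  then show ?thesis unfolding lap_minus using assms by (simp add: ennreal_mult''[symmetric] ennreal_leI)
qed

text \<open>The difference quotient of \<open>exp (- h * z)\<close> at \<open>h = 0\<close>, taken
  along \<open>h = 1 / Suc N\<close>.\<close>

lemma lap_loss_tendsto:
  assumes "0 \<le> z"
  shows "(\<lambda>N. (1 - lap (1 / real (Suc N)) z) * ennreal (real (Suc N))) \<longlonglongrightarrow> ennreal z"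
proof -
  have d: "((\<lambda>h. (exp (- (0 + h) * z) - exp (- 0 * z)) / h) \<longlongrightarrow> - z) (at 0)"
  proof -
    have "((\<lambda>t. exp (- t * z)) has_real_derivative - z) (at 0)"
      by (auto intro!: derivative_eq_intros)
    then show ?thesis unfolding DERIV_def by simp
  qed
  have f: "filterlim (\<lambda>N. 1 / real (Suc N)) (at 0) sequentially"
    using LIMSEQ_inverse_real_of_nat by (auto simp: filterlim_at inverse_eq_divide)
  from filterlim_compose[OF d f]
  have "(\<lambda>N. (exp (- (1 / real (Suc N)) * z) - 1) * real (Suc N)) \<longlonglongrightarrow> - z"
    by (simp add: field_simps)
  from tendsto_minus[OF this]
  have "(\<lambda>N. (1 - exp (- (1 / real (Suc N)) * z)) * real (Suc N)) \<longlonglongrightarrow> z"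
    by (simp add: algebra_simps)
  from tendsto_ennrealI[OF this]
  have "(\<lambda>N. ennreal ((1 - exp (- (1 / real (Suc N)) * z)) * real (Suc N))) \<longlonglongrightarrow> ennreal z" .
  moreover have "ennreal ((1 - exp (- (1 / real (Suc N)) * z)) * real (Suc N)) = (1 - lap (1 / real (Suc N)) z) * ennreal (real (Suc N))" for N
    unfolding lap_minus by (rule ennreal_mult'') simp
  ultimately show ?thesis by (simp only:)
qed

context inputs begin

lemma P_UNIV [simp]: "emeasure P UNIV = 1"
  using P.emeasure_space_1 by simp

lemma \<mu>_job_swap:
  assumes k: "k < n"
  shows "\<mu> (job_swap k m s) = \<mu> s"
proof -
  have "\<mu> (Sz k a) = \<mu> (Sz k b)" "\<mu> (Ps k a p) = \<mu> (Ps k b p)" "\<mu> (Rs k a p) = \<mu> (Rs k b p)" for a b p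
    by (rule trans[OF Sz[OF k] Sz[OF k, symmetric]], rule trans[OF Ps[OF k] Ps[OF k, symmetric]],
        rule trans[OF Rs[OF k] Rs[OF k, symmetric]])
  note eq = this(1)[of "Transposition.transpose m 0 a" a for a]
    this(2)[of "Transposition.transpose m 0 a" _ a for a] this(3)[of "Transposition.transpose m 0 a" _ a for a]
  show ?thesis by (cases s) (simp_all add: job_swap_def eq)
qed

lemma measurable_job_swap: "(\<lambda>x s. x (job_swap k m s)) \<in> measurable P P"
  by (rule measurable_PI) (rule coord)

lemma distr_job_swap:
  assumes "k < n"
  shows "distr P P (\<lambda>x s. x (job_swap k m s)) = P"
proof -
  have "inj (job_swap k m)" by (rule inj_on_inverseI[of _ "job_swap k m"]) (rule job_swap_involutory)
  from distr_PiM_reindex[where M = \<mu> and f = "job_swap k m" and K = UNIV and I = UNIV, OF prob_\<mu> this]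
  show ?thesis using \<mu>_job_swap[OF assms, of m] by (simp add: restrict_UNIV)
qed

lemma pauseN_job_swap: "pauseN \<theta> k m N (\<lambda>s. x (job_swap k m s)) q r = pauseN \<theta> k 0 N x q r"
proof (induction N arbitrary: q r)
  case (Suc N)
  then have "pauseN \<theta> k m N (\<lambda>s. x (job_swap k m s)) (Suc q) = pauseN \<theta> k 0 N x (Suc q)" by (intro ext)
  moreover have "job_swap k m (Ps k m q) = Ps k 0 q" "job_swap k m (Rs k m q) = Rs k 0 q"
    by (simp_all add: job_swap_def)
  ultimately show ?case by simp
qed simp

text \<open>The transform of a fresh job reads only that job's own inputs, and exchanging them with
  those of job 0 of the class preserves the law.\<close>

lemma meanL_eq:
  assumes k: "k < n"
  shows "meanL \<theta> k m = meanL \<theta> k 0"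
proof -
  have kn: "k \<le> n" using k by simp
  have U: "pauseL \<theta> k m (\<lambda>s. x (job_swap k m s)) q = pauseL \<theta> k 0 x q" for x q
    unfolding pauseL_def pauseN_job_swap ..
  have s: "job_swap k m (Sz k m) = Sz k 0" by (simp add: job_swap_def)
  have m: "(\<lambda>x. freshL \<theta> k m x (x (Sz k m))) \<in> borel_measurable P"
    by (rule measurable_compose_P[OF measurable_freshL[OF kn] coord coord])
  have "meanL \<theta> k m = (\<integral>\<^sup>+x. freshL \<theta> k m x (x (Sz k m)) \<partial>distr P P (\<lambda>x s. x (job_swap k m s)))"
    by (simp only: distr_job_swap[OF k] meanL_def)
  also have "\<dots> = (\<E> x. freshL \<theta> k m (\<lambda>s. x (job_swap k m s)) (x (job_swap k m (Sz k m))))"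
    by (rule nn_integral_distr[OF measurable_job_swap]) (simp add: m)
  also have "\<dots> = meanL \<theta> k 0" unfolding meanL_def freshL_def U s ..
  finally show ?thesis .
qed

lemma meanL_le_1:
  assumes k: "k < n" and t: "0 < \<theta>"
  shows "meanL \<theta> k m \<le> 1"
proof -
  have "meanL \<theta> k m \<le> (\<E> x. 1)"
    unfolding meanL_def using AE_regular
    by (intro nn_integral_mono_AE, eventually_elim)
      (rule pausedL_le_1(3)[OF k _ t], use k in \<open>auto simp: regular_def intro: less_imp_le\<close>)
  then show ?thesis by simp
qed

lemma measurable_arrived:
  assumes Q: "discrete Q"
  shows "{x \<in> space P. m < cnt (run Q n x e) k} \<in> sets P"
proof -
  have "(\<lambda>x. m < cnt (run Q n x e) k) \<in> measurable P (count_space UNIV)"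
    by (rule measurable_run_discrete[OF coord Q discrete_cnt[where f = "\<lambda>c. m < c"]]) simp
  then show ?thesis by (simp add: pred_def)
qed

text \<open>Before its arrival a job contributes only its own inputs, which are independent of
  the event that it has not yet arrived.\<close>

lemma expect_sizeL_arrived:
  assumes k: "k < n" and Q: "discrete Q" and t: "0 < \<theta>"
  shows "(\<E> x. (if m < cnt (run Q n x e) k then sizeL \<theta> k m x (run Q n x e) (clk k x (run Q n x e)) else 0))
    = emeasure P {x. m < cnt (run Q n x e) k} * meanL \<theta> k 0" (is "?I = ?p * ?v")
proof -
  have kn: "k \<le> n" using k by simp
  let ?A = "{x. m < cnt (run Q n x e) k}"
  define S where "S x = sizeL \<theta> k m x (run Q n x e) (clk k x (run Q n x e))" for x
  define V where "V x = freshL \<theta> k m x (x (Sz k m))" for x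
  have A: "?A \<in> sets P" using measurable_arrived[OF Q, of m e k] by simp
  have Sm: "S \<in> borel_measurable P" unfolding S_def by (rule measurable_sizeL_clk[OF kn Q])
  have Vm: "V \<in> borel_measurable P" unfolding V_def
    by (rule measurable_compose_P[OF measurable_freshL[OF kn] coord coord])
  have nA: "- ?A \<in> sets P" using sets.compl_sets[OF A] by (simp add: Compl_eq_Diff_UNIV)
  have ind: "indicator (- ?A) \<in> borel_measurable P" using nA by (rule borel_measurable_indicator)
  have iA: "(\<lambda>x. if m < cnt (run Q n x e) k then S x else 0) \<in> borel_measurable P"
    by (rule measurable_If[OF Sm]) (use A in auto)
  have eq: "S x = (if m < cnt (run Q n x e) k then S x else 0) + indicator (- ?A) x * V x" for x
  proof (cases "m < cnt (run Q n x e) k")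
    case False
    then have "(k, m) \<notin> present (run Q n x e)" "(k, m) \<notin> completed (run Q n x e)"
      using wf_stateD(2)[OF wf_run[OF n], of "(k, m)" Q x e] by auto
    then show ?thesis using False by (simp add: S_def V_def sizeL_def)
  qed simp
  have "meanL \<theta> k m = (\<E> x. S x)" unfolding S_def by (rule expect_sizeL[OF k Q, symmetric])
  also have "\<dots> = (\<E> x. (if m < cnt (run Q n x e) k then S x else 0) + indicator (- ?A) x * V x)"
    by (rule nn_integral_cong) (rule eq)
  also have "\<dots> = (\<E> x. (if m < cnt (run Q n x e) k then S x else 0)) + (\<E> x. indicator (- ?A) x * V x)"
    by (rule nn_integral_add[OF iA borel_measurable_times_ennreal[OF ind Vm]])
  also have "(\<E> x. (if m < cnt (run Q n x e) k then S x else 0)) = ?I" unfolding S_def ..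
  also have "(\<E> x. indicator (- ?A) x * V x) = (\<E> x. indicator (- ?A) x) * (\<E> x. V x)"
  proof (rule independent[OF ind Vm, where A = "job_inputs k m"])
    fix x x' :: "src \<Rightarrow> real"
    let ?y = "\<lambda>s. if s \<in> job_inputs k m then x' s else x s"
    show "V ?y = V x'" unfolding V_def using freshL_cong[of k m ?y x' \<theta>] by simp
    have 1: "run Q n ?y e = run Q n x e" if "\<not> m < cnt (run Q n x e) k"
      by (rule run_other_job[OF n _ that]) simp
    have 2: "run Q n x e = run Q n ?y e" if "\<not> m < cnt (run Q n ?y e) k"
      by (rule run_other_job[OF n _ that]) simp
    have "m < cnt (run Q n ?y e) k \<longleftrightarrow> m < cnt (run Q n x e) k" using 1 2 by metis
    then show "indicator (- ?A) ?y = (indicator (- ?A) x :: ennreal)" by (simp add: indicator_def)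
  qed
  also have "(\<E> x. V x) = ?v" unfolding V_def using meanL_eq[OF k, of \<theta> m] by (simp add: meanL_def)
  also have "(\<E> x. indicator (- ?A) x) = emeasure P (- ?A)" by (rule nn_integral_indicator[OF nA])
  finally have 1: "?v = ?I + emeasure P (- ?A) * ?v" unfolding meanL_eq[OF k, of \<theta> m] .
  \<comment> \<open>The constant is split along the same event, so that the finite contribution of
    the case not yet arrived cancels against the one in \<open>1\<close>.\<close>
  have 2: "?v = ?p * ?v + emeasure P (- ?A) * ?v"
  proof -
    have "?p + emeasure P (- ?A) = emeasure P (?A \<union> - ?A)"
      by (intro plus_emeasure A nA) auto
    then have "?p + emeasure P (- ?A) = 1" by simp
    then show ?thesis by (simp add: distrib_right[symmetric])
  qed
  have "emeasure P (- ?A) * ?v < \<infinity>"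
  proof -
    have "emeasure P (- ?A) * ?v \<le> 1 * 1"
      by (intro mult_mono meanL_le_1[OF k t]) (auto intro: P.emeasure_le_1)
    then show ?thesis by (auto intro: le_less_trans)
  qed
  moreover have "?I + emeasure P (- ?A) * ?v = ?p * ?v + emeasure P (- ?A) * ?v" using trans[OF 1[symmetric] 2] .
  ultimately show ?thesis
    using ennreal_add_left_cancel[of "emeasure P (- ?A) * ?v" ?I "?p * ?v"] by (simp only: add.commute) auto
qed

section \<open>From transforms to mean effective sizes\<close>

definition completedL_at :: "real \<Rightarrow> nat \<Rightarrow> nat \<Rightarrow> (src \<Rightarrow> real) \<Rightarrow> ennreal" where
  "completedL_at \<theta> k e x = (if (k, 0) \<in> completed (sys n x e) then lap \<theta> (eff (sys n x e) (k, 0)) else 0)"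

text \<open>This is \<open>exp (- \<theta> * R)\<close> for the effective size \<open>R\<close>,
  read as zero if the job never completes. The supremum is over an increasing sequence of measurable
  functions, since \<open>eff\<close> is frozen after completion.\<close>

definition completedL :: "real \<Rightarrow> nat \<Rightarrow> (src \<Rightarrow> real) \<Rightarrow> ennreal" where
  "completedL \<theta> k x = (SUP e. completedL_at \<theta> k e x)"

lemma completedL_at_measurable: "completedL_at \<theta> k e \<in> borel_measurable P"
  unfolding completedL_at_def sys_eq_run
proof (rule measurable_If)
  have Q: "discrete (\<lambda>_::qstate. False)" by (simp add: discrete_def)
  show "(\<lambda>x. lap \<theta> (eff (run (\<lambda>_. False) n x e) (k, 0))) \<in> borel_measurable P"
    by (rule measurable_compose[OF measurable_run_time(2)[OF coord Q] lap_measurable])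
  show "{x \<in> space P. (k, 0) \<in> completed (run (\<lambda>_. False) n x e)} \<in> sets P"
    using measurable_run_discrete[OF coord Q discrete_completed[of "(k, 0)"], where N = "count_space UNIV" and n = n and e = e]
    by (simp add: pred_def)
qed simp

lemma completedL_measurable [measurable]: "completedL \<theta> k \<in> borel_measurable P"
  unfolding completedL_def by (intro borel_measurable_SUP completedL_at_measurable) simp

text \<open>At each event \<open>completedL_at\<close> is the restriction of the martingale to the
  paths on which the job has completed; the other paths contribute a nonnegative amount to its
  mean.\<close>

lemma completedL_le:
  assumes k: "k < n" and t: "0 < \<theta>"
  shows "(\<E> x. completedL \<theta> k x) \<le> meanL \<theta> k 0"
proof -
  let ?Q = "\<lambda>_::qstate. False"
  have Q: "discrete ?Q" by (simp add: discrete_def)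
  have inc: "incseq (completedL_at \<theta> k)"
  proof (rule incseq_SucI, rule le_funI)
    fix e x
    show "completedL_at \<theta> k e x \<le> completedL_at \<theta> k (Suc e) x"
      using completed_run_mono[OF n, of e "Suc e" "(k, 0)" ?Q x] by (auto simp: completedL_at_def sys_eq_run)
  qed
  have "(\<E> x. completedL \<theta> k x) = (SUP e. \<E> x. completedL_at \<theta> k e x)"
    unfolding completedL_def by (rule nn_integral_monotone_convergence_SUP[OF inc completedL_at_measurable])
  also have "\<dots> \<le> meanL \<theta> k 0"
  proof (rule SUP_least)
    fix e
    have "completedL_at \<theta> k e x \<le> sizeL \<theta> k 0 x (run ?Q n x e) (clk k x (run ?Q n x e))" for x
      by (simp add: completedL_at_def sys_eq_run sizeL_def)
    then show "(\<E> x. completedL_at \<theta> k e x) \<le> meanL \<theta> k 0"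
      unfolding expect_sizeL[OF k Q, of \<theta> 0 e, symmetric] by (rule nn_integral_mono)
  qed
  finally show ?thesis .
qed

text \<open>\<open>(1 - exp (- \<theta> R)) / \<theta>\<close> is a measurable minorant of \<open>R\<close>, so the measurability of \<open>eff_size\<close> is never
  needed.\<close>

definition loss :: "real \<Rightarrow> nat \<Rightarrow> (src \<Rightarrow> real) \<Rightarrow> ennreal" where
  "loss \<theta> k x = (1 - completedL \<theta> k x) * ennreal (1 / \<theta>)"

lemma loss_measurable: "loss \<theta> k \<in> borel_measurable P"
  unfolding loss_def by measurable

lemma loss_le_eff_size:
  assumes x: "regular n x" and t: "0 < \<theta>"
  shows "loss \<theta> k x \<le> eff_size n x (k, 0)"
proof (cases "\<exists>e. (k, 0) \<in> completed (sys n x e)")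
  case True
  let ?e = "LEAST e. (k, 0) \<in> completed (sys n x e)"
  have c: "(k, 0) \<in> completed (sys n x ?e)" using True by (rule LeastI_ex)
  let ?z = "eff (sys n x ?e) (k, 0)"
  have z: "0 \<le> ?z" using consistentD(5)[OF consistent_run[OF n x]] by (simp add: sys_eq_run)
  have "lap \<theta> ?z \<le> completedL \<theta> k x"
    unfolding completedL_def using c by (intro SUP_upper2[of ?e]) (auto simp: completedL_at_def)
  then have "loss \<theta> k x \<le> (1 - lap \<theta> ?z) * ennreal (1 / \<theta>)"
    unfolding loss_def by (intro mult_right_mono ennreal_minus_mono) auto
  also have "\<dots> \<le> ennreal ?z" by (rule lap_loss[OF t z])
  finally show ?thesis using True by (simp add: eff_size_def)
qed (simp add: eff_size_def)

text \<open>By \<open>completedL_le\<close> the deficit of \<open>meanL\<close> from one is at most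
  that of the completed job's transform, and the latter is \<open>\<theta>\<close> times the
  expected \<open>loss\<close>.\<close>

lemma meanL_ge:
  assumes k: "k < n" and t: "0 < \<theta>" and r: "(\<E> x. loss \<theta> k x) \<le> r"
  shows "1 - meanL \<theta> k 0 \<le> ennreal \<theta> * r"
proof -
  have "1 - meanL \<theta> k 0 \<le> 1 - (\<E> x. completedL \<theta> k x)"
    by (intro ennreal_minus_mono order_refl completedL_le[OF k t])
  also have "\<dots> \<le> (\<E> x. (1 - completedL \<theta> k x))"
  proof -
    have "1 = (\<E> x. 1)" by simp
    also have "\<dots> \<le> (\<E> x. (1 - completedL \<theta> k x) + completedL \<theta> k x)"
      by (intro nn_integral_mono) (metis add.commute ennreal_le_minus_iff ennreal_minus_le_iff order_refl)
    also have "\<dots> = (\<E> x. (1 - completedL \<theta> k x)) + (\<E> x. completedL \<theta> k x)"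
      by (rule nn_integral_add) measurable
    finally show ?thesis by (subst ennreal_minus_le_iff) (auto simp: add.commute)
  qed
  also have "\<dots> = (\<E> x. ennreal \<theta> * loss \<theta> k x)"
  proof (rule nn_integral_cong)
    fix x
    have "ennreal \<theta> * ennreal (1 / \<theta>) = 1" using t by (simp add: ennreal_mult[symmetric])
    then show "1 - completedL \<theta> k x = ennreal \<theta> * loss \<theta> k x"
      unfolding loss_def by (metis mult.commute mult.left_commute mult.right_neutral)
  qed
  also have "\<dots> = ennreal \<theta> * (\<E> x. loss \<theta> k x)"
    by (rule nn_integral_cmult[OF loss_measurable])
  also have "\<dots> \<le> ennreal \<theta> * r" by (intro mult_left_mono r) simp
  finally show ?thesis .
qed

text \<open>On the event of arrival the martingale has mean \<open>?p * ?v\<close> and is at most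
  the transform of the work done so far. Taking complements leaves at most
  \<open>?p * (1 - ?v)\<close>.\<close>

lemma expect_eff_loss:
  assumes k: "k < n" and Q: "discrete Q" and t: "0 < \<theta>" and r: "(\<E> x. loss \<theta> k x) \<le> r"
  shows "(\<E> x. (if m < cnt (run Q n x e) k then 1 - lap \<theta> (eff (run Q n x e) (k, m)) else 0))
    \<le> emeasure P {x. m < cnt (run Q n x e) k} * (ennreal \<theta> * r)" (is "?a \<le> ?p * _")
proof -
  let ?v = "meanL \<theta> k 0" and ?A = "{x. m < cnt (run Q n x e) k}"
  have A: "?A \<in> sets P" using measurable_arrived[OF Q, of m e k] by simp
  have L: "(\<lambda>x. lap \<theta> (eff (run Q n x e) (k, m))) \<in> borel_measurable P"
    by (rule measurable_compose[OF measurable_run_time(2)[OF coord Q] lap_measurable])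
  let ?b = "\<E> x. (if m < cnt (run Q n x e) k then lap \<theta> (eff (run Q n x e) (k, m)) else 0)"
  have "?a + ?b = (\<E> x. (if m < cnt (run Q n x e) k then 1 - lap \<theta> (eff (run Q n x e) (k, m)) else 0)
      + (if m < cnt (run Q n x e) k then lap \<theta> (eff (run Q n x e) (k, m)) else 0))"
    by (rule nn_integral_add[symmetric]; rule measurable_If) (use L A in auto)
  also have "\<dots> = (\<E> x. indicator ?A x)"
    using AE_regular
  proof (intro nn_integral_cong_AE, eventually_elim)
    case (elim x)
    have "lap \<theta> (eff (run Q n x e) (k, m)) \<le> 1"
      by (rule lap_le_1[OF t consistentD(5)[OF consistent_run[OF n elim(2)]]])
    then show ?case by (simp add: indicator_def ennreal_diff_add_assoc diff_add_cancel_ennreal)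
  qed
  also have "\<dots> = ?p" using A by simp
  finally have ab: "?a + ?b = ?p" .
  have "?p * ?v \<le> ?b"
    unfolding expect_sizeL_arrived[OF k Q t, symmetric]
    using AE_regular
  proof (intro nn_integral_mono_AE, eventually_elim)
    case (elim x)
    have "sizeL \<theta> k m x (run Q n x e) (clk k x (run Q n x e)) \<le> lap \<theta> (eff (run Q n x e) (k, m))"
      if "m < cnt (run Q n x e) k"
      using that wf_stateD(2)[OF wf_run[OF n], of "(k, m)" Q x e]
      by (intro sizeL_le_lap(2)[OF k wf_run[OF n] consistent_run[OF n elim(2)] elim(2) t]) auto
    then show ?case by simp
  qed
  then have "?a + ?p * ?v \<le> ?a + ?b" by (rule add_left_mono)
  also have "\<dots> = ?p" by (rule ab)
  finally have 1: "?a + ?p * ?v \<le> ?p" .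
  have v: "?v \<le> 1" by (rule meanL_le_1[OF k t])
  have p1: "?p \<le> 1" by (rule P.emeasure_le_1)
  have "?p * (1 - ?v) + ?p * ?v = ?p * (1 - ?v + ?v)" by (rule distrib_left[symmetric])
  also have "1 - ?v + ?v = 1" by (rule diff_add_cancel_ennreal[OF v])
  finally have 2: "?p * (1 - ?v) + ?p * ?v = ?p" by simp
  have "?p * ?v \<le> 1 * 1" by (rule mult_mono[OF p1 v]) simp_all
  then have 3: "?p * ?v < \<infinity>" by (auto intro: le_less_trans)
  have "?p * ?v + ?a \<le> ?p * ?v + ?p * (1 - ?v)" using 1 2 by (simp only: add.commute)
  then have "?a \<le> ?p * (1 - ?v)" using 3 unfolding ennreal_add_left_cancel_le by (elim disjE) auto
  also have "\<dots> \<le> ?p * (ennreal \<theta> * r)" by (intro mult_left_mono meanL_ge[OF k t r]) simp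
  finally show ?thesis .
qed

text \<open>The preceding bound divided by \<open>\<theta>\<close>, along
  \<open>\<theta> = 1 / Suc N\<close>. For an upper bound on the limit Fatou's lemma
  suffices.\<close>

lemma expect_eff:
  assumes k: "k < n" and Q: "discrete Q" and r: "\<And>\<theta>. 0 < \<theta> \<Longrightarrow> (\<E> x. loss \<theta> k x) \<le> r"
  shows "(\<E> x. (if m < cnt (run Q n x e) k then ennreal (eff (run Q n x e) (k, m)) else 0))
    \<le> emeasure P {x. m < cnt (run Q n x e) k} * r" (is "?I \<le> ?p * r")
proof -
  define f where "f N x = (if m < cnt (run Q n x e) k then (1 - lap (1 / real (Suc N)) (eff (run Q n x e) (k, m))) else 0)" for N x
  define g where "g N x = f N x * ennreal (real (Suc N))" for N x
  let ?A = "{x. m < cnt (run Q n x e) k}"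
  have A: "?A \<in> sets P" using measurable_arrived[OF Q, of m e k] by simp
  have L: "(\<lambda>x. lap \<theta> (eff (run Q n x e) (k, m))) \<in> borel_measurable P" for \<theta>
    by (rule measurable_compose[OF measurable_run_time(2)[OF coord Q] lap_measurable])
  have fm: "f N \<in> borel_measurable P" for N
    unfolding f_def by (rule measurable_If) (use L A in auto)
  have gm: "g N \<in> borel_measurable P" for N
    unfolding g_def by (intro borel_measurable_times_ennreal fm) simp
  have "?I = (\<E> x. liminf (\<lambda>N. g N x))"
    using AE_regular
  proof (intro nn_integral_cong_AE, eventually_elim)
    case (elim x)
    have "0 \<le> eff (run Q n x e) (k, m)" by (rule consistentD(5)[OF consistent_run[OF n elim(2)]])
    from lap_loss_tendsto[OF this]
    have "(\<lambda>N. g N x) \<longlonglongrightarrow> (if m < cnt (run Q n x e) k then ennreal (eff (run Q n x e) (k, m)) else 0)"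
      unfolding g_def f_def by simp
    from lim_imp_Liminf[OF _ this] show ?case by simp
  qed
  also have "\<dots> \<le> liminf (\<lambda>N. \<E> x. g N x)" by (rule nn_integral_liminf[OF gm])
  also have "\<dots> \<le> liminf (\<lambda>N. ?p * r)"
  proof (rule Liminf_mono, rule always_eventually, rule allI)
    fix N
    let ?\<theta> = "1 / real (Suc N)"
    have t: "0 < ?\<theta>" by simp
    have "(\<E> x. g N x) = (\<E> x. f N x) * ennreal (real (Suc N))"
      unfolding g_def by (rule nn_integral_multc[OF fm])
    also have "\<dots> \<le> (?p * (ennreal ?\<theta> * r)) * ennreal (real (Suc N))"
      unfolding f_def by (intro mult_right_mono expect_eff_loss[OF k Q t r[OF t]]) simp
    also have "\<dots> = ?p * r * (ennreal ?\<theta> * ennreal (real (Suc N)))" by (simp only: mult_ac)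
    also have "ennreal ?\<theta> * ennreal (real (Suc N)) = 1" by (subst ennreal_mult[symmetric]) simp_all
    finally show "(\<E> x. g N x) \<le> ?p * r" by simp
  qed
  also have "\<dots> = ?p * r" by (simp add: Liminf_const)
  finally show ?thesis .
qed

end

subsection \<open>Stopping at the first return to the empty state\<close>

text \<open>The requirement of a completed job distinguishes a return from the initial state, which
  is empty as well.\<close>

definition returned :: "qstate \<Rightarrow> bool" where
  "returned s \<longleftrightarrow> present s = {} \<and> completed s \<noteq> {}"

lemma discrete_returned: "discrete returned"
  by (simp add: discrete_def returned_def disc_def)

text \<open>The values make every non-arrival event decrease twice the number of jobs present plus
  the phase: a pause goes from 2 to at most 1, a failed resume from 3 to 2, a successful one from 1
  to 0, and the end of a service trades a job, worth 2, for at most 1.\<close>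

definition phase :: "act \<Rightarrow> nat" where
  "phase a = (case a of Idle \<Rightarrow> 1 | Serve j \<Rightarrow> 0 | Pausing j r \<Rightarrow> 2 | Resuming j r f \<Rightarrow> if f then 3 else 1)"

lemma phase_dispatch: "phase (act (dispatch x s)) \<le> 1"
  by (simp add: dispatch_act phase_def)

text \<open>Between two arrivals the quantity \<open>2 * card (present s) + phase (act s)\<close> drops at each event,
  so the number of events is at most linear in the number of arrivals.\<close>

lemma events_le_arrivals:
  assumes n: "0 < n" and nr: "\<And>e'. e' < e \<Longrightarrow> \<not> returned (run returned n x e')"
  shows "2 * card (present (run returned n x e)) + phase (act (run returned n x e)) + e \<le> 5 * (\<Sum>i<n. cnt (run returned n x e) i) + 1"
  using nr
proof (induction e)
  case 0
  then show ?case by (simp add: init_state_def phase_def)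
next
  case (Suc e)
  let ?s = "run returned n x e"
  have IH: "2 * card (present ?s) + phase (act ?s) + e \<le> 5 * (\<Sum>i<n. cnt ?s i) + 1"
    by (rule Suc.IH) (use Suc.prems in auto)
  have w: "wf_state n ?s" by (rule wf_run[OF n])
  have fin: "finite (present ?s)" by (rule wf_stateD(1)[OF w])
  have step: "run returned n x (Suc e) = step n x ?s"
    using Suc.prems[of e] by (simp add: run_Suc halting_step_def)
  have pa: "phase (act (advance s t)) = phase (act s)" for s t
    by (cases "act s") (simp_all add: phase_def)
  show ?case unfolding step
  proof (cases rule: step_cases[of n x ?s])
    case arrival
    let ?i = "next_cls n x ?s" and ?s1 = "advance ?s (next_arr n x ?s)"
    have i: "?i < n" by (rule next_cls(1)[OF n])
    have "(\<Sum>i<n. cnt (arrive x ?i ?s1) i) = (\<Sum>i<n. cnt ?s i) + 1"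
    proof -
      have "(\<Sum>i<n. cnt (arrive x ?i ?s1) i) = (\<Sum>i<n. cnt ?s i + (if i = ?i then 1 else 0))"
        by (rule sum.cong) auto
      then show ?thesis using i by (simp add: sum.distrib)
    qed
    moreover have "card (present (arrive x ?i ?s1)) \<le> card (present ?s) + 1"
      using fin by (simp add: card_insert_if)
    \<comment> \<open>The worst cases are an interrupted service and a resume that becomes flagged.
      Together with 2 for the new job and 1 for the event itself this gives the factor 5.\<close>
    moreover have "phase (act (arrive x ?i ?s1)) \<le> phase (act ?s1) + 2"
      by (cases "act ?s1") (auto simp: arrive_def Let_def phase_def dispatch_act)
    ultimately show "2 * card (present (step n x ?s)) + phase (act (step n x ?s)) + Suc e \<le> 5 * (\<Sum>i<n. cnt (step n x ?s) i) + 1"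
      using IH arrival(1) pa by simp
  next
    case (completion te)
    let ?s1 = "advance ?s te"
    have "2 * card (present (complete x ?s1)) + phase (act (complete x ?s1)) + 1 \<le> 2 * card (present ?s1) + phase (act ?s1)"
    proof (cases "act ?s1")
      case Idle
      then show ?thesis using completion(1) by (cases "act ?s") (simp_all add: act_end_def)
    next
      case (Serve j)
      then have "act ?s = Serve j" by (cases "act ?s") simp_all
      then have j: "j \<in> present ?s" using wf_stateD(8)[OF w] by blast
      let ?s0 = "?s1\<lparr>present := present ?s1 - {j}, completed := insert j (completed ?s1), rem := (rem ?s1)(j := 0)\<rparr>"
      have "card (present ?s0) + 1 = card (present ?s1)" using card_Suc_Diff1[OF fin j] by simp
      moreover have "complete x ?s1 = dispatch x ?s0" using Serve by (simp only: complete_def act.case)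
      moreover have "phase (act ?s1) = 0" unfolding Serve by (simp add: phase_def)
      ultimately show ?thesis using phase_dispatch[of x ?s0] by (simp only: dispatch_simps)
    next
      case (Pausing j r)
      then show ?thesis using phase_dispatch[of x ?s1] by (simp add: complete_def phase_def[of "Pausing j r"])
    next
      case (Resuming j r f)
      then show ?thesis by (simp add: complete_def phase_def)
    qed
    moreover have "cnt (complete x ?s1) = cnt ?s" by simp
    ultimately show "2 * card (present (step n x ?s)) + phase (act (step n x ?s)) + Suc e \<le> 5 * (\<Sum>i<n. cnt (step n x ?s) i) + 1"
      using IH completion pa by simp
  qed
qed

lemma run_returned_eq_sys:
  assumes "\<And>e'. e' < e \<Longrightarrow> \<not> returned (run returned n x e')"
  shows "run returned n x e = sys n x e"
  using assms
proof (induction e)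
  case (Suc e)
  then have "run returned n x e = sys n x e" by simp
  moreover have "\<not> returned (run returned n x e)" by (rule Suc.prems) simp
  ultimately show ?case by (simp add: run_Suc halting_step_def sys_def)
qed (simp add: sys_def)

lemma run_returned_const:
  assumes "returned (run returned n x e0)" "e0 \<le> e"
  shows "run returned n x e = run returned n x e0"
  using assms(2) by (induction rule: dec_induct) (simp_all add: run_Suc halting_step_def assms(1))

text \<open>The first event is an arrival, and a job that has arrived remains either present or
  completed. Hence emptiness after the first event amounts to \<open>returned\<close>.\<close>

lemma present_or_completed:
  assumes n: "0 < n" and e: "0 < e"
  shows "present (sys n x e) \<union> completed (sys n x e) \<noteq> {}"
proof -
  let ?Q = "\<lambda>_::qstate. False"
  have "run ?Q n x 1 = step n x init_state" by (simp add: run_Suc halting_step_def)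
  also have "\<dots> = arrive x (next_cls n x init_state) (advance init_state (next_arr n x init_state))"
    by (simp add: step_def act_end_def init_state_def Let_def)
  finally have "cnt (run ?Q n x 1) (next_cls n x init_state) = Suc (cnt init_state (next_cls n x init_state))"
    by simp
  then have "0 < cnt (run ?Q n x e) (next_cls n x init_state)"
    using cnt_run_mono[OF n, of 1 e ?Q x "next_cls n x init_state"] e by simp
  then show ?thesis using wf_stateD(2)[OF wf_run[OF n], of "(next_cls n x init_state, 0)" ?Q x e]
    by (auto simp: sys_eq_run)
qed

text \<open>The arrival counts are added so that the quantity diverges on every path that never
  returns, even if its event times were to stay bounded.\<close>

definition progress :: "nat \<Rightarrow> (src \<Rightarrow> real) \<Rightarrow> nat \<Rightarrow> ennreal" where
  "progress n x e = ennreal (time (run returned n x e)) + (\<Sum>i<n. of_nat (cnt (run returned n x e) i))"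

lemma return_time_le_liminf:
  assumes n: "0 < n" and x: "regular n x"
  shows "return_time n x \<le> liminf (progress n x)"
proof (cases "\<exists>e>0. present (sys n x e) = {}")
  case True
  define \<tau> where "\<tau> = (LEAST e. e > 0 \<and> present (sys n x e) = {})"
  have \<tau>: "0 < \<tau>" "present (sys n x \<tau>) = {}" using LeastI_ex[OF True] unfolding \<tau>_def by auto
  have nr: "\<not> returned (run returned n x e')" if "e' < \<tau>" for e'
    using that
  proof (induction e' rule: less_induct)
    case (less e')
    then have eq: "run returned n x e' = sys n x e'" by (intro run_returned_eq_sys) auto
    show ?case
    proof (cases "e' = 0")
      case True
      then show ?thesis by (simp add: returned_def init_state_def)
    next
      case False
      then have "present (sys n x e') \<noteq> {}" using less.prems not_less_Least[of e' "\<lambda>e. e > 0 \<and> present (sys n x e) = {}"]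
        unfolding \<tau>_def by auto
      then show ?thesis unfolding eq by (simp add: returned_def)
    qed
  qed
  then have eq: "run returned n x \<tau> = sys n x \<tau>" by (rule run_returned_eq_sys)
  have "returned (run returned n x \<tau>)"
    using present_or_completed[OF n \<tau>(1), of x] \<tau>(2) unfolding eq by (auto simp: returned_def)
  then have c: "run returned n x e = sys n x \<tau>" if "\<tau> \<le> e" for e
    using run_returned_const[OF _ that, of n x] eq by simp
  have "return_time n x = ennreal (time (sys n x \<tau>))"
    using True unfolding return_time_def \<tau>_def by simp
  also have "\<dots> \<le> liminf (progress n x)"
  proof (rule Liminf_bounded)
    show "\<forall>\<^sub>F e in sequentially. ennreal (time (sys n x \<tau>)) \<le> progress n x e"
      using eventually_ge_at_top[of \<tau>] by eventually_elim (simp add: c progress_def)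
  qed
  finally show ?thesis .
next
  case False
  have nr: "\<not> returned (run returned n x e)" for e
  proof (induction e rule: less_induct)
    case (less e)
    then have eq: "run returned n x e = sys n x e" by (intro run_returned_eq_sys) auto
    show ?case
    proof (cases "e = 0")
      case True
      then show ?thesis by (simp add: returned_def init_state_def)
    next
      case e: False
      then have "present (sys n x e) \<noteq> {}" using False by blast
      then show ?thesis unfolding eq by (simp add: returned_def)
    qed
  qed
  define L where "L = liminf (progress n x)"
  have L: "of_nat N \<le> L" for N
    unfolding L_def
  proof (rule Liminf_bounded)
    show "\<forall>\<^sub>F e in sequentially. of_nat N \<le> progress n x e"
      \<comment> \<open>The bound of \<open>events_le_arrivals\<close> solved for the arrivals:
        \<open>5 * N + 1\<close> events force at least \<open>N\<close> of them.\<close>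
      using eventually_ge_at_top[of "5 * N + 1"]
    proof eventually_elim
      case (elim e)
      have "5 * N + 1 \<le> 5 * (\<Sum>i<n. cnt (run returned n x (5 * N + 1)) i) + 1"
        by (rule order_trans[OF le_add2 events_le_arrivals[OF n nr]])
      then have "N \<le> (\<Sum>i<n. cnt (run returned n x (5 * N + 1)) i)" by linarith
      also have "\<dots> \<le> (\<Sum>i<n. cnt (run returned n x e) i)" by (intro sum_mono cnt_run_mono[OF n elim])
      finally have "(of_nat N :: ennreal) \<le> of_nat (\<Sum>i<n. cnt (run returned n x e) i)" by (simp only: of_nat_le_iff)
      also have "\<dots> \<le> progress n x e"
        unfolding of_nat_sum progress_def by (rule add_increasing) simp_all
      finally show ?case .
    qed
  qed
  have "L = top"
  proof (rule ccontr)
    assume "L \<noteq> top"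
    then have "L < top" by (simp add: less_top)
    then obtain N where "L < of_nat N" using ennreal_Ex_less_of_nat by blast
    then show False using L[of N] by simp
  qed
  then show ?thesis unfolding L_def by simp
qed

text \<open>The server is idle only until the first arrival, so afterwards all elapsed time is attributed to jobs.\<close>

lemma time_eq_sum_eff:
  assumes n: "0 < n"
  shows "time (run returned n x e) = (if e = 0 then 0 else next_arr n x init_state) +
     (\<Sum>k<n. \<Sum>m<cnt (run returned n x e) k. eff (run returned n x e) (k, m))"
proof (induction e)
  case 0
  then show ?case by (simp add: init_state_def)
next
  case (Suc e)
  let ?s = "run returned n x e" and ?I = "if e = 0 then 0 else next_arr n x init_state"
  define W where "W s = (\<Sum>k<n. \<Sum>m<cnt s k. eff s (k, m))" for s :: qstate
  have w: "wf_state n ?s" by (rule wf_run[OF n])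
  have W_arrive: "W (arrive x i s) = W s" if "i < n" for i and s :: qstate
  proof -
    have "(\<Sum>m<cnt (arrive x i s) k. eff (arrive x i s) (k, m)) = (\<Sum>m<cnt s k. eff s (k, m))" for k
      by (cases "k = i") (auto intro!: sum.cong)
    then show ?thesis unfolding W_def by simp
  qed
  have W_complete: "W (complete x s) = W s" for s :: qstate by (simp add: W_def)
  have W_upd: "(\<Sum>k<n. \<Sum>m<cnt ?s k. ((eff ?s)(j := eff ?s j + d)) (k, m)) = W ?s + d"
    if j: "j \<in> present ?s" for j d
  proof -
    obtain k0 m0 where j0: "j = (k0, m0)" by (cases j)
    have b: "m0 < cnt ?s k0" "k0 < n" using present_arrived[OF w j] by (simp_all add: j0)
    have "(\<Sum>m<cnt ?s k. ((eff ?s)(j := eff ?s j + d)) (k, m)) = (\<Sum>m<cnt ?s k. eff ?s (k, m)) + (if k = k0 then d else 0)" for k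
    proof -
      have "(\<Sum>m<cnt ?s k. ((eff ?s)(j := eff ?s j + d)) (k, m)) = (\<Sum>m<cnt ?s k. eff ?s (k, m) + (if m = m0 then (if k = k0 then d else 0) else 0))"
        by (rule sum.cong) (auto simp: j0)
      then show ?thesis using b by (auto simp: sum.distrib)
    qed
    then show ?thesis using b by (simp add: W_def sum.distrib)
  qed
  have W_advance: "W (advance ?s t) = W ?s + (t - time ?s)" if "act ?s \<noteq> Idle" for t
  proof -
    obtain j where j: "j \<in> present ?s" "eff (advance ?s t) = (eff ?s)(j := eff ?s j + (t - time ?s))"
    proof (cases "act ?s")
      case (Serve j) then show ?thesis using that[of j] wf_stateD(8)[OF w Serve] by simp
    next
      case (Pausing j r) then show ?thesis using that[of j] wf_stateD(9)[OF w Pausing] wf_stateD(5)[OF w] by auto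
    next
      case (Resuming j r f) then show ?thesis using that[of j] wf_stateD(10)[OF w Resuming] wf_stateD(5)[OF w] by auto
    qed (use \<open>act ?s \<noteq> Idle\<close> in simp)
    have "W (advance ?s t) = (\<Sum>k<n. \<Sum>m<cnt ?s k. eff (advance ?s t) (k, m))" by (simp add: W_def)
    then show ?thesis unfolding j(2) using W_upd[OF j(1)] by simp
  qed
  have IH: "time ?s = ?I + W ?s" using Suc.IH by (simp add: W_def)
  have "time (run returned n x (Suc e)) = next_arr n x init_state + W (run returned n x (Suc e))"
  proof (cases "returned ?s")
    case True
    then have "e \<noteq> 0" by (auto simp: returned_def init_state_def intro: ccontr)
    then show ?thesis using True IH by (simp add: run_Suc halting_step_def)
  next
    case False
    then have step: "run returned n x (Suc e) = step n x ?s" by (simp add: run_Suc halting_step_def)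
    show ?thesis
    proof (cases "e = 0")
      case True
      have "step n x init_state = arrive x (next_cls n x init_state) (advance init_state (next_arr n x init_state))"
        by (simp add: step_def act_end_def init_state_def Let_def)
      moreover have "W (advance init_state t) = 0" for t by (simp add: W_def init_state_def)
      ultimately show ?thesis unfolding step using True W_arrive[OF next_cls(1)[OF n]] by simp
    next
      case e: False
      \<comment> \<open>An idle server means an empty system. After the first event some job has
        arrived, so it would be completed and the state would already be
        \<open>returned\<close>.\<close>
      have "e \<noteq> 0 \<Longrightarrow> act ?s \<noteq> Idle"
      proof
        assume "act ?s = Idle"
        then have p: "present ?s = {}" by (rule wf_stateD(11)[OF w])
        then have nr: "completed ?s = {}" using False by (simp add: returned_def)
        have "cnt (run returned n x 1) (next_cls n x init_state) = Suc (cnt init_state (next_cls n x init_state))"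
          by (simp add: run_Suc halting_step_def returned_def init_state_def step_def act_end_def Let_def)
        then have "0 < cnt ?s (next_cls n x init_state)"
          using cnt_run_mono[OF n, of 1 e returned x "next_cls n x init_state"] e by simp
        then show False using wf_stateD(2)[OF w, of "(next_cls n x init_state, 0)"] p nr by simp
      qed
      then have adv: "W (advance ?s t) = W ?s + (t - time ?s)" for t using W_advance e by blast
      show ?thesis unfolding step
      proof (cases rule: step_cases[of n x ?s])
        case arrival
        then show "time (step n x ?s) = next_arr n x init_state + W (step n x ?s)"
          using IH e adv W_arrive[OF next_cls(1)[OF n]] by simp
      next
        case (completion te)
        then show "time (step n x ?s) = next_arr n x init_state + W (step n x ?s)"
          using IH e adv W_complete by simp
      qed
    qed
  qed
  then show ?case by (simp add: W_def)
qed

section \<open>Wald's identity and the bound on the expected stopped time\<close>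

lemma arrived_IA:
  assumes n: "0 < n"
  shows "m \<le> cnt (run Q n (x(IA i m := y)) e) i \<longleftrightarrow> m \<le> cnt (run Q n x e) i"
proof -
  have "run Q n (x(IA i m := y)) e = run Q n x e" if "\<not> m \<le> cnt (run Q n x e) i" for x y
    by (rule run_agree[OF n refl]) (use that in auto)
  from this[of x y] this[of "x(IA i m := y)" "x (IA i m)"] show ?thesis by fastforce
qed

lemma suminf_of_bool: "(\<Sum>m. if m < N then c else 0) = of_nat N * (c :: ennreal)"
  using suminf_finite[of "{..<N}" "\<lambda>m. if m < N then c else 0"] by simp

context inputs begin

lemma measurable_cnt: "discrete Q \<Longrightarrow> (\<lambda>x. cnt (run Q n x e) i) \<in> measurable P (count_space UNIV)"
  by (rule measurable_run_discrete[OF coord _ discrete_cnt[where f = "\<lambda>c. c"]]) simp_all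

lemma measurable_time [measurable]: "discrete Q \<Longrightarrow> (\<lambda>x. time (run Q n x e)) \<in> borel_measurable P"
  by (rule measurable_run_time(1)[OF coord])

lemma expect_residual:
  assumes i: "i < n" and Q: "discrete Q"
  shows "(\<E> x. ennreal (arrival_time x i (cnt (run Q n x e) i) - time (run Q n x e))) = ennreal (1 / lam i)"
proof -
  have "(\<lambda>(x, u). ennreal u) \<in> borel_measurable (P \<Otimes>\<^sub>M borel)" by simp
  from memoryless[OF i Q this, of e]
  show ?thesis using expm_mean[OF lam[OF i]] by simp
qed

text \<open>The arrival time at index \<open>cnt\<close> is that of the pending arrival and sums
  \<open>cnt + 1\<close> interarrival times, which explains the summand 1. By
  \<open>arrived_IA\<close> the event \<open>m \<le> cnt\<close> does not involve the interarrival
  time number \<open>m\<close>, so each summand can be averaged separately.\<close>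

lemma wald:
  assumes i: "i < n" and Q: "discrete Q"
  shows "(\<E> x. ennreal (arrival_time x i (cnt (run Q n x e) i))) =
    ennreal (1 / lam i) * (1 + (\<E> x. of_nat (cnt (run Q n x e) i)))"
proof -
  have C [measurable]: "(\<lambda>x. cnt (run Q n x e) i) \<in> measurable P (count_space UNIV)" by (rule measurable_cnt[OF Q])
  let ?g = "\<lambda>m x. if m < Suc (cnt (run Q n x e) i) then ennreal (x (IA i m)) else 0"
  have gm [measurable]: "?g m \<in> borel_measurable P" for m by measurable
  have "(\<E> x. ennreal (arrival_time x i (cnt (run Q n x e) i))) = (\<E> x. (\<Sum>m. ?g m x))"
    using AE_regular
  proof (intro nn_integral_cong_AE, eventually_elim)
    case (elim x)
    then have p: "0 \<le> x (IA i m)" for m using i unfolding regular_def by (auto intro: less_imp_le)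
    have "(\<Sum>m. ?g m x) = (\<Sum>m\<in>{..<Suc (cnt (run Q n x e) i)}. ?g m x)"
      by (rule suminf_finite) auto
    also have "\<dots> = (\<Sum>m\<le>cnt (run Q n x e) i. ennreal (x (IA i m)))"
      by (rule sum.cong) auto
    also have "\<dots> = ennreal (arrival_time x i (cnt (run Q n x e) i))"
      unfolding arrival_time_def by (rule sum_ennreal) (rule p)
    finally show ?case ..
  qed
  also have "\<dots> = (\<Sum>m. \<E> x. ?g m x)" by (rule nn_integral_suminf[OF gm])
  also have "\<dots> = (\<Sum>m. \<E> x. (if m < Suc (cnt (run Q n x e) i) then ennreal (1 / lam i) else 0))"
  proof (intro suminf_cong)
    fix m
    have "(\<E> x. ?g m x) = (\<E> x. \<integral>\<^sup>+y. ?g m (x(IA i m := y)) \<partial>expm (lam i))"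
      unfolding IA[OF i, of m, symmetric] by (rule resample[OF gm])
    also have "\<dots> = (\<E> x. (if m < Suc (cnt (run Q n x e) i) then ennreal (1 / lam i) else 0))"
    proof (rule nn_integral_cong)
      fix x
      have "?g m (x(IA i m := y)) = (if m < Suc (cnt (run Q n x e) i) then ennreal y else 0)" for y
        using arrived_IA[OF n, of m Q x i y e] by (simp add: less_Suc_eq_le)
      then show "(\<integral>\<^sup>+y. ?g m (x(IA i m := y)) \<partial>expm (lam i)) = (if m < Suc (cnt (run Q n x e) i) then ennreal (1 / lam i) else 0)"
        using expm_mean[OF lam[OF i]] by (cases "m < Suc (cnt (run Q n x e) i)") simp_all
    qed
    finally show "(\<E> x. ?g m x) = (\<E> x. (if m < Suc (cnt (run Q n x e) i) then ennreal (1 / lam i) else 0))" .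
  qed
  also have "\<dots> = (\<E> x. (\<Sum>m. if m < Suc (cnt (run Q n x e) i) then ennreal (1 / lam i) else 0))"
    by (rule nn_integral_suminf[symmetric]) measurable
  also have "\<dots> = (\<E> x. ennreal (1 / lam i) * (1 + of_nat (cnt (run Q n x e) i)))"
    unfolding suminf_of_bool by (simp add: mult.commute)
  also have "\<dots> = ennreal (1 / lam i) * (\<E> x. 1 + of_nat (cnt (run Q n x e) i))"
    by (rule nn_integral_cmult) measurable
  also have "(\<E> x. 1 + of_nat (cnt (run Q n x e) i)) = (\<E> x. 1) + (\<E> x. of_nat (cnt (run Q n x e) i))"
    by (rule nn_integral_add) measurable
  finally show ?thesis by simp
qed

text \<open>The pending arrival time is the current time plus a residual clock of mean
  \<open>1 / lam i\<close>; this mean cancels against the summand 1 in \<open>wald\<close>.\<close>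

lemma expect_cnt:
  assumes i: "i < n" and Q: "discrete Q"
  shows "(\<E> x. of_nat (cnt (run Q n x e) i)) = ennreal (lam i) * (\<E> x. ennreal (time (run Q n x e)))"
    (is "?N = _ * ?b")
proof -
  let ?c = "ennreal (1 / lam i)"
  have T: "(\<lambda>x. time (run Q n x e)) \<in> borel_measurable P" by (rule measurable_time[OF Q])
  have A: "(\<lambda>x. arrival_time x i (cnt (run Q n x e) i)) \<in> borel_measurable P"
    by (rule measurable_compose_countable[OF arrival_time_measurable[OF coord] measurable_cnt[OF Q]])
  have "?c * (1 + ?N) = (\<E> x. ennreal (arrival_time x i (cnt (run Q n x e) i)))" by (rule wald[OF i Q, symmetric])
  also have "\<dots> = (\<E> x. ennreal (time (run Q n x e)) + ennreal (arrival_time x i (cnt (run Q n x e) i) - time (run Q n x e)))"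
    using AE_regular
  proof (intro nn_integral_cong_AE, eventually_elim)
    case (elim x)
    note C = consistentD[OF consistent_run[OF n elim(2), of Q e]]
    show ?case using C(1) C(2)[OF i] by (subst ennreal_plus[symmetric]) simp_all
  qed
  also have "\<dots> = ?b + (\<E> x. ennreal (arrival_time x i (cnt (run Q n x e) i) - time (run Q n x e)))"
    by (rule nn_integral_add) (use T A in measurable)
  also have "\<dots> = ?b + ?c" by (simp only: expect_residual[OF i Q])
  finally have "?c + ?c * ?N = ?c + ?b" by (simp add: distrib_left add.commute)
  then have e: "?c * ?N = ?b" unfolding ennreal_add_left_cancel by simp
  have "ennreal (lam i) * ?c = 1" using lam[OF i] by (simp add: ennreal_mult[symmetric])
  then have "?N = ennreal (lam i) * (?c * ?N)" by (simp only: mult.assoc[symmetric] mult_1)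
  then show ?thesis unfolding e .
qed

lemma cnt_le_events: "cnt (run Q n x e) i \<le> e"
proof (induction e)
  case 0
  then show ?case by (simp add: init_state_def)
next
  case (Suc e)
  have "cnt (step n x s) i \<le> Suc (cnt s i)" for s by (cases rule: step_cases[of n x s]) auto
  then show ?case using Suc by (auto simp: run_Suc halting_step_def intro: le_SucI order_trans)
qed

text \<open>At most \<open>e\<close> jobs arrive in \<open>e\<close> events, and
  \<open>expect_cnt\<close> converts arrivals into time.\<close>

lemma expect_time_finite:
  assumes Q: "discrete Q"
  shows "(\<E> x. ennreal (time (run Q n x e))) < \<infinity>"
proof -
  let ?b = "\<E> x. ennreal (time (run Q n x e))"
  have "(\<E> x. of_nat (cnt (run Q n x e) 0)) \<le> (\<E> x. of_nat e)"
    by (intro nn_integral_mono) (simp add: cnt_le_events)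
  then have "ennreal (lam 0) * ?b \<le> of_nat e" unfolding expect_cnt[OF n Q] by simp
  also have "of_nat e < (\<infinity> :: ennreal)" by (simp add: of_nat_less_top)
  finally show ?thesis using lam[OF n] by (auto simp: ennreal_mult_less_top less_top)
qed

text \<open>Wald's identity turns the identity \<open>time_eq_sum_eff\<close> into the inequality
  \<open>b \<le> c + \<rho> * b\<close> for the expected stopped time \<open>b\<close>.\<close>

lemma expect_time_le:
  assumes r: "\<And>k \<theta>. k < n \<Longrightarrow> 0 < \<theta> \<Longrightarrow> (\<E> x. loss \<theta> k x) \<le> r k"
    and rho: "(\<Sum>k<n. ennreal (lam k) * r k) < 1"
  shows "(\<E> x. ennreal (time (run returned n x e))) \<le> ennreal (1 / lam 0) / (1 - (\<Sum>k<n. ennreal (lam k) * r k))"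
proof -
  note Q = discrete_returned
  let ?b = "\<E> x. ennreal (time (run returned n x e))"
  let ?\<rho> = "\<Sum>k<n. ennreal (lam k) * r k"
  let ?c = "ennreal (1 / lam 0)"
  let ?g = "\<lambda>k m x. if m < cnt (run returned n x e) k then ennreal (eff (run returned n x e) (k, m)) else 0"
  have E [measurable]: "(\<lambda>x. eff (run returned n x e) j) \<in> borel_measurable P" for j
    by (rule measurable_run_time(2)[OF coord Q])
  have C [measurable]: "(\<lambda>x. cnt (run returned n x e) k) \<in> measurable P (count_space UNIV)" for k
    by (rule measurable_cnt[OF Q])
  have gm [measurable]: "?g k m \<in> borel_measurable P" for k m by measurable
  have "?b \<le> (\<E> x. ennreal (x (IA 0 0)) + (\<Sum>k<n. \<Sum>m. ?g k m x))"
    using AE_regular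
  proof (intro nn_integral_mono_AE, eventually_elim)
    case (elim x)
    let ?s = "run returned n x e"
    have e0: "0 \<le> eff ?s j" for j by (rule consistentD(5)[OF consistent_run[OF n elim(2)]])
    \<comment> \<open>Class 0 serves as a representative: its first arrival is no earlier than the
      first arrival overall and has mean \<open>1 / lam 0\<close>.\<close>
    have "next_arr n x init_state \<le> x (IA 0 0)"
      using next_arr_le[OF n, of x init_state] by (simp add: arrival_time_def init_state_def)
    moreover have "0 < x (IA 0 0)" using elim(2) n by (auto simp: regular_def)
    ultimately have "time ?s \<le> x (IA 0 0) + (\<Sum>k<n. \<Sum>m<cnt ?s k. eff ?s (k, m))"
      unfolding time_eq_sum_eff[OF n, of x e] by auto
    then have "ennreal (time ?s) \<le> ennreal (x (IA 0 0) + (\<Sum>k<n. \<Sum>m<cnt ?s k. eff ?s (k, m)))"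
      by (rule ennreal_leI)
    also have "\<dots> = ennreal (x (IA 0 0)) + ennreal (\<Sum>k<n. \<Sum>m<cnt ?s k. eff ?s (k, m))"
      using \<open>0 < x (IA 0 0)\<close> e0 by (intro ennreal_plus sum_nonneg) auto
    also have "ennreal (\<Sum>k<n. \<Sum>m<cnt ?s k. eff ?s (k, m)) = (\<Sum>k<n. \<Sum>m<cnt ?s k. ennreal (eff ?s (k, m)))"
      using e0 by (simp add: sum_ennreal[symmetric] sum_nonneg del: sum_ennreal)
    also have "\<dots> = (\<Sum>k<n. \<Sum>m. ?g k m x)"
    proof (rule sum.cong[OF refl])
      fix k
      have "(\<Sum>m. ?g k m x) = (\<Sum>m<cnt ?s k. ?g k m x)" by (rule suminf_finite) auto
      also have "\<dots> = (\<Sum>m<cnt ?s k. ennreal (eff ?s (k, m)))" by (rule sum.cong) auto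
      finally show "(\<Sum>m<cnt ?s k. ennreal (eff ?s (k, m))) = (\<Sum>m. ?g k m x)" ..
    qed
    finally show ?case .
  qed
  also have "\<dots> = (\<E> x. ennreal (x (IA 0 0))) + (\<E> x. (\<Sum>k<n. \<Sum>m. ?g k m x))"
    by (rule nn_integral_add) measurable
  also have "(\<E> x. ennreal (x (IA 0 0))) = ?c"
  proof -
    have "(\<E> x. ennreal (x (IA 0 0))) = (\<E> x. \<integral>\<^sup>+y. ennreal ((x(IA 0 0 := y)) (IA 0 0)) \<partial>\<mu> (IA 0 0))"
      by (rule resample) measurable
    then show ?thesis using expm_mean[OF lam[OF n]] IA[OF n, of 0] by simp
  qed
  also have "(\<E> x. (\<Sum>k<n. \<Sum>m. ?g k m x)) = (\<Sum>k<n. \<E> x. (\<Sum>m. ?g k m x))"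
    by (rule nn_integral_sum) measurable
  also have "\<dots> = (\<Sum>k<n. \<Sum>m. \<E> x. ?g k m x)"
    by (intro sum.cong refl nn_integral_suminf gm)
  also have "\<dots> \<le> (\<Sum>k<n. ennreal (lam k) * r k * ?b)"
  proof (rule sum_mono)
    fix k assume "k \<in> {..<n}"
    then have k: "k < n" by simp
    have A: "{x. m < cnt (run returned n x e) k} \<in> sets P" for m using measurable_arrived[OF Q, of m e k] by simp
    \<comment> \<open>The probabilities that job \<open>(k, m)\<close> has arrived add up over
      \<open>m\<close> to the expected number of class \<open>k\<close> arrivals.\<close>
    have "(\<Sum>m. \<E> x. ?g k m x) \<le> (\<Sum>m. emeasure P {x. m < cnt (run returned n x e) k} * r k)"
      by (intro suminf_le expect_eff[OF k Q r[OF k]]) auto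
    also have "\<dots> = (\<Sum>m. emeasure P {x. m < cnt (run returned n x e) k}) * r k"
      by (rule ennreal_suminf_multc)
    also have "(\<Sum>m. emeasure P {x. m < cnt (run returned n x e) k}) = (\<Sum>m. \<E> x. indicator {x. m < cnt (run returned n x e) k} x)"
      using A by simp
    also have "\<dots> = (\<E> x. (\<Sum>m. indicator {x. m < cnt (run returned n x e) k} x))"
      by (rule nn_integral_suminf[symmetric]) (rule borel_measurable_indicator[OF A])
    also have "\<dots> = (\<E> x. of_nat (cnt (run returned n x e) k))"
      using suminf_of_bool[where c = 1] by (intro nn_integral_cong) (simp add: indicator_def of_bool_def)
    also have "\<dots> = ennreal (lam k) * ?b" by (rule expect_cnt[OF k Q])
    finally show "(\<Sum>m. \<E> x. ?g k m x) \<le> ennreal (lam k) * r k * ?b" by (simp only: mult_ac)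
  qed
  also have "\<dots> = ?\<rho> * ?b" by (simp only: sum_distrib_right)
  finally have b: "?b \<le> ?c + ?\<rho> * ?b" by (simp add: add_left_mono)
  \<comment> \<open>Finiteness for each fixed \<open>e\<close> is what permits
    \<open>?\<rho> * ?b\<close> to be moved to the left-hand side.\<close>
  have fin: "?b < \<infinity>" by (rule expect_time_finite[OF Q])
  obtain B where B: "?b = ennreal B" "0 \<le> B" using fin by (cases ?b) auto
  obtain R where R: "?\<rho> = ennreal R" "0 \<le> R" using rho by (cases ?\<rho>) (auto simp: top_unique)
  have R1: "R < 1" using rho R by (simp add: ennreal_less_iff flip: ennreal_1)
  have l0: "0 < lam 0" by (rule lam[OF n])
  have "ennreal B \<le> ennreal (1 / lam 0 + R * B)"
    using b B R l0 unfolding B(1) R(1) by (simp add: ennreal_mult[symmetric] ennreal_plus[symmetric] del: ennreal_plus)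
  then have "B \<le> 1 / lam 0 + R * B" using B R l0 by (subst (asm) ennreal_le_iff) (auto intro!: add_nonneg_nonneg)
  then have "B * (1 - R) \<le> 1 / lam 0" by (simp add: algebra_simps)
  then have "B \<le> (1 / lam 0) / (1 - R)" by (subst pos_le_divide_eq) (use R1 in simp_all)
  moreover have "1 - ?\<rho> = ennreal (1 - R)" unfolding R(1) ennreal_1[symmetric] using R(2) by (rule ennreal_minus)
  moreover have "ennreal (1 / lam 0) / ennreal (1 - R) = ennreal ((1 / lam 0) / (1 - R))"
    using R1 l0 by (intro divide_ennreal) auto
  ultimately show ?thesis unfolding B(1) by (simp add: ennreal_leI)
qed

text \<open>The majorant is the lower limit of \<open>progress\<close>, to which Fatou's lemma
  applies with a bound uniform in \<open>e\<close>. Being measurable, it can be carried over to the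
  original probability space in place of \<open>return_time\<close>.\<close>

lemma expect_return_bound:
  assumes r: "\<And>k \<theta>. k < n \<Longrightarrow> 0 < \<theta> \<Longrightarrow> (\<E> x. loss \<theta> k x) \<le> r k"
    and rho: "(\<Sum>k<n. ennreal (lam k) * r k) < 1"
  obtains g where "g \<in> borel_measurable P" "\<And>x. regular n x \<Longrightarrow> return_time n x \<le> g x" "(\<E> x. g x) < \<infinity>"
proof -
  note Q = discrete_returned
  have C [measurable]: "(\<lambda>x. cnt (run returned n x e) k) \<in> measurable P (count_space UNIV)" for k e
    by (rule measurable_cnt[OF Q])
  have T [measurable]: "(\<lambda>x. time (run returned n x e)) \<in> borel_measurable P" for e by (rule measurable_time[OF Q])
  have fm [measurable]: "(\<lambda>x. progress n x e) \<in> borel_measurable P" for e unfolding progress_def by measurable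
  let ?K = "ennreal (1 / lam 0) / (1 - (\<Sum>k<n. ennreal (lam k) * r k))"
  have K: "?K < \<infinity>" using rho by (simp add: ennreal_divide_eq_top_iff less_top[symmetric] diff_eq_0_iff_ennreal not_le)
  let ?B = "?K + (\<Sum>i<n. ennreal (lam i) * ?K)"
  have fB: "(\<E> x. progress n x e) \<le> ?B" for e
  proof -
    have "(\<E> x. progress n x e) = (\<E> x. ennreal (time (run returned n x e))) + (\<E> x. (\<Sum>i<n. of_nat (cnt (run returned n x e) i)))"
      unfolding progress_def by (rule nn_integral_add) measurable
    also have "(\<E> x. (\<Sum>i<n. of_nat (cnt (run returned n x e) i))) = (\<Sum>i<n. \<E> x. of_nat (cnt (run returned n x e) i))"
      by (rule nn_integral_sum) measurable
    also have "\<dots> = (\<Sum>i<n. ennreal (lam i) * (\<E> x. ennreal (time (run returned n x e))))"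
      by (intro sum.cong refl expect_cnt[OF _ Q]) simp
    also have "(\<E> x. ennreal (time (run returned n x e))) + \<dots> \<le> ?B"
      by (intro add_mono sum_mono mult_left_mono expect_time_le[OF r rho]) simp_all
    finally show ?thesis .
  qed
  have "(\<E> x. liminf (progress n x)) \<le> liminf (\<lambda>e. \<E> x. progress n x e)" by (rule nn_integral_liminf[OF fm])
  also have "\<dots> \<le> liminf (\<lambda>e. ?B)" by (intro Liminf_mono always_eventually allI fB)
  also have "\<dots> = ?B" by (rule Liminf_const) simp
  also have "\<dots> < \<infinity>" using K by (auto simp: ennreal_mult_less_top less_top)
  finally have 3: "(\<E> x. liminf (progress n x)) < \<infinity>" .
  show ?thesis
  proof (rule that[of "\<lambda>x. liminf (progress n x)"])
    show "return_time n x \<le> liminf (progress n x)" if "regular n x" for x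
      by (rule return_time_le_liminf[OF n that])
  qed (use 3 in measurable)
qed

end

section \<open>Transfer to the given probability space\<close>

theorem mainTheorem4:
  fixes M :: "'a measure" and X :: "src \<Rightarrow> 'a \<Rightarrow> real"
    and n :: nat and lam :: "nat \<Rightarrow> real"
  assumes "prob_space M"
    and "0 < n"
    and "\<forall>i<n. 0 < lam i"
    and "prob_space.indep_vars M (\<lambda>_. borel) X UNIV"
    and "\<forall>i<n. \<forall>m. distributed M lborel (X (IA i m)) (\<lambda>t. ennreal (exponential_density (lam i) t))"
    and "\<forall>i<n. \<forall>m. distr M borel (X (Sz i m)) = distr M borel (X (Sz i 0))"
    and "\<forall>i<n. \<forall>m. AE \<omega> in M. 0 < X (Sz i m) \<omega>"
    and "\<forall>k<n. \<forall>m p. distr M borel (X (Ps k m p)) = distr M borel (X (Ps k 0 0))"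
    and "\<forall>k<n. \<forall>m p. AE \<omega> in M. 0 \<le> X (Ps k m p) \<omega>"
    and "\<forall>k<n. \<forall>m p. distr M borel (X (Rs k m p)) = distr M borel (X (Rs k 0 0))"
    and "\<forall>k<n. \<forall>m p. AE \<omega> in M. 0 \<le> X (Rs k m p) \<omega>"
    and "eff_load M n lam X < 1"
  shows "positive_recurrent M n X"
proof -
  interpret MS: prob_space M by fact
  define \<mu> where "\<mu> s = distr M borel (X s)" for s
  have rv: "X s \<in> borel_measurable M" for s
    using assms(4) unfolding MS.indep_vars_def by simp
  have XP: "(\<lambda>\<omega> s. X s \<omega>) \<in> measurable M (PiM UNIV \<mu>)"
    by (rule measurable_PiM_single') (use rv in \<open>auto simp: \<mu>_def\<close>)
  have exp: "distr M borel (X (IA i m)) = expm (lam i)" if "i < n" for i m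
  proof -
    have "distr M lborel (X (IA i m)) = expm (lam i)"
      using assms(5) that unfolding distributed_def by blast
    moreover have "distr M lborel (X (IA i m)) = distr M borel (X (IA i m))" by (rule distr_cong) simp_all
    ultimately show ?thesis by simp
  qed
  interpret inputs n lam \<mu>
  proof (rule inputs.intro)
    show "prob_space (\<mu> s)" for s unfolding \<mu>_def by (rule MS.prob_space_distr[OF rv])
    show "\<mu> (IA i m) = expm (lam i)" if "i < n" for i m unfolding \<mu>_def by (rule exp[OF that])
    show "AE y in \<mu> (Sz i m). 0 < y" if "i < n" for i m
      using assms(7) that rv unfolding \<mu>_def by (subst AE_distr_iff) auto
    show "AE y in \<mu> (Ps i m p). 0 \<le> y" if "i < n" for i m p
      using assms(9) that rv unfolding \<mu>_def by (subst AE_distr_iff) auto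
    show "AE y in \<mu> (Rs i m p). 0 \<le> y" if "i < n" for i m p
      using assms(11) that rv unfolding \<mu>_def by (subst AE_distr_iff) auto
    show "\<mu> (Sz i m) = \<mu> (Sz i 0)" if "i < n" for i m unfolding \<mu>_def using assms(6) that by blast
    show "\<mu> (Ps i m p) = \<mu> (Ps i 0 0)" if "i < n" for i m p unfolding \<mu>_def using assms(8) that by blast
    show "\<mu> (Rs i m p) = \<mu> (Rs i 0 0)" if "i < n" for i m p unfolding \<mu>_def using assms(10) that by blast
    show "0 < lam i" if "i < n" for i using assms(3) that by blast
    show "sets (\<mu> s) = sets borel" for s by (simp add: \<mu>_def)
  qed (rule assms(2))
  \<comment> \<open>Independence of all inputs says precisely that their joint law is the product of
    the marginal laws.\<close>
  have law: "distr M P (\<lambda>\<omega> s. X s \<omega>) = P"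
  proof -
    have "distr M (PiM UNIV (\<lambda>_. borel)) (\<lambda>\<omega>. \<lambda>s\<in>UNIV. X s \<omega>) = P"
      using assms(4) MS.indep_vars_iff_distr_eq_PiM[where I = UNIV and M' = "\<lambda>_. borel" and X = X] rv unfolding \<mu>_def by simp
    moreover have "distr M P (\<lambda>\<omega> s. X s \<omega>) = distr M (PiM UNIV (\<lambda>_. borel)) (\<lambda>\<omega>. \<lambda>s\<in>UNIV. X s \<omega>)"
      by (rule distr_cong[OF refl]) (auto simp: \<mu>_def intro!: sets_PiM_cong)
    ultimately show ?thesis by simp
  qed
  have transfer: "(\<integral>\<^sup>+x. g x \<partial>P) = (\<integral>\<^sup>+\<omega>. g (\<lambda>s. X s \<omega>) \<partial>M)" if "g \<in> borel_measurable P" for g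
    using nn_integral_distr[OF XP, of g] that law by simp
  have reg: "AE \<omega> in M. regular n (\<lambda>s. X s \<omega>)"
    by (rule AE_distrD[OF XP]) (subst law, rule AE_regular)
  define r where "r k = (\<integral>\<^sup>+\<omega>. eff_size n (\<lambda>s. X s \<omega>) (k, 0) \<partial>M)" for k
  have r: "(\<integral>\<^sup>+x. loss \<theta> k x \<partial>P) \<le> r k" if "k < n" "0 < \<theta>" for k \<theta>
    unfolding transfer[OF loss_measurable] r_def using reg
    by (intro nn_integral_mono_AE, eventually_elim) (rule loss_le_eff_size[OF _ that(2)])
  have rho: "(\<Sum>k<n. ennreal (lam k) * r k) < 1" using assms(12) unfolding eff_load_def r_def .
  show ?thesis
  proof (rule expect_return_bound[OF r rho])
    fix g
    assume g: "g \<in> borel_measurable P" "\<And>x. regular n x \<Longrightarrow> return_time n x \<le> g x" "(\<integral>\<^sup>+x. g x \<partial>P) < \<infinity>"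
    have "(\<integral>\<^sup>+\<omega>. return_time n (\<lambda>s. X s \<omega>) \<partial>M) \<le> (\<integral>\<^sup>+\<omega>. g (\<lambda>s. X s \<omega>) \<partial>M)"
      using reg by (intro nn_integral_mono_AE, eventually_elim) (rule g(2))
    also have "\<dots> < \<infinity>" using g(3) transfer[OF g(1)] by simp
    finally show ?thesis unfolding positive_recurrent_def .
  qed
qed

end
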